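(* Let $n\ge2$ and $K\ge1$, and let $f:\mathbb{B}^n\to\mathbb{R}^n$ be a $K$-quasiregular mapping with $f(0)=0$ and $$\int_{\mathbb{B}^n}J(x,f)\,dx\le\alpha_n.$$ Then $$\int_{\mathbb{S}^{n-1}}\exp\left(\beta|f^\star(\zeta)|^{\frac{n}{n-1}}\right)d\mathcal{H}_{n-1}(\zeta)<\infty$$ for every $\beta>0$, where $f^\star(\zeta)=\lim_{t\uparrow1}f(t\zeta)$ for $\mathcal{H}_{n-1}$-a.e. $\zeta\in\mathbb{S}^{n-1}$.
   Context: $\mathbb{B}^n$ is the open unit ball of $\mathbb{R}^n$, $\mathbb{S}^{n-1}$ is the unit sphere, $\mathcal{H}_{n-1}$ is $(n-1)$-dimensional Hausdorff measure, and $\alpha_n$ is the volume of $\mathbb{B}^n$. For an open set $\Omega\subset\mathbb{R}^n$ and $K\ge1$, a mapping $f:\Omega\to\mathbb{R}^n$ is called $K$-quasiregular if it belongs to the Sobolev class $W^{1,n}_{loc}(\Omega,\mathbb{R}^n)$ and satisfies $\|Df(x)\|^n\le K J(x,f)$ for almost every $x\in\Omega$, where $\|Df(x)\|$ is the operator norm of the derivative matrix $Df(x)$ and $J(x,f)=\det Df(x)$. Quasiregular mappings are continuous (i.e. taken to be the continuous representative). It is a known fact that a quasiregular mapping $f:\mathbb{B}^n\to\mathbb{R}^n$ with $\int_{\mathbb{B}^n}J(x,f)\,dx\le\alpha_n$ has radial limits at $\mathcal{H}_{n-1}$-a.e. $\zeta\in\mathbb{S}^{n-1}$, so $f^\star$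 is well defined. *)

theory Defs
  imports "HOL-Analysis.Analysis"
begin

section \<open>Hausdorff measure\<close>

text \<open>
  The normalisation \<open>\<alpha>\<^sub>m (diam U / 2)\<^sup>m\<close> makes the \<open>m\<close>-dimensional Hausdorff measure agree with
  Lebesgue measure on \<open>m\<close>-dimensional Euclidean space. The case distinction keeps the empty set at
  weight \<open>0\<close> for \<open>m = 0\<close>. Boundedness is required of covering sets because
  \<^const>\<open>diameter\<close> has no meaningful value on unbounded sets.
\<close>

definition hausdorff_weight :: "nat \<Rightarrow> 'a::metric_space set \<Rightarrow> ennreal" where
  "hausdorff_weight m U =
     (if U = {} then 0 else ennreal (unit_ball_vol (real m) * (diameter U / 2) ^ m))"

definition hausdorff_premeasure :: "nat \<Rightarrow> real \<Rightarrow> 'a::metric_space set \<Rightarrow> ennreal" where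
  "hausdorff_premeasure m \<delta> A =
     (INF U \<in> {U :: nat \<Rightarrow> 'a set. A \<subseteq> (\<Union>i. U i) \<and> (\<forall>i. bounded (U i) \<and> diameter (U i) \<le> \<delta>)}.
        \<Sum>i. hausdorff_weight m (U i))"

definition hausdorff_outer_measure :: "nat \<Rightarrow> 'a::metric_space set \<Rightarrow> ennreal" where
  "hausdorff_outer_measure m A = (SUP \<delta> \<in> {0<..}. hausdorff_premeasure m \<delta> A)"

definition hausdorff_measure :: "nat \<Rightarrow> 'a::metric_space measure" where
  "hausdorff_measure m =
     measure_of UNIV (lambda_system UNIV (Pow UNIV) (hausdorff_outer_measure m))
       (hausdorff_outer_measure m)"

text \<open>
  Since \<^const>\<open>measure_of\<close> yields the zero measure when its arguments do not form a measure space, we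
  check that they do.
\<close>

lemma hausdorff_premeasure_empty:
  assumes "\<delta> > 0"
  shows "hausdorff_premeasure m \<delta> ({} :: 'a::metric_space set) = 0"
proof -
  have "hausdorff_premeasure m \<delta> ({} :: 'a set) \<le> (\<Sum>i::nat. hausdorff_weight m ({} :: 'a set))"
    unfolding hausdorff_premeasure_def using assms
    by (intro INF_lower2[of "\<lambda>_. {}"]) auto
  then show ?thesis
    by (simp add: hausdorff_weight_def)
qed

lemma hausdorff_premeasure_mono:
  "A \<subseteq> B \<Longrightarrow> hausdorff_premeasure m \<delta> A \<le> hausdorff_premeasure m \<delta> B"
  unfolding hausdorff_premeasure_def by (intro INF_superset_mono) auto

lemma hausdorff_premeasure_countably_subadditive:
  fixes A :: "nat \<Rightarrow> 'a::metric_space set"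
  shows "hausdorff_premeasure m \<delta> (\<Union>i. A i) \<le> (\<Sum>i. hausdorff_premeasure m \<delta> (A i))"
proof (rule ennreal_le_epsilon)
  fix e :: real
  assume e: "e > 0" and fin: "(\<Sum>i. hausdorff_premeasure m \<delta> (A i)) < top"
  define covers where
    "covers X = {U :: nat \<Rightarrow> 'a set. X \<subseteq> (\<Union>i. U i) \<and> (\<forall>i. bounded (U i) \<and> diameter (U i) \<le> \<delta>)}"
    for X
  have pre: "hausdorff_premeasure m \<delta> X = (INF U\<in>covers X. \<Sum>i. hausdorff_weight m (U i))" for X
    unfolding hausdorff_premeasure_def covers_def ..
  have "\<exists>U \<in> covers (A i). (\<Sum>k. hausdorff_weight m (U k)) \<le>
          hausdorff_premeasure m \<delta> (A i) + ennreal (e * (1/2) ^ Suc i)" for i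
  proof -
    have "hausdorff_premeasure m \<delta> (A i) < top"
      using fin ennreal_suminf_lessD by blast
    moreover have "ennreal (e * (1/2) ^ Suc i) > 0"
      using e by simp
    ultimately have "hausdorff_premeasure m \<delta> (A i) <
        hausdorff_premeasure m \<delta> (A i) + ennreal (e * (1/2) ^ Suc i)"
      using ennreal_add_left_cancel_less[of "hausdorff_premeasure m \<delta> (A i)" 0
          "ennreal (e * (1/2) ^ Suc i)"]
      by (simp only: add_0_right infinity_ennreal_def less_top simp_thms)
    then show ?thesis
      unfolding pre[of "A i"] INF_less_iff using less_imp_le by blast
  qed
  then obtain U where U: "\<And>i. U i \<in> covers (A i)"
    and U_le: "\<And>i. (\<Sum>k. hausdorff_weight m (U i k)) \<le>
          hausdorff_premeasure m \<delta> (A i) + ennreal (e * (1/2) ^ Suc i)"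
    by metis
  define V where "V = case_prod U \<circ> prod_decode"
  have "(\<Union>i. A i) \<subseteq> (\<Union>n. V n)"
  proof
    fix x assume "x \<in> (\<Union>i. A i)"
    then obtain i k where "x \<in> U i k"
      using U unfolding covers_def by blast
    then have "x \<in> V (prod_encode (i, k))"
      by (simp add: V_def)
    then show "x \<in> (\<Union>n. V n)" by blast
  qed
  moreover have "bounded (V n) \<and> diameter (V n) \<le> \<delta>" for n
  proof -
    have "V n = U (fst (prod_decode n)) (snd (prod_decode n))"
      by (simp add: V_def case_prod_beta)
    then show ?thesis
      using U[of "fst (prod_decode n)"] unfolding covers_def by simp
  qed
  ultimately have "V \<in> covers (\<Union>i. A i)"
    unfolding covers_def by blast
  then have "hausdorff_premeasure m \<delta> (\<Union>i. A i) \<le> (\<Sum>n. hausdorff_weight m (V n))"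
    unfolding pre by (rule INF_lower)
  also have "\<dots> = (\<Sum>i. \<Sum>k. hausdorff_weight m (U i k))"
    using suminf_ennreal_2dimen[of "\<lambda>i. \<Sum>k. hausdorff_weight m (U i k)"
        "\<lambda>(i, k). hausdorff_weight m (U i k)"]
    by (simp add: V_def comp_def case_prod_unfold)
  also have "\<dots> \<le> (\<Sum>i. hausdorff_premeasure m \<delta> (A i) + ennreal (e * (1/2) ^ Suc i))"
    by (intro suminf_le U_le) auto
  also have "\<dots> = (\<Sum>i. hausdorff_premeasure m \<delta> (A i)) + (\<Sum>i. ennreal (e * (1/2) ^ Suc i))"
    by (intro suminf_add[symmetric]) auto
  also have "(\<Sum>i. ennreal (e * (1/2) ^ Suc i)) = ennreal e"
  proof (rule suminf_ennreal_eq)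
    show "0 \<le> e * (1/2) ^ Suc i" for i using e by simp
    show "(\<lambda>i. e * (1/2) ^ Suc i) sums e"
      using sums_mult[OF power_half_series, of e] by simp
  qed
  finally show "hausdorff_premeasure m \<delta> (\<Union>i. A i) \<le>
      (\<Sum>i. hausdorff_premeasure m \<delta> (A i)) + ennreal e" .
qed

lemma outer_measure_space_hausdorff:
  "outer_measure_space (Pow UNIV) (hausdorff_outer_measure m :: 'a::metric_space set \<Rightarrow> ennreal)"
  unfolding outer_measure_space_def
proof (intro conjI)
  show "positive (Pow UNIV) (hausdorff_outer_measure m :: 'a set \<Rightarrow> ennreal)"
    unfolding positive_def hausdorff_outer_measure_def
    by (simp add: hausdorff_premeasure_empty)
  show "increasing (Pow UNIV) (hausdorff_outer_measure m :: 'a set \<Rightarrow> ennreal)"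
    unfolding increasing_def hausdorff_outer_measure_def
    by (auto intro!: SUP_mono' hausdorff_premeasure_mono)
  show "countably_subadditive (Pow UNIV) (hausdorff_outer_measure m :: 'a set \<Rightarrow> ennreal)"
    unfolding countably_subadditive_def
  proof safe
    fix A :: "nat \<Rightarrow> 'a set"
    have "hausdorff_premeasure m \<delta> (\<Union>i. A i) \<le> (\<Sum>i. hausdorff_outer_measure m (A i))"
      if "\<delta> > 0" for \<delta>
    proof -
      have "hausdorff_premeasure m \<delta> (\<Union>i. A i) \<le> (\<Sum>i. hausdorff_premeasure m \<delta> (A i))"
        by (rule hausdorff_premeasure_countably_subadditive)
      also have "\<dots> \<le> (\<Sum>i. hausdorff_outer_measure m (A i))"
        unfolding hausdorff_outer_measure_def using that
        by (intro suminf_le SUP_upper) auto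
      finally show ?thesis .
    qed
    then show "hausdorff_outer_measure m (\<Union>i. A i) \<le> (\<Sum>i. hausdorff_outer_measure m (A i))"
      unfolding hausdorff_outer_measure_def[of m "\<Union>i. A i"] by (intro SUP_least) auto
  qed
qed

lemma measure_space_hausdorff:
  "measure_space UNIV (lambda_system UNIV (Pow UNIV) (hausdorff_outer_measure m))
     (hausdorff_outer_measure m :: 'a::metric_space set \<Rightarrow> ennreal)"
  using sigma_algebra.caratheodory_lemma[OF sigma_algebra_Pow outer_measure_space_hausdorff] .

lemma space_hausdorff_measure [simp]: "space (hausdorff_measure m) = UNIV"
  by (simp add: hausdorff_measure_def space_measure_of_conv)

lemma sets_hausdorff_measure:
  "sets (hausdorff_measure m :: 'a::metric_space measure) =
     lambda_system UNIV (Pow UNIV) (hausdorff_outer_measure m)"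
proof -
  have "sigma_algebra UNIV (lambda_system UNIV (Pow UNIV)
          (hausdorff_outer_measure m :: 'a set \<Rightarrow> ennreal))"
    using measure_space_hausdorff unfolding measure_space_def by blast
  then show ?thesis
    unfolding hausdorff_measure_def by (rule sigma_algebra.sets_measure_of_eq)
qed

lemma emeasure_hausdorff_measure:
  assumes "A \<in> sets (hausdorff_measure m :: 'a::metric_space measure)"
  shows "emeasure (hausdorff_measure m) A = hausdorff_outer_measure m A"
proof -
  note ms = measure_space_hausdorff[of m, where 'a = 'a, unfolded measure_space_def]
  show ?thesis
    unfolding hausdorff_measure_def
    by (rule emeasure_measure_of_sigma[OF ms[THEN conjunct1] ms[THEN conjunct2, THEN conjunct1]
          ms[THEN conjunct2, THEN conjunct2] assms[unfolded sets_hausdorff_measure]])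
qed


section \<open>Weak derivatives and local Sobolev spaces\<close>

primrec C_k :: "nat \<Rightarrow> (real^'n \<Rightarrow> real) \<Rightarrow> bool" where
  "C_k 0 \<phi> \<longleftrightarrow> continuous_on UNIV \<phi>"
| "C_k (Suc k) \<phi> \<longleftrightarrow> \<phi> differentiable_on UNIV \<and>
     (\<forall>v. C_k k (\<lambda>x. frechet_derivative \<phi> (at x) v))"

definition test_function :: "(real^'n) set \<Rightarrow> (real^'n \<Rightarrow> real) \<Rightarrow> bool" where
  "test_function \<Omega> \<phi> \<longleftrightarrow>
     (\<forall>k. C_k k \<phi>) \<and> compact (closure {x. \<phi> x \<noteq> 0}) \<and> closure {x. \<phi> x \<noteq> 0} \<subseteq> \<Omega>"

definition locally_Lp ::
  "nat \<Rightarrow> 'a::euclidean_space set \<Rightarrow> ('a \<Rightarrow> 'b::euclidean_space) \<Rightarrow> bool" where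
  "locally_Lp p \<Omega> f \<longleftrightarrow>
     set_borel_measurable lebesgue \<Omega> f \<and>
     (\<forall>C. compact C \<and> C \<subseteq> \<Omega> \<longrightarrow> set_integrable lebesgue C (\<lambda>x. norm (f x) ^ p))"

text \<open>The entry \<open>D x $ i $ j\<close> is the weak partial derivative of the \<open>i\<close>-th component in direction \<open>j\<close>.\<close>

definition has_weak_derivative ::
  "(real^'n \<Rightarrow> real^'m) \<Rightarrow> (real^'n \<Rightarrow> real^'n^'m) \<Rightarrow> (real^'n) set \<Rightarrow> bool" where
  "has_weak_derivative f D \<Omega> \<longleftrightarrow>
     locally_Lp 1 \<Omega> f \<and> locally_Lp 1 \<Omega> D \<and>
     (\<forall>\<phi> i j. test_function \<Omega> \<phi> \<longrightarrow>
        (LINT x:\<Omega>|lebesgue. f x $ i * frechet_derivative \<phi> (at x) (axis j 1)) =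
        - (LINT x:\<Omega>|lebesgue. D x $ i $ j * \<phi> x))"

text \<open>Weak derivatives are unique up to null sets, so the choice of representative is immaterial.\<close>

definition weak_derivative ::
  "(real^'n) set \<Rightarrow> (real^'n \<Rightarrow> real^'m) \<Rightarrow> real^'n \<Rightarrow> real^'n^'m" where
  "weak_derivative \<Omega> f = (SOME D. has_weak_derivative f D \<Omega>)"

definition sobolev_W1p_loc :: "nat \<Rightarrow> (real^'n) set \<Rightarrow> (real^'n \<Rightarrow> real^'m) \<Rightarrow> bool" where
  "sobolev_W1p_loc p \<Omega> f \<longleftrightarrow>
     locally_Lp p \<Omega> f \<and> (\<exists>D. has_weak_derivative f D \<Omega>) \<and> locally_Lp p \<Omega> (weak_derivative \<Omega> f)"


section \<open>Quasiregular mappings and radial limits\<close>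

definition weak_jacobian :: "(real^'n) set \<Rightarrow> (real^'n \<Rightarrow> real^'n) \<Rightarrow> real^'n \<Rightarrow> real" where
  "weak_jacobian \<Omega> f x = det (weak_derivative \<Omega> f x)"

definition quasiregular :: "real \<Rightarrow> (real^'n) set \<Rightarrow> (real^'n \<Rightarrow> real^'n) \<Rightarrow> bool" where
  "quasiregular K \<Omega> f \<longleftrightarrow>
     continuous_on \<Omega> f \<and> sobolev_W1p_loc CARD('n) \<Omega> f \<and>
     (AE x in lebesgue. x \<in> \<Omega> \<longrightarrow>
        onorm ((*v) (weak_derivative \<Omega> f x)) ^ CARD('n) \<le> K * weak_jacobian \<Omega> f x)"

definition has_radial_limit ::
  "('a::real_normed_vector \<Rightarrow> 'b::topological_space) \<Rightarrow> 'b \<Rightarrow> 'a \<Rightarrow> bool" where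
  "has_radial_limit f l \<zeta> \<longleftrightarrow> ((\<lambda>t. f (t *\<^sub>R \<zeta>)) \<longlongrightarrow> l) (at_left (1::real))"

definition radial_limit :: "('a::real_normed_vector \<Rightarrow> 'b::t2_space) \<Rightarrow> 'a \<Rightarrow> 'b" where
  "radial_limit f \<zeta> = Lim (at_left (1::real)) (\<lambda>t. f (t *\<^sub>R \<zeta>))"

end

theory Submission
  imports Defs
begin

text \<open>
  The quasiregularity inequality and the bound on the integral of the Jacobian give
  \<open>\<integral> \<parallel>Df\<parallel>\<^sup>n < \<infinity>\<close> over the unit ball, so \<open>f\<close> is a continuous map with weak derivative in
  \<open>L\<^sup>n\<close>. For every such map exponential integrability of order
  \<open>n / (n - 1)\<close> holds for every \<open>\<beta>\<close>: near the sphere the energy of \<open>f\<close> is as small as we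
  please, while further inside \<open>f\<close> is bounded, and the constant in the exponential estimate of
  Trudinger and Moser is governed by the small energy alone.

  The weak derivative enters through a single inequality. Let \<open>g\<close> be the sum of the absolute
  values of the entries of \<open>Df\<close>. Mollifying \<open>f\<close> and using the weak derivative against the
  mollifier bounds the increment of \<open>f\<close> along any segment, up to an arbitrarily small error,
  by an average over small translations of the line integral of \<open>g\<close>
  (\<open>mollified_upper_gradient_weak_derivative\<close>). Every estimate below is
  an integral over a family of segments that is insensitive to translation, so it passes through
  the average with no loss and no limit of mollifications is ever taken.

  Along radii the integral of \<open>g\<close> is finite in the mean. Hence the oscillation of \<open>f\<close> on a radius
  close to the sphere is small for most radii, which gives radial limits almost everywhere
  (\<open>AE_radial_limit\<close>).

  For the exponential estimate let \<open>X\<close> be a set of directions, thickened to a subset of a shell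
  and of measure \<open>m\<close>, on which \<open>|f|\<close> exceeds \<open>M + \<mu>\<close> at radius \<open>r\<close>, where \<open>M\<close> bounds \<open>|f|\<close> on
  a ball outside which the energy is at most \<open>\<epsilon>\<close>. Join the points of radius \<open>r\<close> over \<open>X\<close> to all
  points \<open>a\<close> of a small central ball. On each segment the part outside the ball of radius \<open>\<rho>\<close>
  carries an increment of at least \<open>\<mu>\<close>. With \<open>t\<close> the segment parameter, the elementary
  inequality \<open>g \<le> b + b\<^sup>1\<^sup>-\<^sup>n g\<^sup>n\<close> for \<open>b\<close> proportional to \<open>\<mu> \<tau> t\<^sup>\<tau>\<^sup>-\<^sup>1\<close> replaces the
  Hoelder inequality. Integrated over all segments, the second term becomes
  the integral of \<open>g\<^sup>n\<close> against a potential of the directions in \<open>X\<close>, with a weak singularity of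
  order \<open>(n - 1) \<tau>\<close>; this potential is at most a constant times \<open>m\<close> to the power
  \<open>1 - 2 (n - 1) \<tau>\<close> (\<open>nn_integral_radial_cone_segments\<close>). The outcome is the inequality of
  \<open>level_set_measure_le\<close>, and choosing \<open>\<tau>\<close> as a multiple of \<open>\<mu>\<close> to the power \<open>- n / (n - 1)\<close>
  turns it into \<open>m \<le> exp (- \<beta> \<mu>\<^sup>q)\<close> with \<open>q = n / (n - 1)\<close>, for any \<open>\<beta>\<close> once \<open>\<epsilon>\<close> is small
  (\<open>level_set_decay\<close>).

  Lebesgue measure in the shell controls Hausdorff measure on the sphere by a Vitali covering
  (\<open>hausdorff_outer_measure_le_cone\<close>), and a dyadic decomposition by level sets turns the decay
  into integrability. That decomposition is applied to the simple functions below the integrand,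
  so that outer measure bounds for level sets suffice and measurability of the radial limit never
  has to be discussed.
\<close>

section \<open>Smooth bump functions\<close>

text \<open>
  The factor \<open>inverse t ^ m\<close> makes the family closed, up to linear combinations, under
  differentiation.
\<close>

definition exp_flat :: "nat \<Rightarrow> real \<Rightarrow> real" where
  "exp_flat m t = (if t > 0 then exp (- inverse t) * inverse t ^ m else 0)"

lemma exp_flat_nonneg [simp]: "0 \<le> exp_flat m t"
  by (simp add: exp_flat_def)

lemma has_real_derivative_exp_flat:
  "(exp_flat m has_real_derivative exp_flat (m + 2) t - real m * exp_flat (m + 1) t) (at t)"
proof -
  consider "t > 0" | "t < 0" | "t = 0" by linarith
  then show ?thesis
  proof cases
    case 1
    have "((\<lambda>t. exp (- inverse t) * inverse t ^ m) has_real_derivative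
        exp_flat (m + 2) t - real m * exp_flat (m + 1) t) (at t)"
      using 1 by (auto intro!: derivative_eq_intros simp: exp_flat_def power_Suc[symmetric]
          field_simps simp del: power_Suc)
         (cases m; simp add: field_simps power2_eq_square)+
    then show ?thesis
      by (rule has_field_derivative_transform_within_open[where S = "{0<..}"])
         (use 1 in \<open>auto simp: exp_flat_def\<close>)
  next
    case 2
    have "((\<lambda>t. 0) has_real_derivative exp_flat (m + 2) t - real m * exp_flat (m + 1) t) (at t)"
      using 2 by (simp add: exp_flat_def)
    then show ?thesis
      by (rule has_field_derivative_transform_within_open[where S = "{..<0}"])
         (use 2 in \<open>auto simp: exp_flat_def\<close>)
  next
    case 3
    have "((\<lambda>x. x ^ Suc m / exp x) \<longlongrightarrow> (0::real)) at_top"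
      by (rule tendsto_power_div_exp_0)
    then have "((\<lambda>h. inverse h ^ Suc m / exp (inverse h)) \<longlongrightarrow> (0::real)) (at_right 0)"
      by (rule filterlim_compose[OF _ filterlim_inverse_at_top_right])
    moreover have "\<forall>\<^sub>F h in at_right 0. inverse h ^ Suc m / exp (inverse h)
        = (exp_flat m (0 + h) - exp_flat m 0) / (h::real)"
      by (auto simp: eventually_at_right_field exp_flat_def exp_minus field_simps intro!: exI[of _ 1])
    ultimately have r: "((\<lambda>h. (exp_flat m (0 + h) - exp_flat m 0) / h) \<longlongrightarrow> 0) (at_right 0)"
      by (rule Lim_transform_eventually)
    have "\<forall>\<^sub>F h in at_left 0. 0 = (exp_flat m (0 + h) - exp_flat m 0) / (h::real)"
      by (auto simp: eventually_at_left_field exp_flat_def intro!: exI[of _ "-1"])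
    then have l: "((\<lambda>h. (exp_flat m (0 + h) - exp_flat m 0) / h) \<longlongrightarrow> 0) (at_left 0)"
      by (rule Lim_transform_eventually[OF tendsto_const])
    have "((\<lambda>h. (exp_flat m (0 + h) - exp_flat m 0) / h) \<longlongrightarrow> 0) (at 0)"
      using l r by (simp add: filterlim_at_split)
    then show ?thesis
      using 3 by (simp add: DERIV_def exp_flat_def)
  qed
qed

lemma continuous_exp_flat: "continuous_on S (exp_flat m)"
  by (meson DERIV_isCont continuous_at_imp_continuous_on has_real_derivative_exp_flat)

text \<open>
  A class of functions, containing the bumps, that is stable under every directional derivative. Such
  stability gives derivatives of all orders at once, without a formula for any of them.
\<close>

inductive bump_algebra :: "('a::real_inner \<Rightarrow> real) \<Rightarrow> bool" where
  const: "bump_algebra (\<lambda>x. c)"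
| linear: "bump_algebra (\<lambda>x. x \<bullet> w)"
| flat: "bump_algebra (\<lambda>x. exp_flat m (c - (p - x) \<bullet> (p - x)))"
| add: "bump_algebra a \<Longrightarrow> bump_algebra b \<Longrightarrow> bump_algebra (\<lambda>x. a x + b x)"
| mult: "bump_algebra a \<Longrightarrow> bump_algebra b \<Longrightarrow> bump_algebra (\<lambda>x. a x * b x)"

lemma bump_algebra_derivative:
  "bump_algebra a \<Longrightarrow> \<exists>a'. (\<forall>x. (a has_derivative a' x) (at x)) \<and> (\<forall>v. bump_algebra (\<lambda>x. a' x v))"
proof (induction rule: bump_algebra.induct)
  case (const c)
  show ?case
    by (rule exI[of _ "\<lambda>_ _. 0"]) (auto intro: bump_algebra.const)
next
  case (linear w)
  show ?case
    by (rule exI[of _ "\<lambda>_ v. v \<bullet> w"]) (auto intro: bump_algebra.const intro!: derivative_eq_intros)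
next
  case (flat m c p)
  let ?q = "\<lambda>x. c - (p - x) \<bullet> (p - x)"
  let ?d = "\<lambda>x v. (exp_flat (m + 2) (?q x) + - real m * exp_flat (m + 1) (?q x)) *
              (2 * (p \<bullet> v) + -2 * (x \<bullet> v))"
  have "((\<lambda>x. exp_flat m (?q x)) has_derivative ?d x) (at x)" for x
  proof -
    have "(?q has_derivative (\<lambda>v. 2 * (p \<bullet> v) + -2 * (x \<bullet> v))) (at x)"
      by (auto intro!: derivative_eq_intros simp: inner_simps inner_commute algebra_simps)
    from has_derivative_compose[OF this
        has_real_derivative_exp_flat[of m "?q x", unfolded has_field_derivative_def]]
    show ?thesis by (simp add: mult_ac)
  qed
  moreover have "bump_algebra (\<lambda>x. ?d x v)" for v
    by (intro bump_algebra.mult bump_algebra.add bump_algebra.flat bump_algebra.const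
        bump_algebra.linear)
  ultimately show ?case by (intro exI[of _ ?d]) blast
next
  case (add a b)
  then obtain a' b' where "\<forall>x. (a has_derivative a' x) (at x)" "\<forall>v. bump_algebra (\<lambda>x. a' x v)"
      "\<forall>x. (b has_derivative b' x) (at x)" "\<forall>v. bump_algebra (\<lambda>x. b' x v)"
    by blast
  then show ?case
    by (intro exI[of _ "\<lambda>x v. a' x v + b' x v"])
       (auto intro!: has_derivative_add bump_algebra.add)
next
  case (mult a b)
  then obtain a' b' where "\<forall>x. (a has_derivative a' x) (at x)" "\<forall>v. bump_algebra (\<lambda>x. a' x v)"
      "\<forall>x. (b has_derivative b' x) (at x)" "\<forall>v. bump_algebra (\<lambda>x. b' x v)"
    by blast
  with mult.hyps show ?case
    by (intro exI[of _ "\<lambda>x v. a x * b' x v + a' x v * b x"])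
       (auto intro!: has_derivative_mult bump_algebra.add bump_algebra.mult)
qed

lemma bump_algebra_C_k: "bump_algebra a \<Longrightarrow> C_k k a"
proof (induction k arbitrary: a)
  case 0
  then show ?case
    by (fastforce dest!: bump_algebra_derivative intro: has_derivative_continuous
        continuous_at_imp_continuous_on)
next
  case (Suc k)
  then obtain a' where a': "\<And>x. (a has_derivative a' x) (at x)"
    and alg: "\<And>v. bump_algebra (\<lambda>x. a' x v)"
    using bump_algebra_derivative by blast
  have "frechet_derivative a (at x) = a' x" for x
    using frechet_derivative_at[OF a'] by simp
  then show ?case
    using a' Suc.IH[OF alg] by (auto simp: differentiable_on_def differentiable_def)
qed

definition bump :: "real \<Rightarrow> 'a::real_inner \<Rightarrow> real" where
  "bump r z = exp_flat 0 (r\<^sup>2 - z \<bullet> z)"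

definition bump_deriv :: "real \<Rightarrow> 'a::real_inner \<Rightarrow> 'a \<Rightarrow> real" where
  "bump_deriv r z v = - (exp_flat 2 (r\<^sup>2 - z \<bullet> z) * (2 * (z \<bullet> v)))"

lemma bump_nonneg [simp]: "0 \<le> bump r z"
  by (simp add: bump_def)

lemma bump_pos_iff:
  assumes "r > 0" shows "0 < bump r z \<longleftrightarrow> norm z < r"
proof -
  have "z \<bullet> z < r\<^sup>2 \<longleftrightarrow> norm z < r"
    using assms by (simp add: power2_norm_eq_inner[symmetric] power_less_imp_less_base
        order_less_le power_mono_iff abs_le_square_iff[symmetric] flip: abs_square_less_1)
  then show ?thesis by (simp add: bump_def exp_flat_def)
qed

lemma bump_eq_0_iff: "r > 0 \<Longrightarrow> bump r z = 0 \<longleftrightarrow> r \<le> norm z"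
  using bump_pos_iff[of r z] bump_nonneg[of r z] by linarith

lemma has_derivative_bump: "(bump r has_derivative bump_deriv r z) (at z)"
proof -
  have "((\<lambda>z. r\<^sup>2 - z \<bullet> z) has_derivative (\<lambda>v. - (2 * (z \<bullet> v)))) (at z)"
    by (auto intro!: derivative_eq_intros simp: inner_commute)
  from has_derivative_compose[OF this
      has_real_derivative_exp_flat[of 0 "r\<^sup>2 - z \<bullet> z", unfolded has_field_derivative_def]]
  show ?thesis
    unfolding bump_def bump_deriv_def by (simp add: mult_ac numeral_2_eq_2)
qed

lemma continuous_on_bump [continuous_intros]:
  "continuous_on S a \<Longrightarrow> continuous_on S (\<lambda>x. bump r (a x))"
  unfolding bump_def
  by (rule continuous_on_compose2[OF continuous_exp_flat[of UNIV]]) (auto intro!: continuous_intros)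

lemma continuous_on_bump_deriv [continuous_intros]:
  "continuous_on S a \<Longrightarrow> continuous_on S (\<lambda>x. bump_deriv r (a x) v)"
  unfolding bump_deriv_def
  by (intro continuous_intros continuous_on_compose2[OF continuous_exp_flat[of UNIV]]) auto

lemma test_function_bump:
  fixes x :: "real^'n"
  assumes r: "r > 0" and sub: "cball x r \<subseteq> \<Omega>"
  shows "test_function \<Omega> (\<lambda>y. bump r (x - y))"
proof -
  have "{y. bump r (x - y) \<noteq> 0} = ball x r"
    using r by (auto simp: bump_eq_0_iff dist_norm)
  then have "closure {y. bump r (x - y) \<noteq> 0} = cball x r"
    using r by simp
  then show ?thesis
    using sub unfolding test_function_def bump_def
    by (auto intro!: bump_algebra_C_k bump_algebra.flat)
qed

section \<open>Mollification and the weak derivative\<close>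

lemma ennreal_abs_integral_le:
  fixes f :: "'a \<Rightarrow> real"
  shows "ennreal \<bar>\<integral>x. f x \<partial>M\<bar> \<le> (\<integral>\<^sup>+x. ennreal \<bar>f x\<bar> \<partial>M)"
proof (cases "integrable M f")
  case True
  then show ?thesis using integral_norm_bound_ennreal[OF True] by simp
qed (simp add: not_integrable_integral_eq)

lemma bump_deriv_sum_axis:
  fixes v :: "real^'n"
  shows "bump_deriv r z v = (\<Sum>j\<in>UNIV. v $ j * bump_deriv r z (axis j 1))"
proof -
  have "z \<bullet> v = (\<Sum>j\<in>UNIV. v $ j * (z \<bullet> axis j 1))"
    by (simp add: inner_axis) (simp add: inner_vec_def mult.commute)
  then show ?thesis
    by (simp add: bump_deriv_def sum_distrib_left sum_negf mult_ac)
qed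

text \<open>
  The kernel is left unnormalised; its mass is divided out only once, when the mollification is
  compared with the function itself.
\<close>

definition mollification :: "real \<Rightarrow> (real^'n \<Rightarrow> real) \<Rightarrow> real^'n \<Rightarrow> real" where
  "mollification r u x = (LINT y:ball 0 1|lebesgue. u y * bump r (x - y))"

text \<open>
  Replaces integrals over the open ball, on which \<open>u\<close> is only continuous, by integrals of a bounded
  Borel function of compact support, to which Fubini applies.
\<close>

lemma cut_integral_eq:
  fixes u :: "real^'n \<Rightarrow> real"
  assumes u: "continuous_on (ball 0 1) u" and "0 \<le> R + r" "R + r < 1" "x \<in> cball 0 R"
    and k: "continuous_on UNIV k" and k0: "\<And>y. k y \<noteq> 0 \<Longrightarrow> norm (x - y) \<le> r"
  shows "(LINT y:ball 0 1|lebesgue. u y * k y) = (\<integral>y. (indicator (cball 0 (R + r)) y *\<^sub>R u y) * k y \<partial>lborel)"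
proof -
  have sub: "cball (0::real^'n) (R + r) \<subseteq> ball 0 1" using assms by auto
  have [measurable]: "(\<lambda>y. indicator (cball 0 (R + r)) y *\<^sub>R u y) \<in> borel_measurable borel"
    by (rule borel_measurable_continuous_on_indicator) (auto intro: continuous_on_subset[OF u sub])
  have [measurable]: "k \<in> borel_measurable borel"
    using k by (rule borel_measurable_continuous_onI)
  have "norm y \<le> R + r" if "k y \<noteq> 0" for y
    using k0[OF that] norm_triangle_ineq2[of y x] assms(4) by (simp add: norm_minus_commute)
  then have "indicator (ball 0 1) y *\<^sub>R (u y * k y) = (indicator (cball 0 (R + r)) y *\<^sub>R u y) * k y" for y
    using subsetD[OF sub, of y] by (cases "k y = 0") (auto simp: indicator_def)
  then have "(LINT y:ball 0 1|lebesgue. u y * k y) =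
      (\<integral>y. (indicator (cball 0 (R + r)) y *\<^sub>R u y) * k y \<partial>lebesgue)"
    unfolding set_lebesgue_integral_def by presburger
  also have "\<dots> = (\<integral>y. (indicator (cball 0 (R + r)) y *\<^sub>R u y) * k y \<partial>lborel)"
    by (rule integral_completion) measurable
  finally show ?thesis .
qed

lemma bump_deriv_eq_0: "r > 0 \<Longrightarrow> r \<le> norm z \<Longrightarrow> bump_deriv r z v = 0"
  using bump_eq_0_iff[of r z] by (auto simp: bump_def bump_deriv_def exp_flat_def split: if_splits)

lemma borel_measurable_weak_derivative_entry:
  assumes "has_weak_derivative f D \<Omega>"
  shows "(\<lambda>y. (indicator \<Omega> y *\<^sub>R D y) $ i $ j) \<in> borel_measurable lebesgue"
proof -
  have "(\<lambda>y. indicator \<Omega> y *\<^sub>R D y) \<in> borel_measurable lebesgue"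
    using assms unfolding has_weak_derivative_def locally_Lp_def set_borel_measurable_def by blast
  then have "(\<lambda>y. (indicator \<Omega> y *\<^sub>R D y) \<bullet> axis i (axis j 1)) \<in> borel_measurable lebesgue"
    by (rule borel_measurable_inner) simp
  then show ?thesis by (simp add: inner_axis)
qed

text \<open>
  A derivative falling on the mollifier is a derivative of a test function, so the definition of the
  weak derivative moves it onto \<open>f\<close>.
\<close>

lemma mollification_weak_derivative:
  fixes f :: "real^'n \<Rightarrow> real^'m"
  assumes cont: "continuous_on (ball 0 1) f" and wd: "has_weak_derivative f D (ball 0 1)"
    and r: "r > 0" "R + r < 1" "x \<in> cball 0 R"
  shows "ennreal \<bar>\<integral>y. (indicator (cball 0 (R + r)) y *\<^sub>R f y $ i) * bump_deriv r (x - y) v \<partial>lborel\<bar> \<le>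
     (\<integral>\<^sup>+y. ennreal (norm v * (\<Sum>j\<in>UNIV. \<bar>(indicator (ball 0 1) y *\<^sub>R D y) $ i $ j\<bar>) * bump r (x - y)) \<partial>lebesgue)"
proof -
  let ?c = "\<lambda>y. (indicator (cball 0 (R + r)) y *\<^sub>R f y $ i)"
  have R0: "0 \<le> R" using r(3) norm_ge_zero[of x] by (simp del: norm_ge_zero)
  have ci: "continuous_on (ball 0 1) (\<lambda>y. f y $ i)"
    using cont by (intro continuous_intros)
  let ?D = "\<lambda>y j. (indicator (ball 0 1) y *\<^sub>R D y) $ i $ j"
  have mD[measurable]: "(\<lambda>y. ?D y j) \<in> borel_measurable lebesgue" for j
    by (rule borel_measurable_weak_derivative_entry[OF wd])
  have mb[measurable]: "(\<lambda>y. bump r (x - y)) \<in> borel_measurable lebesgue"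
  proof -
    have "(\<lambda>y. bump r (x - y)) \<in> borel_measurable borel"
      by (intro borel_measurable_continuous_onI continuous_intros)
    then show ?thesis by (simp add: measurable_completion)
  qed
  have "cball x r \<subseteq> ball 0 1"
  proof
    fix y assume "y \<in> cball x r"
    then have "norm y \<le> R + r"
      using norm_triangle_ineq2[of y x] r(3) by (simp add: dist_norm norm_minus_commute)
    then show "y \<in> ball 0 1" using r(2) by simp
  qed
  then have tf: "test_function (ball 0 1) (\<lambda>y. bump r (x - y))"
    by (rule test_function_bump[OF r(1)])
  have fd: "frechet_derivative (\<lambda>y. bump r (x - y)) (at y) w = - bump_deriv r (x - y) w" for y w
  proof -
    have "((\<lambda>y. bump r (x - y)) has_derivative (\<lambda>w. bump_deriv r (x - y) (- w))) (at y)"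
      by (rule has_derivative_compose[OF _ has_derivative_bump]) (auto intro!: derivative_eq_intros)
    from frechet_derivative_at[OF this, symmetric] show ?thesis
      by (simp add: bump_deriv_def)
  qed
  have parts: "(\<integral>y. ?c y * bump_deriv r (x - y) (axis j 1) \<partial>lborel)
      = (LINT y:ball 0 1|lebesgue. D y $ i $ j * bump r (x - y))" for j
  proof -
    have "(\<integral>y. ?c y * bump_deriv r (x - y) (axis j 1) \<partial>lborel)
      = (LINT y:ball 0 1|lebesgue. f y $ i * bump_deriv r (x - y) (axis j 1))"
    proof (rule cut_integral_eq[symmetric, OF ci _ r(2,3)])
      show "norm (x - y) \<le> r" if "bump_deriv r (x - y) (axis j 1) \<noteq> 0" for y
        using that bump_deriv_eq_0[OF r(1), of "x - y" "axis j 1"] by linarith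
    qed (use r R0 in \<open>auto intro!: continuous_intros\<close>)
    also have "\<dots> = - (LINT y:ball 0 1|lebesgue. f y $ i * frechet_derivative (\<lambda>y. bump r (x - y)) (at y) (axis j 1))"
      by (simp add: fd set_lebesgue_integral_def)
    also have "\<dots> = (LINT y:ball 0 1|lebesgue. D y $ i $ j * bump r (x - y))"
      using wd tf unfolding has_weak_derivative_def by simp
    finally show ?thesis .
  qed
  have int: "integrable lborel (\<lambda>y. ?c y * bump_deriv r (x - y) w)" for w
  proof -
    have "integrable lborel (\<lambda>y. indicator (cball 0 (R + r)) y *\<^sub>R (f y $ i * bump_deriv r (x - y) w))"
    proof (rule borel_integrable_compact)
      have "cball (0::real^'n) (R + r) \<subseteq> ball 0 1" using r by auto
      then show "continuous_on (cball 0 (R + r)) (\<lambda>y. f y $ i * bump_deriv r (x - y) w)"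
        by (intro continuous_intros continuous_on_subset[OF ci])
    qed simp
    then show ?thesis by (simp add: mult.assoc)
  qed
  have "(\<integral>y. ?c y * bump_deriv r (x - y) v \<partial>lborel)
     = (\<integral>y. (\<Sum>j\<in>UNIV. v $ j * (?c y * bump_deriv r (x - y) (axis j 1))) \<partial>lborel)"
    by (subst bump_deriv_sum_axis) (simp add: sum_distrib_left mult_ac)
  also have "\<dots> = (\<Sum>j\<in>UNIV. v $ j * (LINT y:ball 0 1|lebesgue. D y $ i $ j * bump r (x - y)))"
    using int by (subst Bochner_Integration.integral_sum) (simp_all only: integral_mult_right_zero parts, auto)
  finally have eq: "(\<integral>y. ?c y * bump_deriv r (x - y) v \<partial>lborel) = \<dots>" .
  have "ennreal \<bar>\<dots>\<bar> \<le> ennreal (\<Sum>j\<in>UNIV. norm v * \<bar>LINT y:ball 0 1|lebesgue. D y $ i $ j * bump r (x - y)\<bar>)"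
    by (intro ennreal_leI order_trans[OF sum_abs] sum_mono)
       (auto simp: abs_mult intro!: mult_right_mono component_le_norm_cart)
  also have "\<dots> = (\<Sum>j\<in>UNIV. ennreal (norm v) * ennreal \<bar>LINT y:ball 0 1|lebesgue. D y $ i $ j * bump r (x - y)\<bar>)"
    by (simp add: sum_ennreal[symmetric] ennreal_mult)
  also have "\<dots> \<le> (\<Sum>j\<in>UNIV. ennreal (norm v) * (\<integral>\<^sup>+y. ennreal (\<bar>?D y j\<bar> * bump r (x - y)) \<partial>lebesgue))"
  proof (intro sum_mono mult_left_mono)
    fix j
    have "ennreal \<bar>LINT y:ball 0 1|lebesgue. D y $ i $ j * bump r (x - y)\<bar> \<le>
       (\<integral>\<^sup>+y. ennreal \<bar>indicator (ball 0 1) y *\<^sub>R (D y $ i $ j * bump r (x - y))\<bar> \<partial>lebesgue)"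
      unfolding set_lebesgue_integral_def by (rule ennreal_abs_integral_le)
    also have "\<dots> = (\<integral>\<^sup>+y. ennreal (\<bar>?D y j\<bar> * bump r (x - y)) \<partial>lebesgue)"
      by (intro nn_integral_cong) (auto simp: abs_mult)
    finally show "ennreal \<bar>LINT y:ball 0 1|lebesgue. D y $ i $ j * bump r (x - y)\<bar> \<le> \<dots>" .
  qed simp
  also have "\<dots> = (\<Sum>j\<in>UNIV. (\<integral>\<^sup>+y. ennreal (norm v * (\<bar>?D y j\<bar> * bump r (x - y))) \<partial>lebesgue))"
  proof (intro sum.cong refl)
    fix j
    have "(\<integral>\<^sup>+y. ennreal (norm v) * ennreal (\<bar>?D y j\<bar> * bump r (x - y)) \<partial>lebesgue) =
        ennreal (norm v) * (\<integral>\<^sup>+y. ennreal (\<bar>?D y j\<bar> * bump r (x - y)) \<partial>lebesgue)"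
      by (rule nn_integral_cmult) measurable
    then show "ennreal (norm v) * (\<integral>\<^sup>+y. ennreal (\<bar>?D y j\<bar> * bump r (x - y)) \<partial>lebesgue) =
        (\<integral>\<^sup>+y. ennreal (norm v * (\<bar>?D y j\<bar> * bump r (x - y))) \<partial>lebesgue)"
      by (simp add: ennreal_mult'')
  qed
  also have "\<dots> = (\<integral>\<^sup>+y. (\<Sum>j\<in>UNIV. ennreal (norm v * (\<bar>?D y j\<bar> * bump r (x - y)))) \<partial>lebesgue)"
    by (rule nn_integral_sum[symmetric]) measurable
  also have "\<dots> = (\<integral>\<^sup>+y. ennreal (norm v * (\<Sum>j\<in>UNIV. \<bar>?D y j\<bar>) * bump r (x - y)) \<partial>lebesgue)"
    by (intro nn_integral_cong) (simp add: sum_ennreal sum_distrib_left sum_distrib_right mult_ac)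
  finally show ?thesis unfolding eq .
qed

text \<open>
  The increment of the kernel between the two endpoints is the integral of its derivative along the
  segment; exchanging that integral with the convolution leaves, at each point of the segment, an
  integral bounded by the weak derivative.
\<close>

lemma mollification_increment:
  fixes f :: "real^'n \<Rightarrow> real^'m"
  assumes cont: "continuous_on (ball 0 1) f" and wd: "has_weak_derivative f D (ball 0 1)"
    and r: "r > 0" "R + r < 1" and t: "t1 \<le> t2"
    and seg: "p + t1 *\<^sub>R v \<in> cball 0 R" "p + t2 *\<^sub>R v \<in> cball 0 R"
  shows "ennreal \<bar>mollification r (\<lambda>y. f y $ i) (p + t2 *\<^sub>R v) - mollification r (\<lambda>y. f y $ i) (p + t1 *\<^sub>R v)\<bar>
    \<le> (\<integral>\<^sup>+t\<in>{t1..t2}. (\<integral>\<^sup>+y. ennreal (norm v * (\<Sum>j\<in>UNIV. \<bar>(indicator (ball 0 1) y *\<^sub>R D y) $ i $ j\<bar>)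
          * bump r (p + t *\<^sub>R v - y)) \<partial>lebesgue) \<partial>lborel)"
proof -
  have R0: "0 \<le> R" using seg(1) norm_ge_zero[of "p + t1 *\<^sub>R v"] by (simp del: norm_ge_zero)
  define c where "c y = indicator (cball 0 (R + r)) y *\<^sub>R f y $ i" for y
  have ci: "continuous_on (ball 0 1) (\<lambda>y. f y $ i)"
    using cont by (intro continuous_intros)
  have sub: "cball (0::real^'n) (R + r) \<subseteq> ball 0 1" using r by auto
  have mc[measurable]: "c \<in> borel_measurable borel"
    unfolding c_def
    by (rule borel_measurable_continuous_on_indicator) (auto intro: continuous_on_subset[OF ci sub])
  have mol: "mollification r (\<lambda>y. f y $ i) x = (\<integral>y. c y * bump r (x - y) \<partial>lborel)" if "x \<in> cball 0 R" for x
    unfolding mollification_def c_def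
  proof (rule cut_integral_eq[OF ci _ r(2) that])
    show "norm (x - y) \<le> r" if "bump r (x - y) \<noteq> 0" for y
      using that bump_eq_0_iff[OF r(1), of "x - y"] by linarith
  qed (use r R0 in \<open>auto intro!: continuous_intros\<close>)
  have seg_in: "p + t *\<^sub>R v \<in> cball 0 R" if "t \<in> {t1..t2}" for t
  proof -
    have "p + t *\<^sub>R v \<in> closed_segment (p + t1 *\<^sub>R v) (p + t2 *\<^sub>R v)"
    proof (cases "t1 = t2")
      case False
      define s where "s = (t - t1) / (t2 - t1)"
      have ts: "t = (1 - s) * t1 + s * t2"
      proof -
        have "s * (t2 - t1) = t - t1" using False by (simp add: s_def)
        then show ?thesis by (simp add: algebra_simps)
      qed
      have "p + t *\<^sub>R v = (1 - s) *\<^sub>R (p + t1 *\<^sub>R v) + s *\<^sub>R (p + t2 *\<^sub>R v)"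
        unfolding ts by (simp add: algebra_simps)
      moreover have "0 \<le> s" "s \<le> 1" using that False t by (auto simp: s_def field_simps)
      ultimately show ?thesis by (auto simp: in_segment)
    qed (use that in auto)
    then show ?thesis using seg convex_contains_segment[of "cball 0 R"] convex_cball by blast
  qed
  define F where "F t y = indicator {t1..t2} t * (c y * bump_deriv r (p + t *\<^sub>R v - y) v)" for t y
  have ftc: "(\<integral>t. F t y \<partial>lborel) = c y * (bump r (p + t2 *\<^sub>R v - y) - bump r (p + t1 *\<^sub>R v - y))" for y
  proof -
    have d: "((\<lambda>t. bump r (p + t *\<^sub>R v - y)) has_real_derivative bump_deriv r (p + t *\<^sub>R v - y) v) (at t)" for t
    proof -
      have "((\<lambda>t. p + t *\<^sub>R v - y) has_derivative (\<lambda>h. h *\<^sub>R v)) (at t)"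
        by (auto intro!: derivative_eq_intros)
      from has_derivative_compose[OF this has_derivative_bump[of r "p + t *\<^sub>R v - y"]]
      show ?thesis unfolding has_field_derivative_def
        by (rule has_derivative_eq_rhs) (auto simp: bump_deriv_def fun_eq_iff)
    qed
    have c: "continuous_on {t1..t2} (\<lambda>t. bump_deriv r (p + t *\<^sub>R v - y) v)"
      by (intro continuous_intros)
    have "isCont (\<lambda>t. bump_deriv r (p + t *\<^sub>R v - y) v) t" for t
    proof -
      have "continuous_on UNIV (\<lambda>t. bump_deriv r (p + t *\<^sub>R v - y) v)"
        by (intro continuous_intros)
      then show ?thesis by (simp add: continuous_on_eq_continuous_at)
    qed
    from integral_FTC_Icc_real[OF t d this]
    show ?thesis unfolding F_def
      by (simp add: mult.left_commute[of _ "c y"] mult.commute[of "indicator _ _"])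
  qed
  have int: "integrable (lborel \<Otimes>\<^sub>M lborel) (case_prod F)"
  proof -
    have "compact (f ` cball 0 (R + r))"
      by (intro compact_continuous_image continuous_on_subset[OF cont sub]) simp
    then obtain B1 where B1: "\<And>y. y \<in> cball 0 (R + r) \<Longrightarrow> norm (f y) \<le> B1"
      by (meson bounded_iff compact_imp_bounded imageI)
    have cB: "\<bar>c y\<bar> \<le> \<bar>B1\<bar>" for y
    proof (cases "y \<in> cball 0 (R + r)")
      case True
      then show ?thesis using B1[OF True] component_le_norm_cart[of "f y" i]
        by (simp add: c_def)
    qed (simp add: c_def)
    let ?A = "{t1..t2} \<times> cball (0::real^'n) (R + r)"
    have "compact ((\<lambda>(t, y). bump_deriv r (p + t *\<^sub>R v - y) v) ` ?A)"
      by (intro compact_continuous_image compact_Times)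
         (auto simp: case_prod_unfold intro!: continuous_intros)
    then obtain B2 where B2: "\<And>t y. (t, y) \<in> ?A \<Longrightarrow> \<bar>bump_deriv r (p + t *\<^sub>R v - y) v\<bar> \<le> B2"
      by (force simp: bounded_iff dest!: compact_imp_bounded)
    show ?thesis
    proof (rule integrableI_bounded_set[where A = ?A and B = "\<bar>B1\<bar> * \<bar>B2\<bar>"])
      show "?A \<in> sets (lborel \<Otimes>\<^sub>M lborel)" by measurable
      have [measurable]: "(\<lambda>z. bump_deriv r (p + fst z *\<^sub>R v - snd z) v) \<in> borel_measurable (borel \<Otimes>\<^sub>M borel)"
        unfolding borel_prod
        by (intro borel_measurable_continuous_onI) (auto intro!: continuous_intros)
      show "case_prod F \<in> borel_measurable (lborel \<Otimes>\<^sub>M lborel)"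
        unfolding F_def case_prod_unfold by measurable
      have "emeasure (lborel \<Otimes>\<^sub>M lborel) ?A = emeasure lborel {t1..t2} * emeasure lborel (cball (0::real^'n) (R + r))"
        by (rule lborel.emeasure_pair_measure_Times) auto
      also have "\<dots> < \<infinity>"
        using t emeasure_lborel_cball_finite[of "0::real^'n" "R + r"] by (simp add: ennreal_mult_less_top)
      finally show "emeasure (lborel \<Otimes>\<^sub>M lborel) ?A < \<infinity>" .
      have "norm (F t y) \<le> \<bar>B1\<bar> * \<bar>B2\<bar>" if "(t, y) \<in> ?A" for t y
      proof -
        have "norm (F t y) = \<bar>c y\<bar> * \<bar>bump_deriv r (p + t *\<^sub>R v - y) v\<bar>"
          using that by (simp add: F_def abs_mult)
        also have "\<dots> \<le> \<bar>B1\<bar> * \<bar>B2\<bar>"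
          using cB[of y] B2[OF that] by (intro mult_mono) auto
        finally show ?thesis .
      qed
      then show "AE x in lborel \<Otimes>\<^sub>M lborel. x \<in> ?A \<longrightarrow> norm (case_prod F x) \<le> \<bar>B1\<bar> * \<bar>B2\<bar>"
        by (intro AE_I2) (metis case_prod_conv surj_pair)
      show "AE x in lborel \<Otimes>\<^sub>M lborel. x \<notin> ?A \<longrightarrow> case_prod F x = 0"
        by (intro AE_I2) (auto simp: F_def c_def indicator_def)
    qed
  qed
  have intb: "integrable lborel (\<lambda>y. c y * bump r (x - y))" for x
  proof -
    have "integrable lborel (\<lambda>y. indicator (cball 0 (R + r)) y *\<^sub>R (f y $ i * bump r (x - y)))"
      by (rule borel_integrable_compact) (auto intro!: continuous_intros continuous_on_subset[OF cont sub])
    then show ?thesis by (simp add: c_def mult.assoc)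
  qed
  have "mollification r (\<lambda>y. f y $ i) (p + t2 *\<^sub>R v) - mollification r (\<lambda>y. f y $ i) (p + t1 *\<^sub>R v)
     = (\<integral>y. c y * bump r (p + t2 *\<^sub>R v - y) - c y * bump r (p + t1 *\<^sub>R v - y) \<partial>lborel)"
    by (simp add: mol[OF seg(1)] mol[OF seg(2)] intb)
  also have "\<dots> = (\<integral>y. (\<integral>t. F t y \<partial>lborel) \<partial>lborel)"
    by (simp add: ftc algebra_simps)
  also have "\<dots> = (\<integral>t. (\<integral>y. F t y \<partial>lborel) \<partial>lborel)"
    by (rule lborel_pair.Fubini_integral[OF int])
  finally have "ennreal \<bar>mollification r (\<lambda>y. f y $ i) (p + t2 *\<^sub>R v) - mollification r (\<lambda>y. f y $ i) (p + t1 *\<^sub>R v)\<bar>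
     \<le> (\<integral>\<^sup>+t. ennreal \<bar>\<integral>y. F t y \<partial>lborel\<bar> \<partial>lborel)"
    using ennreal_abs_integral_le by metis
  also have "\<dots> \<le> (\<integral>\<^sup>+t\<in>{t1..t2}. (\<integral>\<^sup>+y. ennreal (norm v * (\<Sum>j\<in>UNIV. \<bar>(indicator (ball 0 1) y *\<^sub>R D y) $ i $ j\<bar>)
          * bump r (p + t *\<^sub>R v - y)) \<partial>lebesgue) \<partial>lborel)"
  proof (intro nn_integral_mono)
    fix t
    show "ennreal \<bar>\<integral>y. F t y \<partial>lborel\<bar> \<le> (\<integral>\<^sup>+y. ennreal (norm v * (\<Sum>j\<in>UNIV. \<bar>(indicator (ball 0 1) y *\<^sub>R D y) $ i $ j\<bar>)
          * bump r (p + t *\<^sub>R v - y)) \<partial>lebesgue) * indicator {t1..t2} t"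
    proof (cases "t \<in> {t1..t2}")
      case True
      then show ?thesis
        using mollification_weak_derivative[OF cont wd r seg_in[OF True], of i v]
        by (simp add: F_def c_def)
    qed (simp add: F_def)
  qed
  finally show ?thesis .
qed

section \<open>Upper gradients up to mollification\<close>

lemma nn_integral_lborel_affine:
  fixes h :: "'a::euclidean_space \<Rightarrow> ennreal"
  assumes h[measurable]: "h \<in> borel_measurable borel" and c: "c \<noteq> 0"
  shows "(\<integral>\<^sup>+x. h x \<partial>lborel) = ennreal (\<bar>c\<bar> ^ DIM('a)) * (\<integral>\<^sup>+x. h (t + c *\<^sub>R x) \<partial>lborel)"
proof -
  have "(\<integral>\<^sup>+x. h x \<partial>lborel) = (\<integral>\<^sup>+x. h x \<partial>density (distr lborel borel (\<lambda>x. t + c *\<^sub>R x)) (\<lambda>_. ennreal (\<bar>c\<bar> ^ DIM('a))))"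
    using lborel_affine[OF c, of t] by (simp only: ennreal_power)
  also have "\<dots> = ennreal (\<bar>c\<bar> ^ DIM('a)) * (\<integral>\<^sup>+x. h (t + c *\<^sub>R x) \<partial>lborel)"
    by (simp add: nn_integral_density nn_integral_distr nn_integral_cmult)
  finally show ?thesis .
qed

lemma nn_integral_lborel_shift:
  fixes h :: "'a::euclidean_space \<Rightarrow> ennreal"
  assumes "h \<in> borel_measurable borel"
  shows "(\<integral>\<^sup>+x. h (x - t) \<partial>lborel) = (\<integral>\<^sup>+x. h x \<partial>lborel)"
  using nn_integral_lborel_affine[OF assms, of 1 "- t"] by simp

lemma nn_integral_lborel_reflect:
  fixes h :: "'a::euclidean_space \<Rightarrow> ennreal"
  assumes "h \<in> borel_measurable borel"
  shows "(\<integral>\<^sup>+x. h (t - x) \<partial>lborel) = (\<integral>\<^sup>+x. h x \<partial>lborel)"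
  using nn_integral_lborel_affine[OF assms, of "-1" t] by simp

text \<open>
  An upper gradient bounds increments by line integrals, which makes no sense for a function such as
  \<open>\<parallel>Df\<parallel>\<close> that is determined only up to null sets. Averaging the line integral over small
  translations restores meaning, and the error \<open>e\<close> absorbs the difference between \<open>f\<close> and its
  mollification, so that \<open>f\<close> itself can appear on the left.
\<close>

definition mollified_upper_gradient ::
  "('a::euclidean_space \<Rightarrow> 'b::real_normed_vector) \<Rightarrow> ('a \<Rightarrow> ennreal) \<Rightarrow> bool" where
  "mollified_upper_gradient f g \<longleftrightarrow> g \<in> borel_measurable borel \<and>
     (\<forall>R<1. \<forall>e>0. \<forall>\<eta>>0. \<exists>\<phi>\<in>borel_measurable borel.
        (\<integral>\<^sup>+z. \<phi> z \<partial>lborel) = 1 \<and> (\<forall>z. \<phi> z \<noteq> 0 \<longrightarrow> norm z < \<eta>) \<and>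
        (\<forall>p v t1 t2. t1 \<le> t2 \<longrightarrow> p + t1 *\<^sub>R v \<in> cball 0 R \<longrightarrow> p + t2 *\<^sub>R v \<in> cball 0 R \<longrightarrow>
           ennreal (norm (f (p + t2 *\<^sub>R v) - f (p + t1 *\<^sub>R v))) \<le>
           ennreal e + ennreal (norm v) *
             (\<integral>\<^sup>+z. \<phi> z * (\<integral>\<^sup>+t\<in>{t1..t2}. g (p + t *\<^sub>R v - z) \<partial>lborel) \<partial>lborel)))"

lemma mollification_approx:
  fixes u :: "real^'n \<Rightarrow> real"
  assumes u: "continuous_on (ball 0 1) u" and r: "r > 0" "R + r < 1" and x: "x \<in> cball 0 R"
    and close: "\<And>y. dist y x < r \<Longrightarrow> \<bar>u y - u x\<bar> \<le> e"
  shows "\<bar>mollification r u x - u x * (\<integral>z. bump r z \<partial>(lborel :: (real^'n) measure))\<bar> \<le>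
    e * (\<integral>z. bump r z \<partial>(lborel :: (real^'n) measure))"
proof -
  have R0: "0 \<le> R" using x norm_ge_zero[of x] by (simp del: norm_ge_zero)
  have sub: "cball (0::real^'n) (R + r) \<subseteq> ball 0 1" using r by auto
  define c where "c y = indicator (cball 0 (R + r)) y *\<^sub>R u y" for y
  have mol: "mollification r u x = (\<integral>y. c y * bump r (x - y) \<partial>lborel)"
    unfolding mollification_def c_def
  proof (rule cut_integral_eq[OF u _ r(2) x])
    show "norm (x - y) \<le> r" if "bump r (x - y) \<noteq> 0" for y
      using that bump_eq_0_iff[OF r(1), of "x - y"] by linarith
  qed (use r R0 in \<open>auto intro!: continuous_intros\<close>)
  have intc: "integrable lborel (\<lambda>y. c y * bump r (x - y))"
  proof -
    have "integrable lborel (\<lambda>y. indicator (cball 0 (R + r)) y *\<^sub>R (u y * bump r (x - y)))"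
      by (rule borel_integrable_compact) (auto intro!: continuous_intros continuous_on_subset[OF u sub])
    then show ?thesis by (simp add: c_def mult.assoc)
  qed
  have intb: "integrable lborel (\<lambda>y. bump r (x - y))"
  proof -
    have "integrable lborel (\<lambda>y. indicator (cball x r) y *\<^sub>R bump r (x - y))"
      by (rule borel_integrable_compact) (auto intro!: continuous_intros)
    moreover have "indicator (cball x r) y *\<^sub>R bump r (x - y) = bump r (x - y)" for y
      using bump_eq_0_iff[OF r(1), of "x - y"] by (auto simp: indicator_def dist_norm)
    ultimately show ?thesis by (simp only:)
  qed
  have I: "(\<integral>z. bump r z \<partial>(lborel :: (real^'n) measure)) = (\<integral>y. bump r (x - y) \<partial>lborel)"
  proof -
    have L: "lborel = distr lborel borel (\<lambda>y. x - y)"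
      using lborel_affine[of "-1" x] by (simp add: density_1)
    have [measurable]: "(bump r :: real^'n \<Rightarrow> real) \<in> borel_measurable borel"
      by (intro borel_measurable_continuous_onI continuous_intros)
    have "(\<integral>z. bump r z \<partial>distr lborel borel (\<lambda>y. x - y)) = (\<integral>y. bump r (x - y) \<partial>lborel)"
      by (rule integral_distr) measurable
    then show ?thesis by (simp only: L[symmetric])
  qed
  have "\<bar>mollification r u x - u x * (\<integral>z. bump r z \<partial>(lborel :: (real^'n) measure))\<bar> = \<bar>\<integral>y. (c y - u x) * bump r (x - y) \<partial>lborel\<bar>"
    unfolding mol I using intc intb by (simp add: left_diff_distrib)
  also have "\<dots> \<le> (\<integral>y. \<bar>(c y - u x) * bump r (x - y)\<bar> \<partial>lborel)"
    by (rule integral_abs_bound)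
  also have "\<dots> \<le> (\<integral>y. e * bump r (x - y) \<partial>lborel)"
  proof (rule integral_mono)
    show "\<bar>(c y - u x) * bump r (x - y)\<bar> \<le> e * bump r (x - y)" for y
    proof (cases "bump r (x - y) = 0")
      case False
      then have lt: "dist y x < r"
        using bump_eq_0_iff[OF r(1), of "x - y"] by (simp add: dist_norm norm_minus_commute)
      then have "norm y \<le> R + r"
        using norm_triangle_ineq2[of y x] x by (simp add: dist_norm)
      then have "c y = u y" by (simp add: c_def)
      then show ?thesis using close[OF lt] by (simp add: abs_mult mult_right_mono)
    qed simp
  qed (use intc intb in \<open>auto simp: left_diff_distrib intro!: integrable_abs\<close>)
  also have "\<dots> = e * (\<integral>z. bump r z \<partial>(lborel :: (real^'n) measure))"
    unfolding I by simp
  finally show ?thesis .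
qed

lemma bump_mass_pos:
  assumes "r > 0" shows "0 < (\<integral>z. bump r z \<partial>(lborel :: (real^'n) measure))"
    and "integrable lborel (bump r :: real^'n \<Rightarrow> real)"
proof -
  have "integrable lborel (\<lambda>y::real^'n. indicator (cball 0 r) y *\<^sub>R bump r y)"
    by (rule borel_integrable_compact) (auto intro!: continuous_intros)
  moreover have "indicator (cball 0 r) y *\<^sub>R bump r y = bump r y" for y :: "real^'n"
    using bump_eq_0_iff[OF assms, of y] by (auto simp: indicator_def)
  ultimately show int: "integrable lborel (bump r :: real^'n \<Rightarrow> real)"
    by (simp only:)
  have "0 \<le> (\<integral>z. bump r z \<partial>(lborel :: (real^'n) measure))"
    by (rule integral_nonneg_AE) auto
  moreover have "(\<integral>z. bump r z \<partial>(lborel :: (real^'n) measure)) \<noteq> 0"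
  proof
    assume "(\<integral>z. bump r z \<partial>(lborel :: (real^'n) measure)) = 0"
    then have "AE z in lborel. bump r (z::real^'n) = 0"
      using integral_nonneg_eq_0_iff_AE[OF int] by simp
    then have "AE z in lborel. z \<notin> ball (0::real^'n) r"
      by eventually_elim (simp add: bump_eq_0_iff[OF assms])
    then have "emeasure lborel (ball (0::real^'n) r) = 0"
      using AE_iff_measurable[of "ball (0::real^'n) r" lborel "\<lambda>z. z \<notin> ball 0 r"] by (auto simp: ball_def)
    then have "ball (0::real^'n) r \<in> null_sets lborel"
      by (simp add: null_sets_def)
    then show False
      using assms by (metis centre_in_ball completion.null_sets_outer empty_iff negligible_iff_null_sets
          null_sets_completionI open_ball open_not_negligible)
  qed
  ultimately show "0 < (\<integral>z. bump r z \<partial>(lborel :: (real^'n) measure))" by linarith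
qed

text \<open>
  The translations are those of the mollifier: by uniform continuity on a smaller ball \<open>f\<close> differs
  little from its mollification, whose increments are controlled by the weak derivative. The Borel
  representative of the derivative is needed for Fubini on products of Borel spaces.
\<close>

lemma mollified_upper_gradient_weak_derivative:
  fixes f :: "real^'n \<Rightarrow> real^'m"
  assumes cont: "continuous_on (ball 0 1) f" and wd: "has_weak_derivative f D (ball 0 1)"
  obtains g where "mollified_upper_gradient f g"
    "AE y in lebesgue. g y = ennreal (\<Sum>i\<in>UNIV. \<Sum>j\<in>UNIV. \<bar>(indicator (ball 0 1) y *\<^sub>R D y) $ i $ j\<bar>)"
proof -
  define S where "S i y = (\<Sum>j\<in>UNIV. \<bar>(indicator (ball 0 1) y *\<^sub>R D y) $ i $ j\<bar>)" for i y
  have S0[simp]: "0 \<le> S i y" for i y by (simp add: S_def sum_nonneg)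
  have mS: "(\<lambda>y. ennreal (S i y)) \<in> borel_measurable lebesgue" for i
  proof -
    note borel_measurable_weak_derivative_entry[OF wd, measurable]
    show ?thesis unfolding S_def by measurable
  qed
  have "\<exists>gi. gi \<in> borel_measurable borel \<and> (AE y in lebesgue. ennreal (S i y) = gi y)" for i
  proof -
    obtain g' where "g' \<in> borel_measurable lborel" "AE y in lborel. ennreal (S i y) = g' y"
      using completion_ex_borel_measurable[OF mS[of i]] by blast
    then show ?thesis by (intro exI[of _ g']) (auto intro: AE_completion)
  qed
  then have "\<exists>gi. \<forall>i. gi i \<in> borel_measurable borel \<and> (AE y in lebesgue. ennreal (S i y) = gi i y)"
    by (intro choice) blast
  then obtain gi where gi[measurable]: "\<And>i. gi i \<in> borel_measurable borel"
    and gi_eq: "\<And>i. AE y in lebesgue. ennreal (S i y) = gi i y"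
    by blast
  define g where "g y = (\<Sum>i\<in>UNIV. gi i y)" for y
  have [measurable]: "g \<in> borel_measurable borel" unfolding g_def by measurable
  have "mollified_upper_gradient f g"
    unfolding mollified_upper_gradient_def
  proof (intro conjI allI impI)
    fix R e \<eta> :: real
    assume R1: "R < 1" and e: "e > 0" and \<eta>: "\<eta> > 0"
    define R' where "R' = (max R 0 + 1) / 2"
    have sub: "cball (0::real^'n) R' \<subseteq> ball 0 1" using R1 by (auto simp: R'_def)
    define e' where "e' = e / (2 * real CARD('m))"
    have e': "e' > 0" using e by (simp add: e'_def)
    have "uniformly_continuous_on (cball 0 R') f"
      by (intro compact_uniformly_continuous continuous_on_subset[OF cont sub]) simp
    then obtain d where d: "d > 0"
      and d_close: "\<And>x y. x \<in> cball 0 R' \<Longrightarrow> y \<in> cball 0 R' \<Longrightarrow> dist y x < d \<Longrightarrow> dist (f y) (f x) < e'"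
      using e' unfolding uniformly_continuous_on_def by metis
    define r where "r = Min {d, \<eta>, (1 - max R 0) / 4}"
    have r: "r > 0" "r \<le> d" "r \<le> \<eta>" "R + r < 1" "max R 0 + r < R'"
      using d \<eta> R1 by (auto simp: r_def R'_def min_def max_def field_simps)
    define I where "I = (\<integral>z. bump r z \<partial>(lborel :: (real^'n) measure))"
    have I: "I > 0" unfolding I_def by (rule bump_mass_pos[OF r(1)])
    define \<phi> where "\<phi> z = ennreal (bump r z / I)" for z :: "real^'n"
    have [measurable]: "(bump r :: real^'n \<Rightarrow> real) \<in> borel_measurable borel"
      by (intro borel_measurable_continuous_onI continuous_intros)
    have [measurable]: "\<phi> \<in> borel_measurable borel" unfolding \<phi>_def by measurable
    show "\<exists>\<phi>\<in>borel_measurable borel.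
        (\<integral>\<^sup>+z. \<phi> z \<partial>lborel) = 1 \<and> (\<forall>z. \<phi> z \<noteq> 0 \<longrightarrow> norm z < \<eta>) \<and>
        (\<forall>p v t1 t2. t1 \<le> t2 \<longrightarrow> p + t1 *\<^sub>R v \<in> cball 0 R \<longrightarrow> p + t2 *\<^sub>R v \<in> cball 0 R \<longrightarrow>
           ennreal (norm (f (p + t2 *\<^sub>R v) - f (p + t1 *\<^sub>R v))) \<le>
           ennreal e + ennreal (norm v) *
             (\<integral>\<^sup>+z. \<phi> z * (\<integral>\<^sup>+t\<in>{t1..t2}. g (p + t *\<^sub>R v - z) \<partial>lborel) \<partial>lborel))"
    proof (intro bexI[of _ \<phi>] conjI allI impI)
      have "(\<integral>\<^sup>+z. \<phi> z \<partial>lborel) = ennreal (\<integral>z. bump r z / I \<partial>(lborel :: (real^'n) measure))"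
        unfolding \<phi>_def using I bump_mass_pos(2)[OF r(1), where 'n = 'n]
        by (intro nn_integral_eq_integral) auto
      also have "(\<integral>z. bump r z / I \<partial>(lborel :: (real^'n) measure)) = 1"
        using I by (simp add: I_def)
      finally show "(\<integral>\<^sup>+z. \<phi> z \<partial>lborel) = 1" by simp
      show "norm z < \<eta>" if "\<phi> z \<noteq> 0" for z
      proof -
        have "bump r z \<noteq> 0" using that by (auto simp: \<phi>_def)
        then show ?thesis using bump_eq_0_iff[OF r(1), of z] r(3) by linarith
      qed
      fix p v :: "real^'n" and t1 t2 :: real
      assume t: "t1 \<le> t2" and a: "p + t1 *\<^sub>R v \<in> cball 0 R" and b: "p + t2 *\<^sub>R v \<in> cball 0 R"
      let ?G = "\<lambda>i t. (\<integral>\<^sup>+y. ennreal (norm v) * gi i y * \<phi> (p + t *\<^sub>R v - y) \<partial>lborel)"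
      let ?a = "p + t1 *\<^sub>R v" and ?b = "p + t2 *\<^sub>R v"
      let ?h = "\<lambda>i. mollification r (\<lambda>y. f y $ i)"
      have ci: "continuous_on (ball 0 1) (\<lambda>y. f y $ i)" for i
        using cont by (intro continuous_intros)
      have appr: "\<bar>?h i x - f x $ i * I\<bar> \<le> e' * I" if x: "x \<in> cball 0 R" for i x
        unfolding I_def
      proof (rule mollification_approx[OF ci r(1,4) x])
        fix y assume y: "dist y x < r"
        have "norm y \<le> norm x + norm (y - x)" using norm_triangle_sub by blast
        then have "x \<in> cball 0 R'" "y \<in> cball 0 R'"
          using x y r by (auto simp: dist_norm)
        then have "dist (f y) (f x) < e'" using y r(2) by (intro d_close) auto
        then show "\<bar>f y $ i - f x $ i\<bar> \<le> e'"
          using component_le_norm_cart[of "f y - f x" i] by (simp add: dist_norm)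
      qed
      have comp: "\<bar>f ?b $ i - f ?a $ i\<bar> \<le> \<bar>?h i ?b - ?h i ?a\<bar> / I + 2 * e'" for i
      proof -
        have "\<bar>f ?b $ i * I - f ?a $ i * I\<bar> \<le> \<bar>?h i ?b - ?h i ?a\<bar> + 2 * (e' * I)"
          using appr[OF a, of i] appr[OF b, of i] by linarith
        moreover have "\<bar>f ?b $ i * I - f ?a $ i * I\<bar> = \<bar>f ?b $ i - f ?a $ i\<bar> * I"
          using I by (simp flip: left_diff_distrib add: abs_mult)
        ultimately show ?thesis using I by (simp add: field_simps)
      qed
      have incr: "ennreal (\<bar>?h i ?b - ?h i ?a\<bar> / I) \<le>
         (\<integral>\<^sup>+t. ?G i t * indicator {t1..t2} t \<partial>lborel)" for i
      proof -
        let ?Gb = "\<lambda>t. (\<integral>\<^sup>+y. ennreal (norm v) * gi i y * ennreal (bump r (p + t *\<^sub>R v - y)) \<partial>lborel)"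
        have "ennreal (\<bar>?h i ?b - ?h i ?a\<bar> / I) = ennreal (1 / I) * ennreal \<bar>?h i ?b - ?h i ?a\<bar>"
          using I by (simp add: ennreal_mult[symmetric])
        also have "\<dots> \<le> ennreal (1 / I) * (\<integral>\<^sup>+t\<in>{t1..t2}. (\<integral>\<^sup>+y. ennreal (norm v * S i y
          * bump r (p + t *\<^sub>R v - y)) \<partial>lebesgue) \<partial>lborel)"
          using mollification_increment[OF cont wd r(1,4) t a b, of i] unfolding S_def
          by (intro mult_left_mono) auto
        also have "(\<lambda>t. (\<integral>\<^sup>+y. ennreal (norm v * S i y * bump r (p + t *\<^sub>R v - y)) \<partial>lebesgue)) =
          (\<lambda>t. ?Gb t)"
        proof
          fix t
          have "(\<integral>\<^sup>+y. ennreal (norm v * S i y * bump r (p + t *\<^sub>R v - y)) \<partial>lebesgue) =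
             (\<integral>\<^sup>+y. ennreal (norm v) * gi i y * ennreal (bump r (p + t *\<^sub>R v - y)) \<partial>lebesgue)"
            by (rule nn_integral_cong_AE, use gi_eq[of i] in eventually_elim) (auto simp: ennreal_mult)
          also have "\<dots> = ?Gb t"
            by (rule nn_integral_completion)
          finally show "(\<integral>\<^sup>+y. ennreal (norm v * S i y * bump r (p + t *\<^sub>R v - y)) \<partial>lebesgue) = \<dots>" .
        qed
        also have "ennreal (1 / I) * (\<integral>\<^sup>+t\<in>{t1..t2}. ?Gb t \<partial>lborel)
          = (\<integral>\<^sup>+t\<in>{t1..t2}. ennreal (1 / I) * ?Gb t \<partial>lborel)"
          by (subst nn_integral_cmult[symmetric]) (simp_all add: mult_ac)
        also have "\<dots> = (\<integral>\<^sup>+t\<in>{t1..t2}. ?G i t \<partial>lborel)"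
          unfolding \<phi>_def using I
          by (intro nn_integral_cong, subst nn_integral_cmult[symmetric])
             (simp_all add: divide_inverse ennreal_mult mult_ac)
        finally show ?thesis .
      qed
      have "ennreal (norm (f ?b - f ?a)) \<le> ennreal (\<Sum>i\<in>UNIV. \<bar>?h i ?b - ?h i ?a\<bar> / I + 2 * e')"
        using comp by (intro ennreal_leI order_trans[OF norm_le_l1_cart] sum_mono) simp
      also have "\<dots> = ennreal (e + (\<Sum>i\<in>UNIV. \<bar>?h i ?b - ?h i ?a\<bar> / I))"
        by (simp add: sum.distrib e'_def add.commute)
      also have "\<dots> = ennreal e + (\<Sum>i\<in>UNIV. ennreal (\<bar>?h i ?b - ?h i ?a\<bar> / I))"
        using e I by (simp add: ennreal_plus sum_nonneg sum_ennreal)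
      also have "\<dots> \<le> ennreal e + (\<Sum>i\<in>UNIV. (\<integral>\<^sup>+t. ?G i t * indicator {t1..t2} t \<partial>lborel))"
        by (intro add_left_mono sum_mono incr)
      also have "(\<Sum>i\<in>UNIV. (\<integral>\<^sup>+t. ?G i t * indicator {t1..t2} t \<partial>lborel))
         = (\<integral>\<^sup>+t. (\<Sum>i\<in>UNIV. ?G i t * indicator {t1..t2} t) \<partial>lborel)"
        by (subst nn_integral_sum) auto
      also have "\<dots> = (\<integral>\<^sup>+t. (\<integral>\<^sup>+y. ennreal (norm v) * g y * \<phi> (p + t *\<^sub>R v - y) \<partial>lborel) * indicator {t1..t2} t \<partial>lborel)"
        unfolding g_def
        by (intro nn_integral_cong) (simp add: sum_distrib_left sum_distrib_right nn_integral_sum)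
      also have "\<dots> = (\<integral>\<^sup>+t. (\<integral>\<^sup>+z. ennreal (norm v) * g (p + t *\<^sub>R v - z) * \<phi> z \<partial>lborel) * indicator {t1..t2} t \<partial>lborel)"
      proof -
        have "(\<integral>\<^sup>+y. ennreal (norm v) * g y * \<phi> (p + t *\<^sub>R v - y) \<partial>lborel) =
            (\<integral>\<^sup>+z. ennreal (norm v) * g (p + t *\<^sub>R v - z) * \<phi> z \<partial>lborel)" for t
          using nn_integral_lborel_reflect[of "\<lambda>y. ennreal (norm v) * g y * \<phi> (p + t *\<^sub>R v - y)" "p + t *\<^sub>R v"]
          by simp
        then show ?thesis by simp
      qed
      also have "\<dots> = (\<integral>\<^sup>+t. (\<integral>\<^sup>+z. ennreal (norm v) * (\<phi> z * (g (p + t *\<^sub>R v - z) * indicator {t1..t2} t)) \<partial>lborel) \<partial>lborel)"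
        by (intro nn_integral_cong, subst nn_integral_multc[symmetric]) (simp_all add: mult_ac)
      also have "\<dots> = (\<integral>\<^sup>+z. (\<integral>\<^sup>+t. ennreal (norm v) * (\<phi> z * (g (p + t *\<^sub>R v - z) * indicator {t1..t2} t)) \<partial>lborel) \<partial>lborel)"
        by (rule lborel_pair.Fubini') measurable
      also have "\<dots> = ennreal (norm v) * (\<integral>\<^sup>+z. \<phi> z * (\<integral>\<^sup>+t\<in>{t1..t2}. g (p + t *\<^sub>R v - z) \<partial>lborel) \<partial>lborel)"
        by (simp add: nn_integral_cmult)
      finally show "ennreal (norm (f ?b - f ?a)) \<le>
           ennreal e + ennreal (norm v) *
             (\<integral>\<^sup>+z. \<phi> z * (\<integral>\<^sup>+t\<in>{t1..t2}. g (p + t *\<^sub>R v - z) \<partial>lborel) \<partial>lborel)" .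
    qed measurable
  qed measurable
  moreover have "AE y in lebesgue. g y = ennreal (\<Sum>i\<in>UNIV. \<Sum>j\<in>UNIV. \<bar>(indicator (ball 0 1) y *\<^sub>R D y) $ i $ j\<bar>)"
  proof -
    have "AE y in lebesgue. \<forall>i\<in>UNIV. ennreal (S i y) = gi i y"
      by (intro AE_finite_allI gi_eq) simp
    then show ?thesis
    proof eventually_elim
      case (elim y)
      then have "g y = (\<Sum>i\<in>UNIV. ennreal (S i y))"
        by (simp add: g_def)
      then show ?case
        by (simp only: S_def[symmetric] sum_ennreal S0)
    qed
  qed
  ultimately show thesis by (rule that)
qed

section \<open>Hausdorff measure of subsets of the sphere\<close>

text \<open>
  The part of the cone over a spherical cap that lies in a fixed annulus.
\<close>

definition sphere_tube :: "'a::euclidean_space \<Rightarrow> real \<Rightarrow> 'a set" where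
  "sphere_tube \<zeta> r = {x. norm x \<in> {5/8..7/8} \<and> norm (sgn x - \<zeta>) \<le> r}"

lemma sgn_borel_measurable [measurable]: "(sgn :: 'a::euclidean_space \<Rightarrow> 'a) \<in> borel_measurable borel"
  unfolding sgn_div_norm by measurable

lemma sphere_tube_borel [measurable]: "sphere_tube \<zeta> r \<in> sets borel"
  unfolding sphere_tube_def by measurable

text \<open>
  Place a ball of radius \<open>r / 16\<close> around each point of a segment on the axis. All these balls lie in
  the tube, and each point of the tube is covered for a set of parameters of length at most
  \<open>r / 8\<close>; Tonelli then compares the total volume of the balls with that of the tube.
\<close>

lemma emeasure_sphere_tube_ge:
  fixes \<zeta> :: "'a::euclidean_space"
  assumes \<zeta>: "norm \<zeta> = 1" and r: "0 < r" "r \<le> 1"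
  shows "ennreal (unit_ball_vol (real DIM('a)) * r ^ (DIM('a) - 1)) \<le>
           ennreal (16 ^ DIM('a)) * emeasure lborel (sphere_tube \<zeta> r)"
proof -
  let ?V = "unit_ball_vol (real DIM('a))"
  let ?I = "{11/16..13/16::real}"
  let ?P = "\<lambda>t x. indicator ?I t * indicator (ball (t *\<^sub>R \<zeta>) (r / 16)) x :: ennreal"
  have meas: "case_prod ?P \<in> borel_measurable (lborel \<Otimes>\<^sub>M lborel)"
  proof -
    have [measurable]: "{z. dist (fst z *\<^sub>R \<zeta>) (snd z) < r / 16} \<in> sets (borel \<Otimes>\<^sub>M (borel :: 'a measure))"
      unfolding borel_prod by (intro borel_open open_Collect_less continuous_intros)
    have "case_prod ?P = (\<lambda>z. indicator ?I (fst z) * indicator {z. dist (fst z *\<^sub>R \<zeta>) (snd z) < r / 16} z)"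
      by (auto simp: fun_eq_iff indicator_def)
    then show ?thesis by simp
  qed
  have "ennreal (?V * (r / 16) ^ DIM('a) * (1 / 8)) = (\<integral>\<^sup>+t. ennreal (?V * (r / 16) ^ DIM('a)) * indicator ?I t \<partial>lborel)"
    by (subst nn_integral_cmult_indicator) (simp_all add: ennreal_mult'' flip: ennreal_mult'')
  also have "\<dots> = (\<integral>\<^sup>+t. (\<integral>\<^sup>+x. ?P t x \<partial>lborel) \<partial>lborel)"
  proof (rule nn_integral_cong)
    fix t
    have "(\<integral>\<^sup>+x. ?P t x \<partial>lborel) = indicator ?I t * emeasure lborel (ball (t *\<^sub>R \<zeta>) (r / 16))"
      by (rule nn_integral_cmult_indicator) simp
    also have "emeasure lborel (ball (t *\<^sub>R \<zeta>) (r / 16)) = ennreal (?V * (r / 16) ^ DIM('a))"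
      using r by (intro emeasure_ball) simp
    finally show "ennreal (?V * (r / 16) ^ DIM('a)) * indicator ?I t = (\<integral>\<^sup>+x. ?P t x \<partial>lborel)"
      by (simp only: mult.commute)
  qed
  also have "\<dots> = (\<integral>\<^sup>+x. (\<integral>\<^sup>+t. ?P t x \<partial>lborel) \<partial>lborel)"
    by (rule lborel_pair.Fubini'[OF meas, symmetric])
  also have "\<dots> \<le> (\<integral>\<^sup>+x. ennreal (r / 8) * indicator (sphere_tube \<zeta> r) x \<partial>lborel)"
  proof (rule nn_integral_mono)
    fix x :: 'a
    have tube: "x \<in> sphere_tube \<zeta> r" if t: "t \<in> ?I" and x: "dist (t *\<^sub>R \<zeta>) x < r / 16" for t
    proof -
      have nt: "norm (t *\<^sub>R \<zeta>) = t" using t \<zeta> by simp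
      have d: "\<bar>norm x - t\<bar> < r / 16"
        using norm_triangle_ineq3[of x "t *\<^sub>R \<zeta>"] x nt by (simp add: dist_norm norm_minus_commute)
      then have nx: "norm x \<in> {5/8..7/8}"
        using t r unfolding atLeastAtMost_iff by linarith
      have "norm (x - norm x *\<^sub>R \<zeta>) \<le> norm (x - t *\<^sub>R \<zeta>) + norm (t *\<^sub>R \<zeta> - norm x *\<^sub>R \<zeta>)"
        by (metis diff_add_cancel add_diff_eq norm_triangle_ineq)
      also have "norm (t *\<^sub>R \<zeta> - norm x *\<^sub>R \<zeta>) = \<bar>norm x - t\<bar>"
        using \<zeta> by (simp flip: scaleR_left_diff_distrib)
      finally have le: "norm (x - norm x *\<^sub>R \<zeta>) \<le> r / 8"
        using d x by (simp add: dist_norm norm_minus_commute)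
      have "x \<noteq> 0" using nx by auto
      then have "x - norm x *\<^sub>R \<zeta> = norm x *\<^sub>R (sgn x - \<zeta>)"
        by (auto simp: sgn_div_norm scaleR_right_diff_distrib)
      then have "norm x * norm (sgn x - \<zeta>) \<le> r / 8" using le by simp
      moreover have "5/8 * norm (sgn x - \<zeta>) \<le> norm x * norm (sgn x - \<zeta>)"
        using nx by (intro mult_right_mono) auto
      ultimately have "norm (sgn x - \<zeta>) \<le> r" using r by linarith
      with nx show ?thesis by (simp add: sphere_tube_def)
    qed
    show "(\<integral>\<^sup>+t. ?P t x \<partial>lborel) \<le> ennreal (r / 8) * indicator (sphere_tube \<zeta> r) x"
    proof (cases "x \<in> sphere_tube \<zeta> r")
      case True
      have "?P t x \<le> indicator {x \<bullet> \<zeta> - r / 16 .. x \<bullet> \<zeta> + r / 16} t" for t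
      proof (cases "dist (t *\<^sub>R \<zeta>) x < r / 16")
        case True
        have "\<zeta> \<bullet> \<zeta> = 1" using \<zeta> by (simp add: dot_square_norm)
        then have "\<bar>x \<bullet> \<zeta> - t\<bar> = \<bar>(x - t *\<^sub>R \<zeta>) \<bullet> \<zeta>\<bar>" by (simp add: inner_simps)
        also have "\<dots> \<le> norm (x - t *\<^sub>R \<zeta>) * norm \<zeta>" by (rule Cauchy_Schwarz_ineq2)
        finally have "\<bar>x \<bullet> \<zeta> - t\<bar> \<le> r / 16" using True \<zeta> by (simp add: dist_norm norm_minus_commute)
        then have "t \<in> {x \<bullet> \<zeta> - r / 16 .. x \<bullet> \<zeta> + r / 16}"
          unfolding atLeastAtMost_iff by linarith
        then show ?thesis by (simp add: indicator_def)
      qed (simp add: indicator_def)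
      then have "(\<integral>\<^sup>+t. ?P t x \<partial>lborel) \<le> (\<integral>\<^sup>+t. indicator {x \<bullet> \<zeta> - r / 16 .. x \<bullet> \<zeta> + r / 16} t \<partial>lborel)"
        by (intro nn_integral_mono)
      also have "\<dots> = ennreal (r / 8)" using r by simp
      finally show ?thesis using True by simp
    next
      case False
      then have "?P t x = 0" for t using tube[of t] by (auto simp: indicator_def)
      then show ?thesis by (simp del: mult_eq_0_iff)
    qed
  qed
  also have "\<dots> = ennreal (r / 8) * emeasure lborel (sphere_tube \<zeta> r)"
    by (rule nn_integral_cmult_indicator) simp
  finally have *: "ennreal (?V * (r / 16) ^ DIM('a) * (1 / 8)) \<le> ennreal (r / 8) * emeasure lborel (sphere_tube \<zeta> r)" .
  have "ennreal (?V * r ^ (DIM('a) - 1)) = ennreal (8 * 16 ^ DIM('a) / r) * ennreal (?V * (r / 16) ^ DIM('a) * (1 / 8))"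
  proof -
    have "r ^ DIM('a) = r * r ^ (DIM('a) - 1)" by (metis DIM_positive power_eq_if less_numeral_extra(3))
    then show ?thesis using r
      by (simp add: ennreal_mult[symmetric] power_divide field_simps)
  qed
  also have "\<dots> \<le> ennreal (8 * 16 ^ DIM('a) / r) * (ennreal (r / 8) * emeasure lborel (sphere_tube \<zeta> r))"
    by (rule mult_left_mono[OF *]) simp
  also have "\<dots> = ennreal (16 ^ DIM('a)) * emeasure lborel (sphere_tube \<zeta> r)"
    using r by (simp add: ennreal_mult[symmetric] mult.assoc[symmetric])
  finally show ?thesis .
qed

definition cone_const :: "'a::euclidean_space itself \<Rightarrow> real" where
  "cone_const _ = unit_ball_vol (real (DIM('a) - 1)) * 5 ^ (DIM('a) - 1) * 16 ^ DIM('a) / unit_ball_vol (real DIM('a))"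

lemma cone_const_pos: "0 < cone_const TYPE('a::euclidean_space)"
  unfolding cone_const_def by (simp add: unit_ball_vol_pos)

text \<open>
  Enclose \<open>W\<close> in an open set of nearly the same measure. Over each point of \<open>E\<close> it contains a thin
  tube, and Vitali's lemma selects disjoint caps whose five-fold enlargements cover \<open>E\<close>. The weight
  of an enlarged cap is comparable to the volume of the tube over the original one, and these tubes
  are disjoint.
\<close>

lemma hausdorff_outer_measure_le_cone:
  fixes E W :: "'a::euclidean_space set"
  assumes E: "E \<subseteq> sphere 0 1" and W: "W \<in> sets lebesgue"
    and cone: "\<And>\<zeta> t. \<zeta> \<in> E \<Longrightarrow> t \<in> {5/8..7/8} \<Longrightarrow> t *\<^sub>R \<zeta> \<in> W"
  shows "hausdorff_outer_measure (DIM('a) - 1) E \<le>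
    ennreal (cone_const TYPE('a)) * emeasure lebesgue W"
proof (rule ennreal_le_epsilon)
  fix e :: real assume e: "e > 0"
  let ?m = "DIM('a) - 1"
  let ?V = "unit_ball_vol (real DIM('a))" and ?V' = "unit_ball_vol (real (DIM('a) - 1))"
  have V: "?V > 0" "?V' > 0" by (auto intro!: unit_ball_vol_pos)
  define C where "C = cone_const TYPE('a)"
  have C: "C > 0" unfolding C_def by (rule cone_const_pos)
  obtain T where T: "open T" "W \<subseteq> T" "T - W \<in> lmeasurable" "emeasure lebesgue (T - W) < ennreal (e / C)"
    using sets_lebesgue_outer_open[OF W] e C by (metis divide_pos_pos)
  have T_le: "emeasure lborel T \<le> emeasure lebesgue W + ennreal (e / C)"
  proof -
    have "emeasure lborel T = emeasure lebesgue T"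
      using T(1) by simp
    also have "\<dots> = emeasure lebesgue (W \<union> (T - W))"
      using T(2) by (simp add: Un_absorb1)
    also have "\<dots> \<le> emeasure lebesgue W + emeasure lebesgue (T - W)"
      using W T(3) by (intro emeasure_subadditive) (auto simp: fmeasurable_def)
    also have "\<dots> \<le> emeasure lebesgue W + ennreal (e / C)"
      using T(4) by (intro add_left_mono) simp
    finally show ?thesis .
  qed
  have "hausdorff_premeasure ?m \<delta> E \<le> ennreal C * emeasure lborel T" if \<delta>: "\<delta> > 0" for \<delta>
  proof -
    have "\<exists>r. 0 < r \<and> r \<le> 1 \<and> r \<le> \<delta> / 10 \<and> sphere_tube \<zeta> r \<subseteq> T" if \<zeta>: "\<zeta> \<in> E" for \<zeta>
    proof -
      let ?S = "(\<lambda>t. t *\<^sub>R \<zeta>) ` {5/8..7/8}"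
      have "compact ?S" by (intro compact_continuous_image continuous_intros) simp
      moreover have "?S \<subseteq> T" using cone[OF \<zeta>] T(2) by blast
      ultimately obtain d where d: "d > 0" "(\<Union>x\<in>?S. ball x d) \<subseteq> T"
        using compact_subset_open_imp_ball_epsilon_subset T(1) by blast
      define r where "r = min (min 1 (d / 2)) (\<delta> / 10)"
      have r: "0 < r" "r \<le> 1" "r < d" "r \<le> \<delta> / 10" using d \<delta> by (auto simp: r_def min_def)
      have "sphere_tube \<zeta> r \<subseteq> T"
      proof
        fix x assume x: "x \<in> sphere_tube \<zeta> r"
        then have nx: "norm x \<in> {5/8..7/8}" by (simp add: sphere_tube_def)
        then have "x \<noteq> 0" by auto
        then have "norm x *\<^sub>R \<zeta> - x = norm x *\<^sub>R (\<zeta> - sgn x)"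
          by (auto simp: sgn_div_norm scaleR_right_diff_distrib)
        then have "dist (norm x *\<^sub>R \<zeta>) x = norm x * norm (sgn x - \<zeta>)"
          by (simp add: dist_norm norm_minus_commute)
        also have "\<dots> \<le> 1 * r" using x by (intro mult_mono) (auto simp: sphere_tube_def)
        finally have "x \<in> ball (norm x *\<^sub>R \<zeta>) d" using r by simp
        then show "x \<in> T" using d(2) nx by blast
      qed
      then show ?thesis using r by blast
    qed
    then obtain r where r: "\<And>\<zeta>. \<zeta> \<in> E \<Longrightarrow> 0 < r \<zeta> \<and> r \<zeta> \<le> 1 \<and> r \<zeta> \<le> \<delta> / 10 \<and> sphere_tube \<zeta> (r \<zeta>) \<subseteq> T"
      by metis
    have "E \<subseteq> (\<Union>\<zeta>\<in>E. cball \<zeta> (r \<zeta>))" using r by (force simp: less_imp_le)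
    then obtain D where D: "countable D" "D \<subseteq> E"
      and disj: "pairwise (\<lambda>i j. disjnt (cball i (r i)) (cball j (r j))) D"
      and cov: "E \<subseteq> (\<Union>i\<in>D. cball i (5 * r i))"
      using Vitali_covering_lemma_cballs[where S = E and K = E and a = "\<lambda>x. x" and r = r and B = 1] r
      by (metis (no_types, lifting))
    define N where "N = to_nat_on D ` D"
    define c where "c = from_nat_into D"
    have cD: "c k \<in> D" if "k \<in> N" for k using that D(1) by (auto simp: N_def c_def)
    have c_inj: "k = l" if "k \<in> N" "l \<in> N" "c k = c l" for k l
      using that D(1) by (auto simp: N_def c_def)
    have N_surj: "\<exists>k\<in>N. c k = i" if "i \<in> D" for i
      using that D(1) by (auto simp: N_def c_def)
    define U where "U k = (if k \<in> N then cball (c k) (5 * r (c k)) else {})" for k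
    define Q where "Q k = (if k \<in> N then sphere_tube (c k) (r (c k)) else {})" for k
    have Q_borel: "Q k \<in> sets borel" for k by (simp add: Q_def)
    have cE: "c k \<in> E" if "k \<in> N" for k using cD[OF that] D(2) by blast
    have "E \<subseteq> (\<Union>k. U k)"
    proof
      fix x assume "x \<in> E"
      then obtain i where "i \<in> D" "x \<in> cball i (5 * r i)" using cov by blast
      with N_surj[of i] show "x \<in> (\<Union>k. U k)" by (auto simp: U_def)
    qed
    moreover have "bounded (U k) \<and> diameter (U k) \<le> \<delta>" for k
    proof (cases "k \<in> N")
      case True
      then show ?thesis using r[OF cE[OF True]] by (simp add: U_def)
    qed (use \<delta> in \<open>simp add: U_def\<close>)
    ultimately have "hausdorff_premeasure ?m \<delta> E \<le> (\<Sum>k. hausdorff_weight ?m (U k))"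
      unfolding hausdorff_premeasure_def by (intro INF_lower) simp
    also have "\<dots> \<le> (\<Sum>k. ennreal C * emeasure lborel (Q k))"
    proof (intro suminf_le)
      fix k
      show "hausdorff_weight ?m (U k) \<le> ennreal C * emeasure lborel (Q k)"
      proof (cases "k \<in> N")
        case True
        have rk: "0 < r (c k)" "r (c k) \<le> 1" using r[OF cE[OF True]] by auto
        have nk: "norm (c k) = 1" using cE[OF True] E by auto
        have "hausdorff_weight ?m (U k) = ennreal (?V' * (5 * r (c k)) ^ ?m)"
          using True rk by (simp add: U_def hausdorff_weight_def)
        also have "\<dots> = ennreal (?V' * 5 ^ ?m / ?V) * ennreal (?V * r (c k) ^ ?m)"
        proof -
          have "a * (5 * q) ^ m = a * 5 ^ m / b * (b * q ^ m)" if "b > 0" for a b q :: real and m :: nat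
            using that by (simp add: power_mult_distrib)
          note eq = this[OF V(1)]
          show ?thesis unfolding eq by (rule ennreal_mult'') (use rk in simp)
        qed
        also have "\<dots> \<le> ennreal (?V' * 5 ^ ?m / ?V) * (ennreal (16 ^ DIM('a)) * emeasure lborel (sphere_tube (c k) (r (c k))))"
          by (intro mult_left_mono emeasure_sphere_tube_ge nk rk) simp
        also have "\<dots> = ennreal C * emeasure lborel (Q k)"
        proof -
          have "C = ?V' * 5 ^ ?m / ?V * 16 ^ DIM('a)"
            unfolding C_def cone_const_def by (simp only: times_divide_eq_left)
          then have "ennreal C = ennreal (?V' * 5 ^ ?m / ?V) * ennreal (16 ^ DIM('a))"
            by (simp only:) (rule ennreal_mult'', simp)
          with True show ?thesis by (simp only: Q_def if_True mult.assoc)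
        qed
        finally show ?thesis .
      qed (simp add: U_def Q_def hausdorff_weight_def)
    qed auto
    also have "\<dots> = ennreal C * (\<Sum>k. emeasure lborel (Q k))"
      by (rule ennreal_suminf_cmult)
    also have "(\<Sum>k. emeasure lborel (Q k)) = emeasure lborel (\<Union>k. Q k)"
    proof (rule suminf_emeasure)
      show "disjoint_family Q"
        unfolding disjoint_family_on_def
      proof (intro ballI impI)
        fix k l :: nat assume "k \<noteq> l"
        show "Q k \<inter> Q l = {}"
        proof (rule ccontr)
          assume "Q k \<inter> Q l \<noteq> {}"
          then obtain x where x: "x \<in> Q k" "x \<in> Q l" by blast
          then have kl: "k \<in> N" "l \<in> N" by (auto simp: Q_def split: if_splits)
          then have "c k \<noteq> c l" using c_inj \<open>k \<noteq> l\<close> by blast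
          then have "disjnt (cball (c k) (r (c k))) (cball (c l) (r (c l)))"
            using disj cD kl by (auto simp: pairwise_def)
          moreover have "sgn x \<in> cball (c k) (r (c k))" "sgn x \<in> cball (c l) (r (c l))"
            using x kl by (auto simp: Q_def sphere_tube_def dist_norm norm_minus_commute)
          ultimately show False by (auto simp: disjnt_def)
        qed
      qed
    qed (use Q_borel in auto)
    also have "ennreal C * \<dots> \<le> ennreal C * emeasure lborel T"
      using T(1) r[OF cE] by (intro mult_left_mono emeasure_mono) (auto simp: Q_def split: if_splits)
    finally show ?thesis .
  qed
  then have "hausdorff_outer_measure ?m E \<le> ennreal C * emeasure lborel T"
    unfolding hausdorff_outer_measure_def by (intro SUP_least) auto
  also have "\<dots> \<le> ennreal C * (emeasure lebesgue W + ennreal (e / C))"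
    by (intro mult_left_mono T_le) simp
  also have "\<dots> = ennreal C * emeasure lebesgue W + ennreal e"
    using C e by (simp add: distrib_left ennreal_mult[symmetric])
  finally show "hausdorff_outer_measure ?m E \<le>
      ennreal (cone_const TYPE('a)) * emeasure lebesgue W + ennreal e" unfolding C_def .
qed

lemma hausdorff_outer_measure_mono:
  "A \<subseteq> B \<Longrightarrow> hausdorff_outer_measure m A \<le> hausdorff_outer_measure m B"
  unfolding hausdorff_outer_measure_def by (auto intro!: SUP_mono' hausdorff_premeasure_mono)

lemma null_sets_hausdorff_measure:
  fixes N :: "'a::metric_space set"
  assumes "hausdorff_outer_measure m N = 0"
  shows "N \<in> null_sets (hausdorff_measure m)"
proof -
  have oms: "outer_measure_space (Pow UNIV) (hausdorff_outer_measure m :: 'a set \<Rightarrow> ennreal)"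
    by (rule outer_measure_space_hausdorff)
  have "subadditive (Pow UNIV) (hausdorff_outer_measure m :: 'a set \<Rightarrow> ennreal)"
    using oms algebra_Pow[of UNIV] unfolding outer_measure_space_def
    by (intro ring_of_sets.countably_subadditive_subadditive)
       (auto simp: algebra_def)
  then have "hausdorff_outer_measure m A \<le>
      hausdorff_outer_measure m (N \<inter> A) + hausdorff_outer_measure m ((UNIV - N) \<inter> A)" for A
    using subadditiveD[of "Pow UNIV" "hausdorff_outer_measure m" "N \<inter> A" "(UNIV - N) \<inter> A"]
    by (auto simp: Int_Un_distrib2[symmetric])
  moreover have "hausdorff_outer_measure m (N \<inter> A) = 0" for A
    using hausdorff_outer_measure_mono[of "N \<inter> A" N m] assms by auto
  moreover have "hausdorff_outer_measure m ((UNIV - N) \<inter> A) \<le> hausdorff_outer_measure m A" for A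
    by (rule hausdorff_outer_measure_mono) auto
  ultimately have "N \<in> lambda_system UNIV (Pow UNIV) (hausdorff_outer_measure m)"
    unfolding lambda_system_def by (auto intro!: antisym)
  then have "N \<in> sets (hausdorff_measure m)" by (simp add: sets_hausdorff_measure)
  then show ?thesis using assms by (simp add: null_sets_def emeasure_hausdorff_measure)
qed

lemma ennreal_le_dyadic_layers:
  fixes y :: ennreal
  assumes "y < top"
  shows "y \<le> indicator {0<..} y + (\<Sum>k. 2 ^ Suc k * indicator {2 ^ k<..} y)"
proof (cases "y \<le> 1")
  case True
  then show ?thesis by (cases "y = 0") (auto simp: indicator_def add_increasing2)
next
  case False
  obtain x where x: "y = ennreal x" "0 \<le> x" using assms by (cases y) auto
  have "1 < x" using False x by (simp add: ennreal_le_1 not_le)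
  define k where "k = (LEAST k. x \<le> 2 ^ Suc k)"
  obtain j where "x < 2 ^ j" using real_arch_pow[of 2 x] by auto
  then have "x \<le> 2 ^ Suc j" using x by (simp add: less_imp_le order_trans[OF less_imp_le])
  then have k1: "x \<le> 2 ^ Suc k" unfolding k_def by (rule LeastI)
  have k2: "2 ^ k < x"
  proof (cases k)
    case (Suc l)
    then have "\<not> x \<le> 2 ^ Suc l" using not_less_Least[of l "\<lambda>k. x \<le> 2 ^ Suc k"] by (simp add: k_def)
    then show ?thesis using Suc by simp
  qed (use \<open>1 < x\<close> in simp)
  have e2: "(2::ennreal) ^ l = ennreal (2 ^ l)" for l by (simp add: ennreal_power[symmetric])
  have "y \<le> 2 ^ Suc k * indicator {2 ^ k<..} y"
    using k1 k2 x by (simp add: e2 ennreal_less_iff indicator_def del: power_Suc)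
  also have "\<dots> \<le> (\<Sum>k. 2 ^ Suc k * indicator {2 ^ k<..} y)"
  proof -
    have "F k \<le> suminf F" for F :: "nat \<Rightarrow> ennreal"
      using sum_le_suminf[of F "{k}"] by simp
    then show ?thesis .
  qed
  finally show ?thesis by (simp add: add_increasing)
qed

text \<open>
  Only measurable subsets of the level sets of \<open>\<phi>\<close> are measured, so \<open>\<phi>\<close> may be arbitrary: the level
  sets that enter are those of simple functions below it.
\<close>

lemma nn_integral_le_dyadic_layers:
  fixes \<phi> :: "'a \<Rightarrow> ennreal"
  assumes fin: "\<And>x. \<phi> x < top"
    and b0: "\<And>A. A \<in> sets M \<Longrightarrow> A \<subseteq> {x. 0 < \<phi> x} \<Longrightarrow> emeasure M A \<le> b0"
    and b: "\<And>A k. A \<in> sets M \<Longrightarrow> A \<subseteq> {x. 2 ^ k < \<phi> x} \<Longrightarrow> emeasure M A \<le> b k"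
  shows "(\<integral>\<^sup>+x. \<phi> x \<partial>M) \<le> b0 + (\<Sum>k. 2 ^ Suc k * b k)"
  unfolding nn_integral_def
proof (rule SUP_least, clarify)
  fix g assume g: "simple_function M g" and le: "g \<le> \<phi>"
  have [measurable]: "g \<in> borel_measurable M" using g by (rule borel_measurable_simple_function)
  have gle: "g x \<le> \<phi> x" for x using le by (simp add: le_fun_def)
  have "integral\<^sup>S M g = (\<integral>\<^sup>+x. g x \<partial>M)" using nn_integral_eq_simple_integral[OF g] by simp
  also have "\<dots> \<le> (\<integral>\<^sup>+x. indicator {0<..} (g x) + (\<Sum>k. 2 ^ Suc k * indicator {2 ^ k<..} (g x)) \<partial>M)"
    using fin gle by (intro nn_integral_mono ennreal_le_dyadic_layers) (meson order.strict_trans1)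
  also have "\<dots> = (\<integral>\<^sup>+x. indicator {0<..} (g x) \<partial>M) + (\<integral>\<^sup>+x. (\<Sum>k. 2 ^ Suc k * indicator {2 ^ k<..} (g x)) \<partial>M)"
    by (rule nn_integral_add) measurable
  also have "(\<integral>\<^sup>+x. (\<Sum>k. 2 ^ Suc k * indicator {2 ^ k<..} (g x)) \<partial>M)
      = (\<Sum>k. \<integral>\<^sup>+x. 2 ^ Suc k * indicator {2 ^ k<..} (g x) \<partial>M)"
    by (rule nn_integral_suminf) measurable
  also have "(\<integral>\<^sup>+x. indicator {0<..} (g x) \<partial>M) + \<dots> \<le> b0 + (\<Sum>k. 2 ^ Suc k * b k)"
  proof (intro add_mono suminf_le)
    have level: "(\<integral>\<^sup>+x. indicator {c<..} (g x) \<partial>M) = emeasure M {x \<in> space M. c < g x}" for c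
    proof -
      have "(\<integral>\<^sup>+x. indicator {c<..} (g x) \<partial>M) = (\<integral>\<^sup>+x. indicator {x \<in> space M. c < g x} x \<partial>M)"
        by (intro nn_integral_cong) (auto simp: indicator_def)
      also have "\<dots> = emeasure M {x \<in> space M. c < g x}"
        by (rule nn_integral_indicator) measurable
      finally show ?thesis .
    qed
    show "(\<integral>\<^sup>+x. indicator {0<..} (g x) \<partial>M) \<le> b0"
      unfolding level using gle by (intro b0) (auto intro: less_le_trans)
    fix k
    have "(\<integral>\<^sup>+x. 2 ^ Suc k * indicator {2 ^ k<..} (g x) \<partial>M) = 2 ^ Suc k * (\<integral>\<^sup>+x. indicator {2 ^ k<..} (g x) \<partial>M)"
      by (rule nn_integral_cmult) measurable
    also have "\<dots> \<le> 2 ^ Suc k * b k"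
      unfolding level using gle by (intro mult_left_mono b) (auto intro: less_le_trans)
    finally show "(\<integral>\<^sup>+x. 2 ^ Suc k * indicator {2 ^ k<..} (g x) \<partial>M) \<le> 2 ^ Suc k * b k" .
  qed auto
  finally show "integral\<^sup>S M g \<le> b0 + (\<Sum>k. 2 ^ Suc k * b k)" .
qed

section \<open>Existence of radial limits\<close>

text \<open>
  The shell contains the radial segments \<open>{5/8..7/8}\<close> over which Hausdorff measure is compared with
  volume, and stays inside the radii \<open>r \<ge> 9/10\<close> at which level sets of \<open>f\<close> are estimated, so that passing from
  \<open>x\<close> to \<open>r *\<^sub>R sgn x\<close> never shortens vectors. Directions are represented by points of the shell
  instead of points of the sphere, which replaces integration in polar coordinates by linear
  changes of variables.
\<close>

definition shell :: "'a::euclidean_space set" where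
  "shell = {x. 1/2 < norm x \<and> norm x < 9/10}"

lemma open_shell: "open shell"
  unfolding shell_def Collect_conj_eq by (intro open_Int open_Collect_less continuous_intros)

lemma shell_borel [measurable]: "shell \<in> sets borel"
  using open_shell by (rule borel_open)

lemma emeasure_lborel_ball_eq:
  "emeasure lborel (ball (c::'a::euclidean_space) r) = ennreal (measure lborel (ball c r))"
  using emeasure_lborel_ball_finite[of c r] by (intro emeasure_eq_ennreal_measure) auto

lemma indicator_ball_measurable [measurable]:
  "(\<lambda>x. indicator (ball c r) x :: ennreal) \<in> borel_measurable (borel :: 'a::euclidean_space measure)"
  by (intro borel_measurable_indicator) simp

text \<open>
  A bound that is uniform over translations survives averaging with a probability density.
\<close>

lemma nn_integral_average_le:
  fixes F :: "'c::euclidean_space \<Rightarrow> 'a::euclidean_space \<Rightarrow> ennreal"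
  assumes [measurable]: "\<phi> \<in> borel_measurable borel" "case_prod F \<in> borel_measurable (borel \<Otimes>\<^sub>M borel)"
    and one: "(\<integral>\<^sup>+z. \<phi> z \<partial>lborel) = 1" and B: "\<And>z. (\<integral>\<^sup>+x. F x z \<partial>lborel) \<le> B"
  shows "(\<integral>\<^sup>+x. (\<integral>\<^sup>+z. \<phi> z * F x z \<partial>lborel) \<partial>lborel) \<le> B"
proof -
  have "(\<integral>\<^sup>+x. (\<integral>\<^sup>+z. \<phi> z * F x z \<partial>lborel) \<partial>lborel) = (\<integral>\<^sup>+z. (\<integral>\<^sup>+x. \<phi> z * F x z \<partial>lborel) \<partial>lborel)"
    by (rule lborel_pair.Fubini'[symmetric]) measurable
  also have "\<dots> = (\<integral>\<^sup>+z. \<phi> z * (\<integral>\<^sup>+x. F x z \<partial>lborel) \<partial>lborel)"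
    by (intro nn_integral_cong nn_integral_cmult) measurable
  also have "\<dots> \<le> (\<integral>\<^sup>+z. \<phi> z * B \<partial>lborel)"
    by (intro nn_integral_mono mult_left_mono B) simp
  also have "\<dots> = B"
    by (simp add: nn_integral_multc one)
  finally show ?thesis .
qed

lemma tail_integral_small:
  fixes h :: "'a::euclidean_space \<Rightarrow> ennreal"
  assumes [measurable]: "h \<in> borel_measurable borel" and fin: "(\<integral>\<^sup>+y. h y \<partial>lborel) < \<infinity>"
    and supp: "AE y in lborel. h y \<noteq> 0 \<longrightarrow> norm y < 1" and e: "e > 0" and a: "a < 1"
  obtains R where "a < R" "R < 1" "(\<integral>\<^sup>+y. h y * indicator {y. R < norm y} y \<partial>lborel) < e"
proof -
  let ?A = "\<lambda>k::nat. {y::'a. 1 - 1 / real (Suc k) < norm y}"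
  let ?M = "density lborel h"
  have "emeasure ?M (?A 0) \<le> emeasure ?M UNIV" by (intro emeasure_mono) auto
  also have "\<dots> < \<infinity>" using fin by (simp add: emeasure_density)
  finally have fin0: "emeasure ?M (?A k) \<noteq> \<infinity>" for k
    using emeasure_mono[of "?A k" UNIV ?M] fin by (auto simp: emeasure_density)
  have dec: "decseq ?A"
  proof (rule decseq_SucI, rule subsetI)
    fix k and y :: 'a assume "y \<in> ?A (Suc k)"
    moreover have "1 - 1 / real (Suc k) \<le> 1 - 1 / real (Suc (Suc k))" by (simp add: field_simps)
    ultimately show "y \<in> ?A k" by simp
  qed
  have "(\<lambda>k. emeasure ?M (?A k)) \<longlonglongrightarrow> emeasure ?M (\<Inter>k. ?A k)"
    using fin0 dec by (intro Lim_emeasure_decseq) auto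
  moreover have "emeasure ?M (\<Inter>k. ?A k) = 0"
  proof -
    have "1 \<le> norm y" if "y \<in> (\<Inter>k. ?A k)" for y :: 'a
    proof (rule ccontr)
      assume "\<not> 1 \<le> norm y"
      then obtain k where "inverse (real (Suc k)) < 1 - norm y"
        using reals_Archimedean[of "1 - norm y"] by auto
      moreover have "1 - 1 / real (Suc k) < norm y" using that by blast
      ultimately show False by (simp add: inverse_eq_divide)
    qed
    note far = this
    from supp have "AE y in lborel. h y * indicator (\<Inter>k. ?A k) y = 0"
    proof eventually_elim
      case (elim y)
      then show ?case using far[of y] by (cases "y \<in> (\<Inter>k. ?A k)") (auto simp del: INT_iff)
    qed
    then have "(\<integral>\<^sup>+y. h y * indicator (\<Inter>k. ?A k) y \<partial>lborel) = (\<integral>\<^sup>+y. 0 \<partial>(lborel :: 'a measure))"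
      by (rule nn_integral_cong_AE)
    then show ?thesis by (simp add: emeasure_density)
  qed
  ultimately have lim: "(\<lambda>k. emeasure ?M (?A k)) \<longlonglongrightarrow> 0" by simp
  have "\<forall>\<^sub>F k in sequentially. emeasure ?M (?A k) < e"
    using order_tendstoD(2)[OF lim e] .
  moreover have "\<forall>\<^sub>F k in sequentially. a < 1 - 1 / real (Suc k)"
  proof -
    have "(\<lambda>k. 1 - 1 / real (Suc k)) \<longlonglongrightarrow> 1 - 0"
      by (intro tendsto_diff tendsto_const LIMSEQ_Suc lim_1_over_n)
    then show ?thesis using a by (intro order_tendstoD(1)) auto
  qed
  ultimately obtain k where "emeasure ?M (?A k) < e" "a < 1 - 1 / real (Suc k)"
    using eventually_happens'[OF sequentially_bot eventually_conj] by blast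
  then show thesis
    by (intro that[of "1 - 1 / real (Suc k)"]) (auto simp: emeasure_density)
qed

lemma mollified_upper_gradientE:
  assumes "mollified_upper_gradient f g" "R < 1" "e > 0" "\<eta> > 0"
  obtains \<phi> where "\<phi> \<in> borel_measurable borel" "(\<integral>\<^sup>+z. \<phi> z \<partial>lborel) = 1"
    "\<And>z. \<phi> z \<noteq> 0 \<Longrightarrow> norm z < \<eta>"
    "\<And>p v t1 t2. t1 \<le> t2 \<Longrightarrow> p + t1 *\<^sub>R v \<in> cball 0 R \<Longrightarrow> p + t2 *\<^sub>R v \<in> cball 0 R \<Longrightarrow>
           ennreal (norm (f (p + t2 *\<^sub>R v) - f (p + t1 *\<^sub>R v))) \<le>
           ennreal e + ennreal (norm v) *
             (\<integral>\<^sup>+z. \<phi> z * (\<integral>\<^sup>+t\<in>{t1..t2}. g (p + t *\<^sub>R v - z) \<partial>lborel) \<partial>lborel)"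
  using assms unfolding mollified_upper_gradient_def by meson

definition radial_oscillation_set ::
  "('a::euclidean_space \<Rightarrow> 'b::real_normed_vector) \<Rightarrow> real \<Rightarrow> real \<Rightarrow> real \<Rightarrow> 'a set" where
  "radial_oscillation_set f d R R' =
     {x \<in> shell. \<exists>s s'. R < s \<and> s \<le> s' \<and> s' < R' \<and> d < norm (f (s' *\<^sub>R sgn x) - f (s *\<^sub>R sgn x))}"

lemma continuous_on_radial_projection:
  assumes "continuous_on (ball 0 1) f" "0 \<le> s" "s < 1"
  shows "continuous_on shell (\<lambda>x. f (s *\<^sub>R sgn x))"
proof (rule continuous_on_compose2[OF assms(1)])
  show "continuous_on shell (\<lambda>x. s *\<^sub>R sgn (x::'a))"
    by (intro continuous_intros) (auto simp: shell_def)
  show "(\<lambda>x. s *\<^sub>R sgn x) ` shell \<subseteq> ball 0 1"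
    using assms by (auto simp: shell_def norm_sgn)
qed

lemma open_radial_level_set:
  fixes f :: "'a::euclidean_space \<Rightarrow> 'b::real_normed_vector"
  assumes "continuous_on (ball 0 1) f" "0 \<le> r" "r < 1"
  shows "open {x \<in> shell. M < norm (f (r *\<^sub>R sgn x))}"
proof -
  have "open (shell \<inter> (\<lambda>x. norm (f (r *\<^sub>R sgn x))) -` {M<..})"
    using assms by (intro continuous_open_preimage continuous_intros continuous_on_radial_projection open_shell) auto
  also have "shell \<inter> (\<lambda>x. norm (f (r *\<^sub>R sgn x))) -` {M<..} = {x \<in> shell. M < norm (f (r *\<^sub>R sgn x))}"
    by auto
  finally show ?thesis .
qed

lemma open_radial_oscillation_set:
  assumes f: "continuous_on (ball 0 1) f" and "0 \<le> R" "R' \<le> 1"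
  shows "open (radial_oscillation_set f d R R')"
proof -
  have "radial_oscillation_set f d R R' =
    (\<Union>s\<in>{R<..}. \<Union>s'\<in>{s..<R'}. {x \<in> shell. d < norm (f (s' *\<^sub>R sgn x) - f (s *\<^sub>R sgn x))})"
    unfolding radial_oscillation_set_def by (auto simp: Bex_def) blast+
  moreover have "open {x \<in> shell. d < norm (f (s' *\<^sub>R sgn x) - f (s *\<^sub>R sgn x))}"
    if "s \<in> {R<..}" "s' \<in> {s..<R'}" for s s'
  proof -
    have "continuous_on shell (\<lambda>x. norm (f (s' *\<^sub>R sgn x) - f (s *\<^sub>R sgn x)))"
      using that assms by (intro continuous_intros continuous_on_radial_projection) auto
    from continuous_open_preimage[OF this open_shell open_greaterThan[of d]]
    have "open (shell \<inter> (\<lambda>x. norm (f (s' *\<^sub>R sgn x) - f (s *\<^sub>R sgn x))) -` {d<..})" .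
    also have "shell \<inter> (\<lambda>x. norm (f (s' *\<^sub>R sgn x) - f (s *\<^sub>R sgn x))) -` {d<..} =
        {x \<in> shell. d < norm (f (s' *\<^sub>R sgn x) - f (s *\<^sub>R sgn x))}" by auto
    finally show ?thesis .
  qed
  ultimately show ?thesis by (auto intro!: open_UN)
qed

lemma nn_integral_scaled_le:
  fixes h :: "'a::euclidean_space \<Rightarrow> ennreal"
  assumes h: "h \<in> borel_measurable borel" and t: "1/2 \<le> t"
  shows "(\<integral>\<^sup>+x. h (t *\<^sub>R x - z) \<partial>lborel) \<le> ennreal (2 ^ DIM('a)) * (\<integral>\<^sup>+y. h y \<partial>lborel)"
proof -
  have "(\<integral>\<^sup>+x. h (t *\<^sub>R x - z) \<partial>lborel) = 1 * (\<integral>\<^sup>+x. h (- z + t *\<^sub>R x) \<partial>lborel)" by simp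
  also have "\<dots> \<le> (ennreal (2 ^ DIM('a)) * ennreal (\<bar>t\<bar> ^ DIM('a))) * (\<integral>\<^sup>+x. h (- z + t *\<^sub>R x) \<partial>lborel)"
  proof (rule mult_right_mono)
    have "1 \<le> (2 * t) ^ DIM('a)" using t by (intro one_le_power) simp
    then show "1 \<le> ennreal (2 ^ DIM('a)) * ennreal (\<bar>t\<bar> ^ DIM('a))"
      using t by (subst ennreal_mult''[symmetric]) (simp_all add: power_mult_distrib del: ennreal_power)
  qed simp
  also have "\<dots> = ennreal (2 ^ DIM('a)) * (\<integral>\<^sup>+y. h y \<partial>lborel)"
    using t by (subst nn_integral_lborel_affine[OF h, of t "- z"]) (auto simp: mult.assoc)
  finally show ?thesis .
qed

text \<open>
  A Chebyshev estimate. The radii through the points of the shell cover each region with bounded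
  density, because \<open>x \<mapsto> t *\<^sub>R x\<close> distorts volume by a bounded factor for \<open>1/2 \<le> t \<le> 2\<close>.
\<close>

lemma emeasure_radial_oscillation_set_le:
  fixes f :: "'a::euclidean_space \<Rightarrow> 'b::real_normed_vector"
  assumes f: "continuous_on (ball 0 1) f" and g: "mollified_upper_gradient f g"
    and R: "1/2 \<le> R0" "R0 < R" "R' < 1" and d: "d > 0"
  shows "ennreal (d / 2) * emeasure lborel (radial_oscillation_set f d R R') \<le>
    ennreal (2 ^ DIM('a)) * ennreal (3/2) * (\<integral>\<^sup>+y. g y * indicator {y. R0 < norm y} y \<partial>lborel)"
proof -
  have [measurable]: "g \<in> borel_measurable borel" using g by (simp add: mollified_upper_gradient_def)
  define g1 where "g1 y = g y * indicator {y. R0 < norm y} y" for y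
  have [measurable]: "g1 \<in> borel_measurable borel" unfolding g1_def by measurable
  let ?E = "radial_oscillation_set f d R R'"
  have E[measurable]: "?E \<in> sets borel"
    using open_radial_oscillation_set[OF f, of R R' d] R by simp
  have pos: "R' < 1" "0 < d / 2" "0 < R - R0" using R d by auto
  obtain \<phi> where [measurable]: "\<phi> \<in> borel_measurable borel" and one: "(\<integral>\<^sup>+z. \<phi> z \<partial>lborel) = 1"
    and small: "\<And>z. \<phi> z \<noteq> 0 \<Longrightarrow> norm z < R - R0"
    and seg: "\<And>p v t1 t2. t1 \<le> t2 \<Longrightarrow> p + t1 *\<^sub>R v \<in> cball 0 R' \<Longrightarrow> p + t2 *\<^sub>R v \<in> cball 0 R' \<Longrightarrow>
           ennreal (norm (f (p + t2 *\<^sub>R v) - f (p + t1 *\<^sub>R v))) \<le>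
           ennreal (d / 2) + ennreal (norm v) *
             (\<integral>\<^sup>+z. \<phi> z * (\<integral>\<^sup>+t\<in>{t1..t2}. g (p + t *\<^sub>R v - z) \<partial>lborel) \<partial>lborel)"
    by (rule mollified_upper_gradientE[OF g pos]) (rule that)
  let ?F = "\<lambda>x z. (\<integral>\<^sup>+t. g1 (t *\<^sub>R x - z) * indicator {1/2..2} t \<partial>lborel)"
  have "ennreal (d / 2) * emeasure lborel ?E = (\<integral>\<^sup>+x. ennreal (d / 2) * indicator ?E x \<partial>lborel)"
    by (rule nn_integral_cmult_indicator[symmetric]) simp
  also have "\<dots> \<le> (\<integral>\<^sup>+x. (\<integral>\<^sup>+z. \<phi> z * ?F x z \<partial>lborel) \<partial>lborel)"
  proof (rule nn_integral_mono)
    fix x :: 'a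
    show "ennreal (d / 2) * indicator ?E x \<le> (\<integral>\<^sup>+z. \<phi> z * ?F x z \<partial>lborel)"
    proof (cases "x \<in> ?E")
      case True
      then obtain s s' where x: "1/2 < norm x" "norm x < 1" and s: "R < s" "s \<le> s'" "s' < R'"
        and osc: "d < norm (f (s' *\<^sub>R sgn x) - f (s *\<^sub>R sgn x))"
        unfolding radial_oscillation_set_def shell_def by auto
      define t1 t2 where "t1 = s / norm x" and "t2 = s' / norm x"
      have t: "t1 \<le> t2" "1/2 \<le> t1" "t2 \<le> 2"
      proof -
        have "1/2 * norm x \<le> s" using x s R by linarith
        moreover have "0 < norm x" using x by linarith
        ultimately show "1/2 \<le> t1" unfolding t1_def by (subst pos_le_divide_eq)
        have "s' \<le> 2 * norm x" "0 < norm x" using x s R by linarith+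
        then show "t2 \<le> 2" unfolding t2_def by (subst pos_divide_le_eq)
      qed (use x s in \<open>auto simp: t1_def t2_def divide_right_mono\<close>)
      have tx: "t1 *\<^sub>R x = s *\<^sub>R sgn x" "t2 *\<^sub>R x = s' *\<^sub>R sgn x"
        by (simp_all add: t1_def t2_def sgn_div_norm divide_inverse)
      have nx: "norm (sgn x) = 1" using x by (auto simp: norm_sgn)
      have "ennreal (d / 2) + ennreal (d / 2) = ennreal d"
        using d by (simp flip: ennreal_plus)
      also have "\<dots> \<le> ennreal (norm (f (0 + t2 *\<^sub>R x) - f (0 + t1 *\<^sub>R x)))"
        using osc by (simp add: tx)
      also have "\<dots> \<le> ennreal (d / 2) + ennreal (norm x) *
          (\<integral>\<^sup>+z. \<phi> z * (\<integral>\<^sup>+t\<in>{t1..t2}. g (0 + t *\<^sub>R x - z) \<partial>lborel) \<partial>lborel)"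
        using s R nx by (intro seg t(1)) (auto simp: tx)
      finally have "ennreal (d / 2) \<le> ennreal (norm x) *
          (\<integral>\<^sup>+z. \<phi> z * (\<integral>\<^sup>+t\<in>{t1..t2}. g (0 + t *\<^sub>R x - z) \<partial>lborel) \<partial>lborel)"
        by (simp add: ennreal_add_left_cancel_le)
      also have "\<dots> \<le> 1 * (\<integral>\<^sup>+z. \<phi> z * ?F x z \<partial>lborel)"
      proof (rule mult_mono)
        show "ennreal (norm x) \<le> 1" using x by (simp add: ennreal_le_1)
        show "(\<integral>\<^sup>+z. \<phi> z * (\<integral>\<^sup>+t\<in>{t1..t2}. g (0 + t *\<^sub>R x - z) \<partial>lborel) \<partial>lborel) \<le> (\<integral>\<^sup>+z. \<phi> z * ?F x z \<partial>lborel)"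
        proof (rule nn_integral_mono)
        fix z
        show "\<phi> z * (\<integral>\<^sup>+t\<in>{t1..t2}. g (0 + t *\<^sub>R x - z) \<partial>lborel) \<le> \<phi> z * ?F x z"
        proof (cases "\<phi> z = 0")
          case False
          have "g (0 + t *\<^sub>R x - z) * indicator {t1..t2} t \<le> g1 (t *\<^sub>R x - z) * indicator {1/2..2} t" for t
          proof (cases "t \<in> {t1..t2}")
            case True
            have "s = t1 * norm x" using nx by (auto simp: t1_def)
            also have "\<dots> \<le> t * norm x" using True by (intro mult_right_mono) auto
            finally have "R0 < norm (t *\<^sub>R x) - norm z" using s(1) small[OF False] True t by simp
            also have "\<dots> \<le> norm (t *\<^sub>R x - z)" by (rule norm_triangle_ineq2)
            finally show ?thesis using True t by (simp add: g1_def)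
          qed simp
          then show ?thesis by (intro mult_left_mono nn_integral_mono) auto
        qed simp
        qed
      qed auto
      finally show ?thesis using True by simp
    qed simp
  qed
  also have "\<dots> \<le> ennreal (2 ^ DIM('a)) * ennreal (3/2) * (\<integral>\<^sup>+y. g1 y \<partial>lborel)"
  proof (rule nn_integral_average_le[OF _ _ one])
    fix z
    have "(\<integral>\<^sup>+x. ?F x z \<partial>lborel) = (\<integral>\<^sup>+t. (\<integral>\<^sup>+x. g1 (t *\<^sub>R x - z) * indicator {1/2..2} t \<partial>lborel) \<partial>lborel)"
      by (rule lborel_pair.Fubini'[symmetric]) measurable
    also have "\<dots> \<le> (\<integral>\<^sup>+t. ennreal (2 ^ DIM('a)) * (\<integral>\<^sup>+y. g1 y \<partial>lborel) * indicator {1/2..2::real} t \<partial>lborel)"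
    proof (rule nn_integral_mono)
      fix t :: real
      show "(\<integral>\<^sup>+x. g1 (t *\<^sub>R x - z) * indicator {1/2..2} t \<partial>lborel) \<le>
         ennreal (2 ^ DIM('a)) * (\<integral>\<^sup>+y. g1 y \<partial>lborel) * indicator {1/2..2} t"
        using nn_integral_scaled_le[of g1 t z] by (cases "t \<in> {1/2..2}") auto
    qed
    also have "\<dots> = ennreal (2 ^ DIM('a)) * (\<integral>\<^sup>+y. g1 y \<partial>lborel) * ennreal (3/2)"
      by (subst nn_integral_cmult_indicator) auto
    finally show "(\<integral>\<^sup>+x. ?F x z \<partial>lborel) \<le> ennreal (2 ^ DIM('a)) * ennreal (3/2) * (\<integral>\<^sup>+y. g1 y \<partial>lborel)"
      by (simp only: mult_ac)
  qed measurable
  finally show ?thesis unfolding g1_def .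
qed

text \<open>
  For each \<open>d\<close>, the set of directions with oscillation above \<open>d\<close> arbitrarily close to the sphere is
  null, since its measure is bounded by tails of the integral of \<open>g\<close>. Elsewhere the Cauchy criterion
  holds.
\<close>

lemma AE_radial_limit:
  fixes f :: "'a::euclidean_space \<Rightarrow> 'b::banach"
  assumes f: "continuous_on (ball 0 1) f" and g: "mollified_upper_gradient f g"
    and fin: "(\<integral>\<^sup>+y. g y \<partial>lborel) < \<infinity>" and supp: "AE y in lborel. g y \<noteq> 0 \<longrightarrow> norm y < 1"
  shows "AE x in lborel. x \<in> shell \<longrightarrow> (\<exists>l. has_radial_limit f l (sgn x))"
proof -
  have [measurable]: "g \<in> borel_measurable borel" using g by (simp add: mollified_upper_gradient_def)
  define N where "N d = (\<Inter>k::nat. radial_oscillation_set f d (1 - 1 / real (k + 2)) 1)" for d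
  have op: "open (radial_oscillation_set f d (1 - 1 / real (k + 2)) 1)" for d and k :: nat
    by (rule open_radial_oscillation_set[OF f]) auto
  have N_borel: "N d \<in> sets borel" for d
    unfolding N_def using op by (intro sets.countable_INT) auto
  have "emeasure lborel (N d) = 0" if d: "d > 0" for d
  proof -
    have "emeasure lborel (N d) \<le> ennreal (2 / d) * e" if e: "e > 0" for e
    proof -
      let ?c = "ennreal (2 ^ DIM('a)) * ennreal (3/2)"
      have c: "?c = ennreal (2 ^ DIM('a) * (3/2))"
        by (subst ennreal_mult''[symmetric]) (simp_all del: ennreal_power)
      obtain e' where e': "e' > 0" "?c * e' \<le> e"
      proof (cases "e = top")
        case True then show thesis using that[of 1] by simp
      next
        case False
        then obtain x where x: "e = ennreal x" "x > 0" using e by (cases e) auto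
        then show thesis
          by (intro that[of "ennreal (x / (2 ^ DIM('a) * (3/2)))"])
             (auto simp: c ennreal_mult[symmetric] simp del: ennreal_power)
      qed
      obtain R0 where R0: "1/2 < R0" "R0 < 1" "(\<integral>\<^sup>+y. g y * indicator {y. R0 < norm y} y \<partial>lborel) < e'"
        using tail_integral_small[OF _ fin supp e'(1), of "1/2"] by auto
      obtain k :: nat where k: "R0 < 1 - 1 / real (k + 2)"
      proof -
        obtain k where "inverse (real (Suc k)) < 1 - R0" using reals_Archimedean[of "1 - R0"] R0 by auto
        moreover have "1 / real (k + 2) \<le> inverse (real (Suc k))" by (simp add: field_simps)
        ultimately show thesis by (intro that[of k]) linarith
      qed
      let ?R = "1 - 1 / real (k + 2)"
      let ?E = "\<lambda>j::nat. radial_oscillation_set f d ?R (1 - 1 / real (Suc j))"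
      have Eop: "open (?E j)" for j
        by (rule open_radial_oscillation_set[OF f]) auto
      have inc: "incseq ?E"
      proof (rule incseq_SucI, rule subsetI)
        fix j x assume "x \<in> ?E j"
        moreover have "1 - 1 / real (Suc j) \<le> 1 - 1 / real (Suc (Suc j))" by (simp add: field_simps)
        ultimately show "x \<in> ?E (Suc j)"
          unfolding radial_oscillation_set_def by (blast intro: less_le_trans)
      qed
      have "N d \<subseteq> (\<Union>j. ?E j)"
      proof
        fix x assume "x \<in> N d"
        then have "x \<in> radial_oscillation_set f d ?R 1" unfolding N_def by blast
        then obtain s s' where s: "x \<in> shell" "?R < s" "s \<le> s'" "s' < 1" "d < norm (f (s' *\<^sub>R sgn x) - f (s *\<^sub>R sgn x))"
          unfolding radial_oscillation_set_def by blast
        obtain j where "inverse (real (Suc j)) < 1 - s'" using reals_Archimedean[of "1 - s'"] s by auto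
        then have "s' < 1 - 1 / real (Suc j)" by (simp add: inverse_eq_divide)
        with s show "x \<in> (\<Union>j. ?E j)" unfolding radial_oscillation_set_def by blast
      qed
      then have "emeasure lborel (N d) \<le> emeasure lborel (\<Union>j. ?E j)"
        using Eop by (intro emeasure_mono) auto
      also have "\<dots> = (SUP j. emeasure lborel (?E j))"
        using Eop inc by (intro SUP_emeasure_incseq[symmetric]) auto
      also have "\<dots> \<le> ennreal (2 / d) * e"
      proof (rule SUP_least)
        fix j
        have "ennreal (d / 2) * emeasure lborel (?E j) \<le> ?c * (\<integral>\<^sup>+y. g y * indicator {y. R0 < norm y} y \<partial>lborel)"
          using R0 k d by (intro emeasure_radial_oscillation_set_le[OF f g]) auto
        also have "\<dots> \<le> ?c * e'" using R0(3) by (intro mult_left_mono) auto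
        also have "\<dots> \<le> e" by (rule e')
        finally have "ennreal (2 / d) * (ennreal (d / 2) * emeasure lborel (?E j)) \<le> ennreal (2 / d) * e"
          by (rule mult_left_mono) simp
        then show "emeasure lborel (?E j) \<le> ennreal (2 / d) * e"
          using d by (simp add: mult.assoc[symmetric] ennreal_mult[symmetric])
      qed
      finally show ?thesis .
    qed
    from this[of "ennreal (d / 2 * e)" for e] have "emeasure lborel (N d) \<le> ennreal e" if "e > 0" for e
      using that d by (simp add: ennreal_mult[symmetric])
    then show ?thesis using ennreal_le_epsilon[of 0 "emeasure lborel (N d)"] by simp
  qed
  then have "AE x in lborel. x \<notin> N (1 / real (Suc m))" for m
    using N_borel by (intro AE_not_in) (auto simp: null_sets_def)
  then have "AE x in lborel. \<forall>m. x \<notin> N (1 / real (Suc m))"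
    by (simp add: AE_all_countable)
  then show ?thesis
  proof eventually_elim
    case (elim x)
    show ?case
    proof
      assume x: "x \<in> shell"
      let ?u = "\<lambda>t. f (t *\<^sub>R sgn x)"
      have "cauchy_filter (filtermap ?u (at_left 1))"
        unfolding cauchy_filter_metric_filtermap
      proof (intro allI impI)
        fix e :: real assume "e > 0"
        then obtain m where m: "inverse (real (Suc m)) < e" using reals_Archimedean by blast
        obtain k :: nat where k: "x \<notin> radial_oscillation_set f (1 / real (Suc m)) (1 - 1 / real (k + 2)) 1"
          using elim unfolding N_def by blast
        have le: "dist (?u s) (?u s') \<le> 1 / real (Suc m)"
          if "1 - 1 / real (k + 2) < s" "s \<le> s'" "s' < 1" for s s'
          using k x that unfolding radial_oscillation_set_def by (force simp: dist_norm norm_minus_commute not_less)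
        show "\<exists>P. eventually P (at_left 1) \<and> (\<forall>s s'. P s \<and> P s' \<longrightarrow> dist (?u s) (?u s') < e)"
        proof (intro exI conjI allI impI)
          show "\<forall>\<^sub>F s in at_left 1. s \<in> {1 - 1 / real (k + 2)<..<1}"
            by (rule eventually_at_left_real) simp
          fix s s' assume "s \<in> {1 - 1 / real (k + 2)<..<1} \<and> s' \<in> {1 - 1 / real (k + 2)<..<1}"
          then have "dist (?u s) (?u s') \<le> 1 / real (Suc m)"
            using le[of s s'] le[of s' s] by (cases "s \<le> s'") (auto simp: dist_commute)
          then show "dist (?u s) (?u s') < e" using m by (simp add: inverse_eq_divide)
        qed
      qed
      then have "\<exists>l. filtermap ?u (at_left 1) \<le> nhds l"
        by (rule cauchy_filter_complete_converges[where A = UNIV])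
           (auto simp: filtermap_bot_iff complete_UNIV)
      then show "\<exists>l. has_radial_limit f l (sgn x)"
        by (simp add: has_radial_limit_def filterlim_def)
    qed
  qed
qed

section \<open>Kernel estimates over the shell\<close>

text \<open>
  The power \<open>u\<close> to the \<open>- s\<close>. It is written as an inverse in the extended nonnegative reals to make the
  value at \<open>0\<close> infinite, whereas \<^const>\<open>powr\<close> would make it \<open>0\<close> and destroy monotonicity.
\<close>

definition riesz_kernel :: "real \<Rightarrow> real \<Rightarrow> ennreal" where
  "riesz_kernel s u = inverse (ennreal (u powr s))"

lemma riesz_kernel_borel [measurable]:
  "h \<in> borel_measurable M \<Longrightarrow> (\<lambda>x. riesz_kernel s (h x)) \<in> borel_measurable M"
  unfolding riesz_kernel_def by measurable

lemma riesz_kernel_pos: "0 < u \<Longrightarrow> riesz_kernel s u = ennreal (u powr - s)"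
  unfolding riesz_kernel_def by (simp add: inverse_ennreal powr_minus)

lemma riesz_kernel_0: "0 < s \<Longrightarrow> riesz_kernel s 0 = top"
  unfolding riesz_kernel_def by simp

lemma riesz_kernel_antimono:
  assumes "0 \<le> u" "u \<le> v" "0 < s"
  shows "riesz_kernel s v \<le> riesz_kernel s u"
proof (cases "u = 0")
  case False
  then show ?thesis using assms by (auto simp: riesz_kernel_pos intro!: ennreal_leI powr_mono2')
qed (use assms in \<open>simp add: riesz_kernel_0\<close>)

lemma riesz_kernel_le_threshold:
  assumes "0 \<le> u" "0 < s" "s \<le> 1/2" "0 < D"
  shows "riesz_kernel s u \<le> ennreal (D powr - s) + ennreal (D powr (1/2 - s)) * riesz_kernel (1/2) u"
proof -
  consider "u = 0" | "0 < u" "u < D" | "D \<le> u" using assms by linarith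
  then show ?thesis
  proof cases
    case 1
    then show ?thesis using assms by (simp add: riesz_kernel_0 ennreal_mult_top)
  next
    case 2
    have "u powr - s = u powr (1/2 - s) * u powr - (1/2)" by (simp add: powr_add[symmetric])
    also have "\<dots> \<le> D powr (1/2 - s) * u powr - (1/2)"
      using 2 assms by (intro mult_right_mono powr_mono2) auto
    finally have "ennreal (u powr - s) \<le> ennreal (D powr (1/2 - s)) * ennreal (u powr - (1/2))"
      by (simp add: ennreal_mult[symmetric])
    then show ?thesis using 2 by (simp only: riesz_kernel_pos) (rule add_increasing, simp_all)
  next
    case 3
    then have "riesz_kernel s u \<le> riesz_kernel s D" using assms by (intro riesz_kernel_antimono) auto
    also have "\<dots> = ennreal (D powr - s)" using assms by (simp add: riesz_kernel_pos)
    finally show ?thesis by (simp add: add_increasing2)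
  qed
qed

lemma nn_integral_powr_unit:
  assumes "a > - 1"
  shows "(\<integral>\<^sup>+t. ennreal (t powr a) * indicator {0..1} t \<partial>lborel) = ennreal (1 / (a + 1))"
proof -
  have "((\<lambda>x. x powr a) has_integral (1 powr (a + 1) / (a + 1))) {0..1}"
    using assms by (intro has_integral_powr_from_0) auto
  then have "(\<integral>\<^sup>+x. ennreal (indicator {0..1} x * x powr a) \<partial>lborel) = ennreal (1 / (a + 1))"
    by (intro nn_integral_has_integral_lebesgue) auto
  moreover have "ennreal (t powr a) * indicator {0..1} t = ennreal (indicator {0..1} t * t powr a)" for t :: real
    by (simp add: indicator_def)
  ultimately show ?thesis by simp
qed

lemma nn_integral_riesz_kernel_line:
  "(\<integral>\<^sup>+u. riesz_kernel (1/2) \<bar>u\<bar> * indicator {-1..1} u \<partial>lborel) \<le> 4"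
proof -
  let ?k = "\<lambda>u. ennreal (u powr - (1/2)) * indicator {0..1} u"
  have "AE u in lborel. riesz_kernel (1/2) \<bar>u\<bar> * indicator {-1..1} u \<le> ?k u + ?k (0 + (-1) * u)"
    using AE_lborel_singleton[of 0]
  proof eventually_elim
    case (elim u)
    then have "riesz_kernel (1/2) \<bar>u\<bar> = ennreal (\<bar>u\<bar> powr - (1/2))" by (intro riesz_kernel_pos) auto
    then show ?case by (cases "u \<ge> 0") (auto simp: indicator_def)
  qed
  then have "(\<integral>\<^sup>+u. riesz_kernel (1/2) \<bar>u\<bar> * indicator {-1..1} u \<partial>lborel) \<le>
      (\<integral>\<^sup>+u. ?k u + ?k (0 + (-1) * u) \<partial>lborel)"
    by (rule nn_integral_mono_AE)
  also have "\<dots> = (\<integral>\<^sup>+u. ?k u \<partial>lborel) + (\<integral>\<^sup>+u. ?k (0 + (-1) * u) \<partial>lborel)"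
    by (rule nn_integral_add) measurable
  also have "(\<integral>\<^sup>+u. ?k (0 + (-1) * u) \<partial>lborel) = (\<integral>\<^sup>+u. ?k u \<partial>lborel)"
    using nn_integral_real_affine[of ?k "-1" 0] by simp
  also have "(\<integral>\<^sup>+u. ?k u \<partial>lborel) = 2"
    using nn_integral_powr_unit[of "- (1/2)"] by simp
  finally show ?thesis by simp
qed

definition slab_const :: "'a::euclidean_space itself \<Rightarrow> real" where
  "slab_const _ = 4 * measure lborel (ball (0::'a) 2)"

text \<open>
  The kernel depends on one coordinate only. Averaging over translations by \<open>u *\<^sub>R w\<close> with \<open>0 \<le> u \<le> 1\<close>
  reduces the integral to the one-dimensional one, without choosing coordinates.
\<close>

lemma nn_integral_riesz_kernel_slab:
  fixes w :: "'a::euclidean_space"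
  assumes w: "norm w = 1"
  shows "(\<integral>\<^sup>+x. riesz_kernel (1/2) \<bar>x \<bullet> w\<bar> * indicator (ball 0 1) x \<partial>lborel) \<le> ennreal (slab_const TYPE('a))"
proof -
  have ww: "w \<bullet> w = 1" using w by (simp add: dot_square_norm)
  let ?h = "\<lambda>x. riesz_kernel (1/2) \<bar>x \<bullet> w\<bar> * indicator (ball 0 1) x"
  let ?k = "\<lambda>u. riesz_kernel (1/2) \<bar>u\<bar> * indicator {-1..1} u"
  have [measurable]: "?k \<in> borel_measurable borel" by measurable
  have "(\<integral>\<^sup>+x. ?h x \<partial>lborel) = (\<integral>\<^sup>+u. (\<integral>\<^sup>+x. ?h x \<partial>lborel) * indicator {0..1::real} u \<partial>lborel)"
    by (subst nn_integral_cmult_indicator) auto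
  also have "\<dots> \<le> (\<integral>\<^sup>+u. (\<integral>\<^sup>+x. indicator (ball (0::'a) 2) x * (?k (x \<bullet> w + u) * indicator {0..1} u) \<partial>lborel) \<partial>lborel)"
  proof (rule nn_integral_mono)
    fix u :: real
    show "(\<integral>\<^sup>+x. ?h x \<partial>lborel) * indicator {0..1} u \<le>
      (\<integral>\<^sup>+x. indicator (ball (0::'a) 2) x * (?k (x \<bullet> w + u) * indicator {0..1} u) \<partial>lborel)"
    proof (cases "u \<in> {0..1}")
      case True
      have "(\<integral>\<^sup>+x. ?h x \<partial>lborel) = (\<integral>\<^sup>+x. ?h (x - (- u *\<^sub>R w)) \<partial>lborel)"
        by (rule nn_integral_lborel_shift[symmetric]) measurable
      also have "\<dots> \<le> (\<integral>\<^sup>+x. indicator (ball (0::'a) 2) x * ?k (x \<bullet> w + u) \<partial>lborel)"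
      proof (rule nn_integral_mono)
        fix x :: 'a
        show "?h (x - (- u *\<^sub>R w)) \<le> indicator (ball (0::'a) 2) x * ?k (x \<bullet> w + u)"
        proof (cases "x - (- u *\<^sub>R w) \<in> ball 0 1")
          case in_ball: True
          have "norm x \<le> norm (x - (- u *\<^sub>R w)) + norm (- u *\<^sub>R w)"
            using norm_triangle_sub[of x "- u *\<^sub>R w"] by (simp add: add.commute)
          then have "norm x < 2" using in_ball True w by simp
          have e: "(x - (- u *\<^sub>R w)) \<bullet> w = x \<bullet> w + u" by (simp add: inner_simps ww)
          have "\<bar>(x - (- u *\<^sub>R w)) \<bullet> w\<bar> \<le> norm (x - (- u *\<^sub>R w)) * norm w" by (rule Cauchy_Schwarz_ineq2)
          then have "\<bar>x \<bullet> w + u\<bar> \<le> 1" using in_ball w e by simp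
          then have "x \<bullet> w + u \<in> {-1..1}" unfolding atLeastAtMost_iff by linarith
          then show ?thesis using \<open>norm x < 2\<close> by (simp only: e) (simp add: indicator_def)
        qed simp
      qed
      finally show ?thesis using True by simp
    qed simp
  qed
  also have "\<dots> = (\<integral>\<^sup>+x. (\<integral>\<^sup>+u. indicator (ball (0::'a) 2) x * (?k (x \<bullet> w + u) * indicator {0..1} u) \<partial>lborel) \<partial>lborel)"
    by (rule lborel_pair.Fubini') measurable
  also have "\<dots> \<le> (\<integral>\<^sup>+x. 4 * indicator (ball (0::'a) 2) x \<partial>lborel)"
  proof (rule nn_integral_mono)
    fix x :: 'a
    have "(\<integral>\<^sup>+u. indicator (ball (0::'a) 2) x * (?k (x \<bullet> w + u) * indicator {0..1} u) \<partial>lborel) \<le>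
        (\<integral>\<^sup>+u. indicator (ball (0::'a) 2) x * ?k (x \<bullet> w + 1 * u) \<partial>lborel)"
      by (intro nn_integral_mono) (simp add: indicator_def)
    also have "\<dots> = indicator (ball (0::'a) 2) x * (\<integral>\<^sup>+u. ?k (x \<bullet> w + 1 * u) \<partial>lborel)"
      by (rule nn_integral_cmult) measurable
    also have "(\<integral>\<^sup>+u. ?k (x \<bullet> w + 1 * u) \<partial>lborel) = (\<integral>\<^sup>+u. ?k u \<partial>lborel)"
      using nn_integral_real_affine[of ?k 1 "x \<bullet> w"] by simp
    also have "indicator (ball (0::'a) 2) x * (\<integral>\<^sup>+u. ?k u \<partial>lborel) \<le> indicator (ball (0::'a) 2) x * 4"
      by (intro mult_left_mono nn_integral_riesz_kernel_line) simp
    finally show "(\<integral>\<^sup>+u. indicator (ball (0::'a) 2) x * (?k (x \<bullet> w + u) * indicator {0..1} u) \<partial>lborel)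
        \<le> 4 * indicator (ball (0::'a) 2) x" by (simp only: mult.commute)
  qed
  also have "\<dots> = 4 * emeasure lborel (ball (0::'a) 2)"
    by (rule nn_integral_cmult_indicator) simp
  also have "emeasure lborel (ball (0::'a) 2) = ennreal (measure lborel (ball (0::'a) 2))"
    by (rule emeasure_lborel_ball_eq)
  also have "4 * \<dots> = ennreal (slab_const TYPE('a))"
    unfolding slab_const_def by (simp add: ennreal_mult)
  finally show ?thesis .
qed

lemma slab_const_nonneg: "0 \<le> slab_const TYPE('a::euclidean_space)"
  by (simp add: slab_const_def)

text \<open>
  In dimension at least two there is a unit vector \<open>w\<close> orthogonal to \<open>y\<close>, and the component along
  \<open>w\<close> bounds the distance to \<open>y\<close> from below uniformly in \<open>y\<close>. This settles the exponent
  \<open>1/2\<close>. For smaller \<open>s\<close> the kernel is split at the distance \<open>m\<^sup>2\<close>, which balances the two parts and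
  yields the power of \<open>m\<close>.
\<close>

lemma nn_integral_riesz_kernel_radial_le:
  fixes y :: "'a::euclidean_space"
  assumes dim: "DIM('a) \<ge> 2" and r: "9/10 \<le> r" and s: "0 < s" "s \<le> 1/2"
    and X: "X \<in> sets borel" "X \<subseteq> shell" and m: "emeasure lborel X = ennreal m" "0 < m"
  shows "(\<integral>\<^sup>+x. riesz_kernel s (norm (y - r *\<^sub>R sgn x)) * indicator X x \<partial>lborel) \<le>
           ennreal ((1 + slab_const TYPE('a)) * m powr (1 - 2 * s))"
proof -
  note [measurable] = X(1)
  obtain w :: 'a where w: "norm w = 1" "y \<bullet> w = 0"
  proof -
    obtain v :: 'a where v: "v \<noteq> 0" "orthogonal y v"
      using orthogonal_to_vector_exists[OF dim, of y] by blast
    show thesis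
      by (rule that[of "sgn v"]) (use v in \<open>auto simp: norm_sgn sgn_div_norm orthogonal_def\<close>)
  qed
  have half: "(\<integral>\<^sup>+x. riesz_kernel (1/2) (norm (y - r *\<^sub>R sgn x)) * indicator X x \<partial>lborel) \<le> ennreal (slab_const TYPE('a))"
  proof (rule order_trans[OF nn_integral_mono nn_integral_riesz_kernel_slab[OF w(1)]])
    fix x :: 'a
    show "riesz_kernel (1/2) (norm (y - r *\<^sub>R sgn x)) * indicator X x \<le> riesz_kernel (1/2) \<bar>x \<bullet> w\<bar> * indicator (ball 0 1) x"
    proof (cases "x \<in> X")
      case True
      then have x: "1/2 < norm x" "norm x < 9/10" using X(2) by (auto simp: shell_def)
      have "\<bar>x \<bullet> w\<bar> * 1 \<le> \<bar>x \<bullet> w\<bar> * (r / norm x)"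
      proof (rule mult_left_mono)
        have "norm x \<le> r" "0 < norm x" using x r by linarith+
        then show "1 \<le> r / norm x" by (subst pos_le_divide_eq) auto
      qed simp
      also have "\<dots> = \<bar>(y - r *\<^sub>R sgn x) \<bullet> w\<bar>"
      proof -
        have "(y - r *\<^sub>R sgn x) \<bullet> w = - ((r / norm x) * (x \<bullet> w))"
          by (simp add: inner_diff_left w(2) sgn_div_norm divide_inverse)
        moreover have "\<bar>r / norm x\<bar> = r / norm x" using r by simp
        ultimately show ?thesis by (simp only: abs_minus_cancel abs_mult mult.commute)
      qed
      also have "\<dots> \<le> norm (y - r *\<^sub>R sgn x) * norm w" by (rule Cauchy_Schwarz_ineq2)
      finally have "\<bar>x \<bullet> w\<bar> \<le> norm (y - r *\<^sub>R sgn x)" using w by simp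
      then have "riesz_kernel (1/2) (norm (y - r *\<^sub>R sgn x)) \<le> riesz_kernel (1/2) \<bar>x \<bullet> w\<bar>"
        by (intro riesz_kernel_antimono) auto
      then show ?thesis using True x by simp
    qed simp
  qed
  \<comment> \<open>The threshold for splitting the kernel.\<close>
  let ?D = "m\<^sup>2"
  have p: "?D powr - s * m = m powr (1 - 2 * s)" "?D powr (1/2 - s) = m powr (1 - 2 * s)"
  proof -
    have "?D = m powr 2" using m(2) by simp
    then have sq: "?D powr a = m powr (2 * a)" for a by (simp only: powr_powr)
    show "?D powr - s * m = m powr (1 - 2 * s)"
      using m(2) powr_add[of m "- 2 * s" 1] by (simp add: sq)
    show "?D powr (1/2 - s) = m powr (1 - 2 * s)"
      by (simp add: sq algebra_simps)
  qed
  have "(\<integral>\<^sup>+x. riesz_kernel s (norm (y - r *\<^sub>R sgn x)) * indicator X x \<partial>lborel) \<le>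
    (\<integral>\<^sup>+x. ennreal (?D powr - s) * indicator X x +
        ennreal (?D powr (1/2 - s)) * (riesz_kernel (1/2) (norm (y - r *\<^sub>R sgn x)) * indicator X x) \<partial>lborel)"
    using riesz_kernel_le_threshold[of "norm (y - r *\<^sub>R sgn x)" s ?D for x] s m(2)
    by (intro nn_integral_mono) (auto simp: indicator_def)
  also have "\<dots> = ennreal (?D powr - s) * emeasure lborel X +
      ennreal (?D powr (1/2 - s)) * (\<integral>\<^sup>+x. riesz_kernel (1/2) (norm (y - r *\<^sub>R sgn x)) * indicator X x \<partial>lborel)"
    by (simp add: nn_integral_add nn_integral_cmult nn_integral_cmult_indicator)
  also have "\<dots> \<le> ennreal (?D powr - s) * ennreal m + ennreal (?D powr (1/2 - s)) * ennreal (slab_const TYPE('a))"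
    unfolding m(1) by (intro add_mono mult_left_mono half) auto
  also have "\<dots> = ennreal (?D powr - s * m) + ennreal (?D powr (1/2 - s) * slab_const TYPE('a))"
    using m(2) by (simp add: ennreal_mult'' slab_const_nonneg)
  also have "\<dots> = ennreal ((1 + slab_const TYPE('a)) * m powr (1 - 2 * s))"
    unfolding p by (subst ennreal_plus[symmetric]) (auto simp: slab_const_nonneg algebra_simps)
  finally show ?thesis .
qed

section \<open>Segments joining a small ball to a sphere\<close>

text \<open>
  A segment from \<open>P\<close> to a point of the central ball has length bounded above and below, so it can pass
  through \<open>y\<close> only at a parameter comparable to the distance from \<open>P\<close> to \<open>y\<close>.
\<close>

lemma nn_integral_segment_window_le:
  fixes P y :: "'a::euclidean_space"
  assumes P: "9/10 \<le> norm P" "norm P \<le> 1" and s: "0 < s" "s \<le> 1/2"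
  shows "(\<integral>\<^sup>+t. ennreal (t powr (- 1 - s)) *
      (indicator (ball 0 (1/2)) ((1 / t) *\<^sub>R (y - (1 - t) *\<^sub>R P)) * indicator {0<..1} t) \<partial>lborel)
    \<le> 10 * riesz_kernel s (norm (y - P))"
proof (cases "y = P")
  case True
  then show ?thesis using s by (simp add: riesz_kernel_0 ennreal_mult_top)
next
  case False
  define d where "d = norm (y - P)"
  have d: "d > 0" using False by (simp add: d_def)
  have "(\<integral>\<^sup>+t. ennreal (t powr (- 1 - s)) *
      (indicator (ball 0 (1/2)) ((1 / t) *\<^sub>R (y - (1 - t) *\<^sub>R P)) * indicator {0<..1} t) \<partial>lborel)
    \<le> (\<integral>\<^sup>+t. ennreal ((2 * d / 3) powr (- 1 - s)) * indicator {2 * d / 3 .. 5 * d / 2} t \<partial>lborel)"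
  proof (rule nn_integral_mono)
    fix t :: real
    define a where "a = (1 / t) *\<^sub>R (y - (1 - t) *\<^sub>R P)"
    show "ennreal (t powr (- 1 - s)) *
      (indicator (ball 0 (1/2)) ((1 / t) *\<^sub>R (y - (1 - t) *\<^sub>R P)) * indicator {0<..1} t)
      \<le> ennreal ((2 * d / 3) powr (- 1 - s)) * indicator {2 * d / 3 .. 5 * d / 2} t"
    proof (cases "a \<in> ball 0 (1/2) \<and> t \<in> {0<..1}")
      case True
      then have a: "norm a < 1/2" and t: "0 < t" "t \<le> 1" by auto
      have "t *\<^sub>R a = y - (1 - t) *\<^sub>R P" using t by (simp add: a_def)
      then have "y - P = t *\<^sub>R (a - P)" by (simp add: algebra_simps)
      then have dt: "d = t * norm (a - P)" using t by (simp add: d_def)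
      have "norm (a - P) \<le> 3/2" using norm_triangle_ineq4[of a P] a P by linarith
      moreover have "2/5 \<le> norm (a - P)" using norm_triangle_ineq3[of a P] a P by linarith
      ultimately have "d \<le> t * (3/2)" "t * (2/5) \<le> d"
        unfolding dt using t by (auto intro!: mult_left_mono)
      then have tt: "2 * d / 3 \<le> t" "t \<le> 5 * d / 2" by auto
      then have "t powr (- 1 - s) \<le> (2 * d / 3) powr (- 1 - s)"
        using d s by (intro powr_mono2') auto
      then show ?thesis using True tt by (simp add: a_def ennreal_leI)
    qed (auto simp: a_def indicator_def)
  qed
  also have "\<dots> = ennreal ((2 * d / 3) powr (- 1 - s)) * ennreal (11 / 6 * d)"
    using d by (subst nn_integral_cmult_indicator) auto
  also have "\<dots> = ennreal ((2 * d / 3) powr (- 1 - s) * (11 / 6 * d))"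
    using d by (intro ennreal_mult''[symmetric]) simp
  also have "\<dots> \<le> ennreal (10 * d powr - s)"
  proof (rule ennreal_leI)
    have e: "(2 * d / 3) powr (- 1 - s) = (3/2) powr (1 + s) * d powr (- 1 - s)"
    proof -
      have "(2 * d / 3) powr (- 1 - s) = (2/3) powr (- 1 - s) * d powr (- 1 - s)"
        using d powr_mult[of "2/3" d "- 1 - s"] by simp
      also have "(2/3::real) powr (- 1 - s) = inverse ((2/3) powr (1 + s))"
        by (simp flip: powr_minus)
      also have "\<dots> = (3/2) powr (1 + s)"
        by (simp add: powr_divide)
      finally show ?thesis .
    qed
    have "(3/2::real) powr (1 + s) \<le> (3/2) powr 2" using s by (intro powr_mono) auto
    also have "\<dots> = 9/4" by (simp add: power2_eq_square)
    finally have b: "(3/2::real) powr (1 + s) \<le> 9/4" .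
    have dd: "d powr (- 1 - s) * d = d powr - s"
      using d powr_add[of d "- 1 - s" 1] by simp
    have "(2 * d / 3) powr (- 1 - s) * (11 / 6 * d) = (3/2) powr (1 + s) * (11/6) * d powr - s"
      unfolding e dd[symmetric] by simp
    also have "\<dots> \<le> 10 * d powr - s" using b by (intro mult_right_mono) auto
    finally show "(2 * d / 3) powr (- 1 - s) * (11 / 6 * d) \<le> 10 * d powr - s" .
  qed
  also have "\<dots> = 10 * riesz_kernel s (norm (y - P))"
    using d by (simp add: riesz_kernel_pos ennreal_mult flip: d_def)
  finally show ?thesis .
qed

text \<open>
  For fixed \<open>t\<close> the substitution \<open>y = P + t (a - P)\<close> has Jacobian \<open>t\<^sup>n\<close>; what remains of the weight is
  the integrand of the preceding lemma.
\<close>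

lemma nn_integral_cone_segments:
  fixes P :: "'a::euclidean_space" and w :: "'a \<Rightarrow> ennreal"
  assumes w[measurable]: "w \<in> borel_measurable borel"
    and P: "9/10 \<le> norm P" "norm P \<le> 1" and s: "0 < s" "s \<le> 1/2"
  shows "(\<integral>\<^sup>+a. (\<integral>\<^sup>+t. w (P + t *\<^sub>R (a - P)) * (ennreal (t powr (real DIM('a) - 1 - s)) * indicator {0<..1} t)
           \<partial>lborel) * indicator (ball 0 (1/2)) a \<partial>lborel)
    \<le> (\<integral>\<^sup>+y. w y * (10 * riesz_kernel s (norm (y - P))) \<partial>lborel)"
proof -
  let ?n = "DIM('a)"
  let ?A = "ball (0::'a) (1/2)"
  let ?e = "\<lambda>t. ennreal (t powr (real ?n - 1 - s)) * indicator {0<..1} t"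
  let ?W = "\<lambda>t y. indicator ?A ((1 / t) *\<^sub>R (y - (1 - t) *\<^sub>R P)) * indicator {0<..1} t :: ennreal"
  have mW[measurable]: "case_prod ?W \<in> borel_measurable (borel \<Otimes>\<^sub>M borel)"
  proof -
    have "case_prod ?W = (\<lambda>z. indicator {z. norm ((1 / fst z) *\<^sub>R (snd z - (1 - fst z) *\<^sub>R P)) < 1/2} z * indicator {0<..1} (fst z))"
      by (auto simp: fun_eq_iff indicator_def)
    then show ?thesis by simp
  qed
  have "(\<integral>\<^sup>+a. (\<integral>\<^sup>+t. w (P + t *\<^sub>R (a - P)) * ?e t \<partial>lborel) * indicator ?A a \<partial>lborel)
     = (\<integral>\<^sup>+a. (\<integral>\<^sup>+t. w (P + t *\<^sub>R (a - P)) * ?e t * indicator ?A a \<partial>lborel) \<partial>lborel)"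
    by (intro nn_integral_cong nn_integral_multc[symmetric]) measurable
  also have "\<dots> = (\<integral>\<^sup>+t. (\<integral>\<^sup>+a. w (P + t *\<^sub>R (a - P)) * ?e t * indicator ?A a \<partial>lborel) \<partial>lborel)"
    by (rule lborel_pair.Fubini'[symmetric]) measurable
  also have "\<dots> = (\<integral>\<^sup>+t. (\<integral>\<^sup>+y. w y * (ennreal (t powr (- 1 - s)) * ?W t y) \<partial>lborel) \<partial>lborel)"
  proof (rule nn_integral_cong)
    fix t :: real
    show "(\<integral>\<^sup>+a. w (P + t *\<^sub>R (a - P)) * ?e t * indicator ?A a \<partial>lborel) =
      (\<integral>\<^sup>+y. w y * (ennreal (t powr (- 1 - s)) * ?W t y) \<partial>lborel)"
    proof (cases "t \<in> {0<..1}")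
      case True
      then have t: "0 < t" by simp
      have m1[measurable]: "(\<lambda>y. indicator ?A ((1 / t) *\<^sub>R (y - (1 - t) *\<^sub>R P)) :: ennreal) \<in> borel_measurable borel"
        by measurable
      let ?h = "\<lambda>y. w y * (ennreal (t powr (- 1 - s)) * indicator ?A ((1 / t) *\<^sub>R (y - (1 - t) *\<^sub>R P)))"
      have "(\<integral>\<^sup>+y. ?h y \<partial>lborel) = ennreal (\<bar>t\<bar> ^ ?n) * (\<integral>\<^sup>+a. ?h ((1 - t) *\<^sub>R P + t *\<^sub>R a) \<partial>lborel)"
        using t by (intro nn_integral_lborel_affine) auto
      also have "\<dots> = (\<integral>\<^sup>+a. ennreal (\<bar>t\<bar> ^ ?n) * ?h ((1 - t) *\<^sub>R P + t *\<^sub>R a) \<partial>lborel)"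
        by (rule nn_integral_cmult[symmetric]) measurable
      also have "\<dots> = (\<integral>\<^sup>+a. w (P + t *\<^sub>R (a - P)) * ?e t * indicator ?A a \<partial>lborel)"
      proof (rule nn_integral_cong)
        fix a :: 'a
        have e1: "(1 - t) *\<^sub>R P + t *\<^sub>R a = P + t *\<^sub>R (a - P)" by (simp add: algebra_simps)
        have e2: "(1 / t) *\<^sub>R ((1 - t) *\<^sub>R P + t *\<^sub>R a - (1 - t) *\<^sub>R P) = a" using t by simp
        have "\<bar>t\<bar> ^ ?n * t powr (- 1 - s) = t powr (real ?n - 1 - s)"
          using t powr_add[of t "real ?n" "- 1 - s"] by (simp add: powr_realpow algebra_simps)
        then have "ennreal (\<bar>t\<bar> ^ ?n) * ennreal (t powr (- 1 - s)) = ennreal (t powr (real ?n - 1 - s))"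
          by (simp only: ennreal_mult''[symmetric] powr_ge_zero)
        then have c: "?e t = ennreal (\<bar>t\<bar> ^ ?n) * ennreal (t powr (- 1 - s))"
          using True by simp
        show "ennreal (\<bar>t\<bar> ^ ?n) * ?h ((1 - t) *\<^sub>R P + t *\<^sub>R a) =
            w (P + t *\<^sub>R (a - P)) * ?e t * indicator ?A a"
          unfolding e2 unfolding e1 c by (simp only: mult_ac)
      qed
      finally show ?thesis using True by simp
    qed simp
  qed
  also have "\<dots> = (\<integral>\<^sup>+y. (\<integral>\<^sup>+t. w y * (ennreal (t powr (- 1 - s)) * ?W t y) \<partial>lborel) \<partial>lborel)"
    by (rule lborel_pair.Fubini'[symmetric]) measurable
  also have "\<dots> = (\<integral>\<^sup>+y. w y * (\<integral>\<^sup>+t. ennreal (t powr (- 1 - s)) * ?W t y \<partial>lborel) \<partial>lborel)"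
    by (intro nn_integral_cong nn_integral_cmult) measurable
  also have "\<dots> \<le> (\<integral>\<^sup>+y. w y * (10 * riesz_kernel s (norm (y - P))) \<partial>lborel)"
    using nn_integral_segment_window_le[OF P s] by (intro nn_integral_mono mult_left_mono) auto
  finally show ?thesis .
qed

lemma nn_integral_radial_cone_segments:
  fixes w :: "'a::euclidean_space \<Rightarrow> ennreal"
  assumes w[measurable]: "w \<in> borel_measurable borel"
    and dim: "DIM('a) \<ge> 2" and r: "9/10 \<le> r" "r \<le> 1" and s: "0 < s" "s \<le> 1/2"
    and X: "X \<in> sets borel" "X \<subseteq> shell" and m: "emeasure lborel X = ennreal m" "0 < m"
  shows "(\<integral>\<^sup>+x. (\<integral>\<^sup>+a. (\<integral>\<^sup>+t. w (r *\<^sub>R sgn x + t *\<^sub>R (a - r *\<^sub>R sgn x)) *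
            (ennreal (t powr (real DIM('a) - 1 - s)) * indicator {0<..1} t)
           \<partial>lborel) * indicator (ball 0 (1/2)) a \<partial>lborel) * indicator X x \<partial>lborel)
    \<le> 10 * ennreal ((1 + slab_const TYPE('a)) * m powr (1 - 2 * s)) * (\<integral>\<^sup>+y. w y \<partial>lborel)"
proof -
  let ?I = "\<lambda>x. (\<integral>\<^sup>+a. (\<integral>\<^sup>+t. w (r *\<^sub>R sgn x + t *\<^sub>R (a - r *\<^sub>R sgn x)) *
            (ennreal (t powr (real DIM('a) - 1 - s)) * indicator {0<..1} t)
           \<partial>lborel) * indicator (ball 0 (1/2)) a \<partial>lborel)"
  let ?k = "\<lambda>x y. (10 * riesz_kernel s (norm (y - r *\<^sub>R sgn x)))"
  note [measurable] = X(1)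
  have "(\<integral>\<^sup>+x. ?I x * indicator X x \<partial>lborel)
    \<le> (\<integral>\<^sup>+x. (\<integral>\<^sup>+y. w y * ?k x y \<partial>lborel) * indicator X x \<partial>lborel)"
  proof (rule nn_integral_mono)
    fix x :: 'a
    show "?I x * indicator X x \<le>
        (\<integral>\<^sup>+y. w y * ?k x y \<partial>lborel) * indicator X x"
    proof (cases "x \<in> X")
      case True
      then have "x \<noteq> 0" using X(2) by (auto simp: shell_def)
      then have "norm (r *\<^sub>R sgn x) = r" using r by (simp add: norm_sgn)
      then show ?thesis
        using r by (intro mult_right_mono nn_integral_cone_segments[OF w _ _ s]) auto
    qed simp
  qed
  also have "\<dots> = (\<integral>\<^sup>+x. (\<integral>\<^sup>+y. w y * ?k x y * indicator X x \<partial>lborel) \<partial>lborel)"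
    by (intro nn_integral_cong nn_integral_multc[symmetric]) measurable
  also have "\<dots> = (\<integral>\<^sup>+y. (\<integral>\<^sup>+x. w y * ?k x y * indicator X x \<partial>lborel) \<partial>lborel)"
    by (rule lborel_pair.Fubini') measurable
  also have "\<dots> = (\<integral>\<^sup>+y. w y * (10 * (\<integral>\<^sup>+x. riesz_kernel s (norm (y - r *\<^sub>R sgn x)) * indicator X x \<partial>lborel)) \<partial>lborel)"
    by (simp add: mult.assoc nn_integral_cmult)
  also have "\<dots> \<le> (\<integral>\<^sup>+y. w y * (10 * ennreal ((1 + slab_const TYPE('a)) * m powr (1 - 2 * s))) \<partial>lborel)"
    by (intro nn_integral_mono mult_left_mono nn_integral_riesz_kernel_radial_le dim r s X m) auto
  also have "\<dots> = 10 * ennreal ((1 + slab_const TYPE('a)) * m powr (1 - 2 * s)) * (\<integral>\<^sup>+y. w y \<partial>lborel)"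
    by (simp add: nn_integral_multc mult_ac)
  finally show ?thesis .
qed

text \<open>
  Young's inequality without exponents or constants: the first term wins below \<open>b\<close>, the second above.
\<close>

lemma ennreal_le_truncation:
  fixes y :: ennreal
  assumes b: "b > 0" and n: "n \<ge> 1"
  shows "y \<le> ennreal b + ennreal (inverse (b ^ (n - 1))) * y ^ n"
proof (cases y)
  case top
  have "(top::ennreal) ^ n = top" using n by (induction n rule: dec_induct) simp_all
  then show ?thesis using b top by (simp add: ennreal_mult_top)
next
  case (real x)
  show ?thesis
  proof (cases "x \<le> b")
    case True
    then show ?thesis using real by (simp add: add_increasing2)
  next
    case False
    have "x ^ n = x * x ^ (n - 1)" using n by (metis Suc_diff_1 power_Suc less_eq_Suc_le One_nat_def)
    have "1 \<le> (x / b) ^ (n - 1)" using b False by (intro one_le_power) simp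
    then have "x * 1 \<le> x * (x / b) ^ (n - 1)" using real by (intro mult_left_mono) auto
    also have "\<dots> = inverse (b ^ (n - 1)) * x ^ n"
      using \<open>x ^ n = x * x ^ (n - 1)\<close> by (simp add: power_divide field_simps)
    finally have "ennreal x \<le> ennreal (inverse (b ^ (n - 1))) * ennreal (x ^ n)"
      using b real by (simp add: ennreal_mult[symmetric] del: ennreal_power)
    then have "y \<le> ennreal (inverse (b ^ (n - 1))) * y ^ n"
      using real by (simp add: ennreal_power)
    then show ?thesis by (simp add: add_increasing)
  qed
qed

text \<open>
  The truncation level is \<open>c\<close> times \<open>t\<close> to the power \<open>\<tau> - 1\<close>. This is barely integrable, with integral
  \<open>c / \<tau>\<close>, and makes the weight of \<open>g\<^sup>n\<close> equal to \<open>t\<close> to the power \<open>n - 1 - (n - 1) \<tau>\<close>, which after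
  the substitution leaves a kernel with the weak singularity \<open>(n - 1) \<tau>\<close>.
\<close>

lemma nn_integral_radial_segments_le:
  fixes g :: "'a::euclidean_space \<Rightarrow> ennreal"
  assumes g[measurable]: "g \<in> borel_measurable borel"
    and dim: "DIM('a) \<ge> 2" and r: "9/10 \<le> r" "r \<le> 1" and c: "c > 0"
    and \<tau>: "0 < \<tau>" "(real DIM('a) - 1) * \<tau> \<le> 1/2"
    and X: "X \<in> sets borel" "X \<subseteq> shell" and m: "emeasure lborel X = ennreal m" "0 < m"
  shows "(\<integral>\<^sup>+x. (\<integral>\<^sup>+a. (\<integral>\<^sup>+t. g (r *\<^sub>R sgn x + t *\<^sub>R (a - r *\<^sub>R sgn x) - z) * indicator {0..1} t \<partial>lborel)
            * indicator (ball 0 (1/2)) a \<partial>lborel) * indicator X x \<partial>lborel)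
    \<le> ennreal (c / \<tau> * measure lborel (ball (0::'a) (1/2)) * m) +
      ennreal (inverse (c ^ (DIM('a) - 1))) *
       (10 * ennreal ((1 + slab_const TYPE('a)) * m powr (1 - 2 * ((real DIM('a) - 1) * \<tau>))) * (\<integral>\<^sup>+y. g y ^ DIM('a) \<partial>lborel))"
proof -
  note [measurable] = X(1)
  let ?n = "DIM('a)"
  define s where "s = (real ?n - 1) * \<tau>"
  have s: "0 < s" "s \<le> 1/2" using dim \<tau> by (auto simp: s_def)
  let ?A = "ball (0::'a) (1/2)"
  define w where "w y = g (y - z) ^ ?n" for y
  have [measurable]: "w \<in> borel_measurable borel" unfolding w_def by measurable
  let ?\<gamma> = "\<lambda>x a t. r *\<^sub>R sgn x + t *\<^sub>R (a - r *\<^sub>R sgn (x::'a))"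
  let ?e = "\<lambda>t. ennreal (t powr (real ?n - 1 - s)) * indicator {0<..1} t"
  let ?p = "\<lambda>t. ennreal (t powr (\<tau> - 1)) * indicator {0..1} t"
  let ?ci = "ennreal (inverse (c ^ (?n - 1)))"
  have inner: "(\<integral>\<^sup>+t. g (?\<gamma> x a t - z) * indicator {0..1} t \<partial>lborel)
      \<le> ennreal (c / \<tau>) + ?ci * (\<integral>\<^sup>+t. w (?\<gamma> x a t) * ?e t \<partial>lborel)" for x a
  proof -
    have "AE t in lborel. g (?\<gamma> x a t - z) * indicator {0..1} t \<le>
       ennreal c * ?p t + ?ci * (w (?\<gamma> x a t) * ?e t)"
      using AE_lborel_singleton[of 0]
    proof eventually_elim
      case (elim t)
      show ?case
      proof (cases "t \<in> {0<..1}")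
        case True
        then have t: "0 < t" by simp
        let ?b = "c * t powr (\<tau> - 1)"
        have "(t powr (\<tau> - 1)) ^ (?n - 1) = t powr ((\<tau> - 1) * real (?n - 1))"
          using t by (simp add: powr_powr flip: powr_realpow)
        also have "(\<tau> - 1) * real (?n - 1) = - (real ?n - 1 - s)"
          using dim by (simp add: s_def of_nat_diff algebra_simps)
        finally have "inverse (?b ^ (?n - 1)) = inverse (c ^ (?n - 1)) * t powr (real ?n - 1 - s)"
          by (simp only: power_mult_distrib inverse_mult_distrib powr_minus inverse_inverse_eq)
        then have eb: "ennreal (inverse (?b ^ (?n - 1))) = ?ci * ennreal (t powr (real ?n - 1 - s))"
          by (simp add: ennreal_mult'')
        have "g (?\<gamma> x a t - z) \<le> ennreal ?b + ennreal (inverse (?b ^ (?n - 1))) * w (?\<gamma> x a t)"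
          unfolding w_def using c t by (intro ennreal_le_truncation) (auto simp: Suc_leI)
        also have "\<dots> = ennreal c * ?p t + ?ci * (w (?\<gamma> x a t) * ?e t)"
          unfolding eb using True by (simp add: ennreal_mult'' mult_ac)
        finally show ?thesis using True by simp
      qed (use elim in \<open>auto simp: indicator_def\<close>)
    qed
    then have "(\<integral>\<^sup>+t. g (?\<gamma> x a t - z) * indicator {0..1} t \<partial>lborel) \<le>
       (\<integral>\<^sup>+t. ennreal c * ?p t + ?ci * (w (?\<gamma> x a t) * ?e t) \<partial>lborel)"
      by (rule nn_integral_mono_AE)
    also have "\<dots> = ennreal c * (\<integral>\<^sup>+t. ?p t \<partial>lborel) + ?ci * (\<integral>\<^sup>+t. w (?\<gamma> x a t) * ?e t \<partial>lborel)"
      by (simp add: nn_integral_add nn_integral_cmult)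
    also have "(\<integral>\<^sup>+t. ?p t \<partial>lborel) = ennreal (1 / \<tau>)"
      using nn_integral_powr_unit[of "\<tau> - 1"] \<tau> by simp
    also have "ennreal c * ennreal (1 / \<tau>) = ennreal (c / \<tau>)"
      using c \<tau> by (simp add: ennreal_mult[symmetric])
    finally show ?thesis .
  qed
  have mA: "emeasure lborel ?A = ennreal (measure lborel ?A)"
    by (rule emeasure_lborel_ball_eq)
  have "(\<integral>\<^sup>+x. (\<integral>\<^sup>+a. (\<integral>\<^sup>+t. g (?\<gamma> x a t - z) * indicator {0..1} t \<partial>lborel) * indicator ?A a \<partial>lborel) * indicator X x \<partial>lborel)
    \<le> (\<integral>\<^sup>+x. (\<integral>\<^sup>+a. (ennreal (c / \<tau>) + ?ci * (\<integral>\<^sup>+t. w (?\<gamma> x a t) * ?e t \<partial>lborel)) * indicator ?A a \<partial>lborel) * indicator X x \<partial>lborel)"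
    by (intro nn_integral_mono mult_right_mono inner) auto
  also have "\<dots> = (\<integral>\<^sup>+x. (ennreal (c / \<tau>) * emeasure lborel ?A + ?ci *
      (\<integral>\<^sup>+a. (\<integral>\<^sup>+t. w (?\<gamma> x a t) * ?e t \<partial>lborel) * indicator ?A a \<partial>lborel)) * indicator X x \<partial>lborel)"
    by (intro nn_integral_cong) (simp add: distrib_right mult.assoc nn_integral_add nn_integral_cmult nn_integral_cmult_indicator)
  also have "\<dots> = ennreal (c / \<tau>) * emeasure lborel ?A * emeasure lborel X + ?ci *
      (\<integral>\<^sup>+x. (\<integral>\<^sup>+a. (\<integral>\<^sup>+t. w (?\<gamma> x a t) * ?e t \<partial>lborel) * indicator ?A a \<partial>lborel) * indicator X x \<partial>lborel)"
    by (simp only: distrib_right mult.assoc, subst nn_integral_add)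
       (simp_all add: nn_integral_cmult nn_integral_cmult_indicator mult.assoc)
  also have "\<dots> \<le> ennreal (c / \<tau>) * emeasure lborel ?A * emeasure lborel X + ?ci *
      (10 * ennreal ((1 + slab_const TYPE('a)) * m powr (1 - 2 * s)) * (\<integral>\<^sup>+y. w y \<partial>lborel))"
    by (intro add_left_mono mult_left_mono nn_integral_radial_cone_segments dim r s X m) auto
  also have "(\<integral>\<^sup>+y. w y \<partial>lborel) = (\<integral>\<^sup>+y. g y ^ ?n \<partial>lborel)"
    unfolding w_def using nn_integral_lborel_shift[of "\<lambda>y. g y ^ ?n" z] by simp
  also have "ennreal (c / \<tau>) * emeasure lborel ?A * emeasure lborel X = ennreal (c / \<tau> * measure lborel ?A * m)"
    unfolding mA m(1)
    by (simp only: ennreal_mult''[OF less_imp_le[OF m(2)]] ennreal_mult''[OF measure_nonneg])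
  finally show ?thesis unfolding s_def .
qed

section \<open>Exponential decay of level sets\<close>

text \<open>
  Follow the segment from \<open>P\<close> until it first meets the ball of radius \<open>\<rho>\<close>. There \<open>|f|\<close> is at most \<open>M\<close>,
  and up to that point the segment and its small translates avoid the ball of radius \<open>\<rho>'\<close>.
\<close>

lemma level_point_estimate:
  fixes f :: "'a::euclidean_space \<Rightarrow> 'b::real_normed_vector"
  assumes M: "\<And>x. norm x \<le> \<rho> \<Longrightarrow> norm (f x) \<le> M"
    and rad: "1/2 \<le> \<rho>" "\<rho> < r" "r < 1" and \<mu>: "0 < \<mu>"
    and small: "\<And>z. \<phi> z \<noteq> 0 \<Longrightarrow> norm z < \<rho> - \<rho>'"
    and seg: "\<And>p v t1 t2. t1 \<le> t2 \<Longrightarrow> p + t1 *\<^sub>R v \<in> cball 0 r \<Longrightarrow> p + t2 *\<^sub>R v \<in> cball 0 r \<Longrightarrow>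
           ennreal (norm (f (p + t2 *\<^sub>R v) - f (p + t1 *\<^sub>R v))) \<le>
           ennreal (\<mu> / 2) + ennreal (norm v) *
             (\<integral>\<^sup>+z. \<phi> z * (\<integral>\<^sup>+t\<in>{t1..t2}. g (p + t *\<^sub>R v - z) \<partial>lborel) \<partial>lborel)"
    and P: "norm P = r" "M + \<mu> < norm (f P)" and a: "norm a < 1/2"
  shows "ennreal (\<mu> / 4) \<le> (\<integral>\<^sup>+z. \<phi> z * (\<integral>\<^sup>+t. g (P + t *\<^sub>R (a - P) - z) *
      indicator {y. \<rho>' < norm y} (P + t *\<^sub>R (a - P) - z) * indicator {0..1} t \<partial>lborel) \<partial>lborel)" (is "_ \<le> ?I")
proof -
  let ?\<gamma> = "\<lambda>t. P + t *\<^sub>R (a - P)"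
  let ?K = "{t \<in> {0..1}. norm (?\<gamma> t) = \<rho>}"
  have cont: "continuous_on S (\<lambda>t. norm (?\<gamma> t))" for S by (intro continuous_intros)
  have ivt: "\<exists>u. 0 \<le> u \<and> u \<le> t \<and> norm (?\<gamma> u) = \<rho>" if "0 \<le> t" "norm (?\<gamma> t) \<le> \<rho>" for t
    using IVT2'[of "\<lambda>t. norm (?\<gamma> t)" t \<rho> 0] that cont rad P by auto
  have "?K \<noteq> {}" using ivt[of 1] a rad by auto
  moreover have "compact ?K"
  proof -
    have "?K = {0..1} \<inter> {t. norm (?\<gamma> t) = \<rho>}" by auto
    moreover have "closed {t. norm (?\<gamma> t) = \<rho>}" by (intro closed_Collect_eq continuous_intros)
    ultimately show ?thesis by (simp add: compact_Int_closed)
  qed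
  ultimately obtain \<tau> where \<tau>: "\<tau> \<in> ?K" "\<And>t. t \<in> ?K \<Longrightarrow> \<tau> \<le> t"
    using compact_attains_inf[of ?K] by blast
  have before: "\<rho> \<le> norm (?\<gamma> t)" if t: "t \<in> {0..\<tau>}" for t
  proof (rule ccontr)
    assume "\<not> \<rho> \<le> norm (?\<gamma> t)"
    then obtain u where u: "0 \<le> u" "u \<le> t" "norm (?\<gamma> u) = \<rho>" using ivt[of t] t by auto
    then have "u \<in> ?K" using t \<tau>(1) by auto
    then have "t = \<tau>" using \<tau>(2)[of u] u t by auto
    then show False using \<tau>(1) \<open>\<not> \<rho> \<le> norm (?\<gamma> t)\<close> by auto
  qed
  have v: "norm (a - P) \<le> 2" using norm_triangle_ineq4[of a P] a P rad by linarith
  have "\<mu> \<le> norm (f P) - norm (f (?\<gamma> \<tau>))" using P(2) M[of "?\<gamma> \<tau>"] \<tau>(1) by auto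
  also have "\<dots> \<le> norm (f (?\<gamma> \<tau>) - f (?\<gamma> 0))"
    using norm_triangle_ineq2[of "f P" "f (?\<gamma> \<tau>)"] by (simp add: norm_minus_commute)
  finally have "ennreal (\<mu> / 2) + ennreal (\<mu> / 2) \<le> ennreal (norm (f (?\<gamma> \<tau>) - f (?\<gamma> 0)))"
    using \<mu> by (simp flip: ennreal_plus add: ennreal_leI)
  also have "\<dots> \<le> ennreal (\<mu> / 2) + ennreal (norm (a - P)) *
             (\<integral>\<^sup>+z. \<phi> z * (\<integral>\<^sup>+t\<in>{0..\<tau>}. g (?\<gamma> t - z) \<partial>lborel) \<partial>lborel)"
    using \<tau>(1) P(1) rad by (intro seg) auto
  finally have "ennreal (\<mu> / 2) \<le> ennreal (norm (a - P)) *
             (\<integral>\<^sup>+z. \<phi> z * (\<integral>\<^sup>+t\<in>{0..\<tau>}. g (?\<gamma> t - z) \<partial>lborel) \<partial>lborel)"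
    by (simp add: ennreal_add_left_cancel_le)
  also have "\<dots> \<le> ennreal 2 * ?I"
  proof (rule mult_mono)
    show "ennreal (norm (a - P)) \<le> ennreal 2" using v by (rule ennreal_leI)
    show "(\<integral>\<^sup>+z. \<phi> z * (\<integral>\<^sup>+t\<in>{0..\<tau>}. g (?\<gamma> t - z) \<partial>lborel) \<partial>lborel) \<le> ?I"
    proof (rule nn_integral_mono)
      fix z
      show "\<phi> z * (\<integral>\<^sup>+t\<in>{0..\<tau>}. g (?\<gamma> t - z) \<partial>lborel) \<le> \<phi> z * (\<integral>\<^sup>+t. g (?\<gamma> t - z) *
        indicator {y. \<rho>' < norm y} (?\<gamma> t - z) * indicator {0..1} t \<partial>lborel)"
      proof (cases "\<phi> z = 0")
        case False
        have "g (?\<gamma> t - z) * indicator {0..\<tau>} t \<le> g (?\<gamma> t - z) * indicator {y. \<rho>' < norm y} (?\<gamma> t - z) * indicator {0..1} t" for t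
        proof (cases "t \<in> {0..\<tau>}")
          case True
          have "\<rho>' < norm (?\<gamma> t) - norm z" using before[OF True] small[OF False] by linarith
          also have "\<dots> \<le> norm (?\<gamma> t - z)" by (rule norm_triangle_ineq2)
          finally show ?thesis using True \<tau>(1) by simp
        qed simp
        then show ?thesis by (intro mult_left_mono nn_integral_mono) auto
      qed simp
    qed
  qed auto
  finally have "ennreal (1/2) * ennreal (\<mu> / 2) \<le> ennreal (1/2) * (ennreal 2 * ?I)"
    by (rule mult_left_mono) simp
  moreover have "ennreal (1/2) * ennreal (\<mu> / 2) = ennreal (\<mu> / 4)"
    by (subst ennreal_mult'[symmetric]) auto
  moreover have "ennreal (1/2) * ennreal 2 = 1"
    by (subst ennreal_mult'[symmetric]) auto
  ultimately show ?thesis by (simp only: mult.assoc[symmetric] mult_1_left)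
qed

text \<open>
  The truncation constant \<open>\<mu> \<tau> / 8\<close> is chosen so that the first of the two terms is half of the
  left-hand side and can be absorbed.
\<close>

lemma level_set_measure_le:
  fixes f :: "'a::euclidean_space \<Rightarrow> 'b::real_normed_vector"
  assumes f: "continuous_on (ball 0 1) f" and g: "mollified_upper_gradient f g"
    and dim: "DIM('a) \<ge> 2"
    and M: "\<And>x. norm x \<le> \<rho> \<Longrightarrow> norm (f x) \<le> M"
    and rad: "9/10 \<le> \<rho>" "\<rho>' < \<rho>" "\<rho> < r" "r < 1" and \<mu>: "0 < \<mu>"
    and \<epsilon>: "(\<integral>\<^sup>+y. g y ^ DIM('a) * indicator {y. \<rho>' < norm y} y \<partial>lborel) \<le> ennreal \<epsilon>" "0 \<le> \<epsilon>"
    and \<tau>: "0 < \<tau>" "(real DIM('a) - 1) * \<tau> \<le> 1/2"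
    and X: "X = {x \<in> shell. M + \<mu> < norm (f (r *\<^sub>R sgn x))}" and m: "emeasure lborel X = ennreal m" "0 < m"
  shows "\<mu> / 8 * measure lborel (ball (0::'a) (1/2)) * m \<le>
    inverse ((\<mu> * \<tau> / 8) ^ (DIM('a) - 1)) *
      (10 * (1 + slab_const TYPE('a)) * m powr (1 - 2 * ((real DIM('a) - 1) * \<tau>)) * \<epsilon>)"
proof -
  let ?n = "DIM('a)"
  let ?A = "ball (0::'a) (1/2)"
  let ?V = "measure lborel ?A"
  let ?B = "(1 + slab_const TYPE('a)) * m powr (1 - 2 * ((real ?n - 1) * \<tau>))"
  have [measurable]: "g \<in> borel_measurable borel" using g by (simp add: mollified_upper_gradient_def)
  define g1 where "g1 y = g y * indicator {y. \<rho>' < norm y} y" for y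
  have [measurable]: "g1 \<in> borel_measurable borel" unfolding g1_def by measurable
  have Xb[measurable]: "X \<in> sets borel"
    unfolding X using rad by (intro borel_open open_radial_level_set f) auto
  have Xs: "X \<subseteq> shell" unfolding X by auto
  have mA: "emeasure lborel ?A = ennreal ?V"
    by (rule emeasure_lborel_ball_eq)
  have pos: "r < 1" "0 < \<mu> / 2" "0 < \<rho> - \<rho>'" using rad \<mu> by auto
  obtain \<phi> where [measurable]: "\<phi> \<in> borel_measurable borel" and one: "(\<integral>\<^sup>+z. \<phi> z \<partial>lborel) = 1"
    and small: "\<And>z. \<phi> z \<noteq> 0 \<Longrightarrow> norm z < \<rho> - \<rho>'"
    and seg: "\<And>p v t1 t2. t1 \<le> t2 \<Longrightarrow> p + t1 *\<^sub>R v \<in> cball 0 r \<Longrightarrow> p + t2 *\<^sub>R v \<in> cball 0 r \<Longrightarrow>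
           ennreal (norm (f (p + t2 *\<^sub>R v) - f (p + t1 *\<^sub>R v))) \<le>
           ennreal (\<mu> / 2) + ennreal (norm v) *
             (\<integral>\<^sup>+z. \<phi> z * (\<integral>\<^sup>+t\<in>{t1..t2}. g (p + t *\<^sub>R v - z) \<partial>lborel) \<partial>lborel)"
    by (rule mollified_upper_gradientE[OF g pos]) (rule that)
  let ?J = "\<lambda>x a z. (\<integral>\<^sup>+t. g1 (r *\<^sub>R sgn x + t *\<^sub>R (a - r *\<^sub>R sgn (x::'a)) - z) * indicator {0..1} t \<partial>lborel)"
  let ?F = "\<lambda>x z. (\<integral>\<^sup>+a. ?J x a z * indicator ?A a \<partial>lborel) * indicator X x"
  have "ennreal (\<mu> / 4 * ?V * m) = ennreal (\<mu> / 4) * emeasure lborel ?A * emeasure lborel X"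
    unfolding mA m(1) using m(2)
    by (simp only: ennreal_mult''[OF less_imp_le[OF m(2)]] ennreal_mult''[OF measure_nonneg])
  also have "\<dots> = (\<integral>\<^sup>+x. (\<integral>\<^sup>+a. ennreal (\<mu> / 4) * indicator ?A a \<partial>lborel) * indicator X x \<partial>lborel)"
    by (simp add: nn_integral_cmult_indicator)
  also have "\<dots> \<le> (\<integral>\<^sup>+x. (\<integral>\<^sup>+z. \<phi> z * ?F x z \<partial>lborel) \<partial>lborel)"
  proof (rule nn_integral_mono)
    fix x :: 'a
    show "(\<integral>\<^sup>+a. ennreal (\<mu> / 4) * indicator ?A a \<partial>lborel) * indicator X x \<le> (\<integral>\<^sup>+z. \<phi> z * ?F x z \<partial>lborel)"
    proof (cases "x \<in> X")
      case True
      then have x: "x \<noteq> 0" "M + \<mu> < norm (f (r *\<^sub>R sgn x))" unfolding X by (auto simp: shell_def)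
      have nP: "norm (r *\<^sub>R sgn x) = r" using x rad by (simp add: norm_sgn)
      have rho: "1/2 \<le> \<rho>" using rad by simp
      have "(\<integral>\<^sup>+a. ennreal (\<mu> / 4) * indicator ?A a \<partial>lborel) \<le> (\<integral>\<^sup>+a. (\<integral>\<^sup>+z. \<phi> z * ?J x a z \<partial>lborel) * indicator ?A a \<partial>lborel)"
      proof (rule nn_integral_mono)
        fix a :: 'a
        show "ennreal (\<mu> / 4) * indicator ?A a \<le> (\<integral>\<^sup>+z. \<phi> z * ?J x a z \<partial>lborel) * indicator ?A a"
        proof (cases "a \<in> ?A")
          case in_A: True
          then have "norm a < 1/2" by simp
          from level_point_estimate[OF M rho rad(3,4) \<mu> small seg nP x(2) this]
          show ?thesis using in_A by (simp add: g1_def)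
        qed simp
      qed
      also have "\<dots> = (\<integral>\<^sup>+a. (\<integral>\<^sup>+z. \<phi> z * ?J x a z * indicator ?A a \<partial>lborel) \<partial>lborel)"
        by (intro nn_integral_cong nn_integral_multc[symmetric]) measurable
      also have "\<dots> = (\<integral>\<^sup>+z. (\<integral>\<^sup>+a. \<phi> z * ?J x a z * indicator ?A a \<partial>lborel) \<partial>lborel)"
        by (rule lborel_pair.Fubini'[symmetric]) measurable
      also have "\<dots> = (\<integral>\<^sup>+z. \<phi> z * (\<integral>\<^sup>+a. ?J x a z * indicator ?A a \<partial>lborel) \<partial>lborel)"
        by (simp add: mult.assoc nn_integral_cmult)
      finally show ?thesis using True by simp
    qed simp
  qed
  also have "\<dots> \<le> ennreal (\<mu> * \<tau> / 8 / \<tau> * ?V * m) + ennreal (inverse ((\<mu> * \<tau> / 8) ^ (?n - 1))) *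
      (10 * ennreal ?B * ennreal \<epsilon>)"
  proof (rule nn_integral_average_le[OF _ _ one])
    fix z
    have pw: "(\<integral>\<^sup>+y. g1 y ^ ?n \<partial>lborel) \<le> ennreal \<epsilon>"
    proof -
      have "g1 y ^ ?n = g y ^ ?n * indicator {y. \<rho>' < norm y} y" for y
        by (simp add: g1_def indicator_def)
      then show ?thesis using \<epsilon>(1) by simp
    qed
    have "(\<integral>\<^sup>+x. ?F x z \<partial>lborel) \<le> ennreal (\<mu> * \<tau> / 8 / \<tau> * ?V * m) + ennreal (inverse ((\<mu> * \<tau> / 8) ^ (?n - 1))) *
       (10 * ennreal ?B * (\<integral>\<^sup>+y. g1 y ^ ?n \<partial>lborel))"
      using rad \<mu> \<tau> by (intro nn_integral_radial_segments_le dim Xb Xs m \<tau>) auto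
    also have "\<dots> \<le> ennreal (\<mu> * \<tau> / 8 / \<tau> * ?V * m) + ennreal (inverse ((\<mu> * \<tau> / 8) ^ (?n - 1))) *
       (10 * ennreal ?B * ennreal \<epsilon>)"
      by (intro add_left_mono mult_left_mono pw) auto
    finally show "(\<integral>\<^sup>+x. ?F x z \<partial>lborel) \<le> \<dots>" .
  qed measurable
  also have "\<mu> * \<tau> / 8 / \<tau> = \<mu> / 8" using \<tau> by simp
  also have "ennreal (inverse ((\<mu> * \<tau> / 8) ^ (?n - 1))) * (10 * ennreal ?B * ennreal \<epsilon>) =
     ennreal (inverse ((\<mu> * \<tau> / 8) ^ (?n - 1)) * (10 * ?B * \<epsilon>))"
  proof -
    have B0: "0 \<le> ?B" by (intro mult_nonneg_nonneg) (auto simp: add_nonneg_nonneg slab_const_nonneg)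
    have "10 * ennreal ?B * ennreal \<epsilon> = ennreal (10 * ?B * \<epsilon>)"
      using B0 \<epsilon>(2) by (simp only: ennreal_mult''[OF \<epsilon>(2)] ennreal_mult''[OF B0]) simp
    then show ?thesis using B0 \<epsilon>(2) by (simp only: ennreal_mult''[of "10 * ?B * \<epsilon>"] mult_nonneg_nonneg zero_le_numeral)
  qed
  also have "ennreal (\<mu> / 8 * ?V * m) + \<dots> = ennreal (\<mu> / 8 * ?V * m + inverse ((\<mu> * \<tau> / 8) ^ (?n - 1)) * (10 * ?B * \<epsilon>))"
    using \<mu> m(2) \<epsilon>(2) \<tau>(1)
    by (intro ennreal_plus[symmetric] mult_nonneg_nonneg) (auto simp: add_nonneg_nonneg slab_const_nonneg)
  finally have "\<mu> / 4 * ?V * m \<le> \<mu> / 8 * ?V * m + inverse ((\<mu> * \<tau> / 8) ^ (?n - 1)) * (10 * ?B * \<epsilon>)"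
    using \<mu> m(2) \<epsilon>(2) \<tau>(1)
    by (subst (asm) ennreal_le_iff) (auto intro!: add_nonneg_nonneg mult_nonneg_nonneg simp: slab_const_nonneg)
  moreover have "\<mu> / 4 * ?V * m = \<mu> / 8 * ?V * m + \<mu> / 8 * ?V * m" by simp
  ultimately have "\<mu> / 8 * ?V * m \<le> inverse ((\<mu> * \<tau> / 8) ^ (?n - 1)) * (10 * ?B * \<epsilon>)"
    by linarith
  then show ?thesis by (simp only: mult.assoc)
qed

lemma exponential_bound_from_power:
  fixes m :: real
  assumes "0 < m" "0 < b" "m powr (1 / b) \<le> exp (- 1)"
  shows "m \<le> exp (- b)"
proof -
  have "ln (m powr (1 / b)) \<le> ln (exp (- 1))"
    using assms by (subst ln_le_cancel_iff) auto
  then have "ln m / b \<le> - 1" using assms by (simp add: ln_powr)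
  then have "ln m \<le> - b" using assms by (simp add: field_simps)
  then have "exp (ln m) \<le> exp (- b)" by simp
  then show ?thesis using assms by simp
qed

text \<open>
  Choose \<open>\<tau>\<close> with \<open>2 (n - 1) \<tau> = 1 / b\<close> for \<open>b = \<beta> \<mu>\<^sup>q\<close>. Since \<open>(q - 1) (n - 1) = 1\<close>, all powers of
  \<open>\<mu>\<close> cancel in the preceding estimate, and it reads \<open>m\<close> to the power \<open>1 / b\<close> is at most \<open>C \<epsilon>\<close> with \<open>C\<close>
  depending on \<open>\<beta>\<close> and \<open>n\<close> only. An energy \<open>\<epsilon>\<close> that makes the right-hand side \<open>1 / e\<close> gives
  \<open>m \<le> exp (- b)\<close>.
\<close>

lemma level_set_decay:
  fixes f :: "'a::euclidean_space \<Rightarrow> 'b::real_normed_vector"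
  defines "q \<equiv> real DIM('a) / (real DIM('a) - 1)"
  assumes f: "continuous_on (ball 0 1) f" and g: "mollified_upper_gradient f g"
    and dim: "DIM('a) \<ge> 2"
    and fin: "(\<integral>\<^sup>+y. g y ^ DIM('a) \<partial>lborel) < \<infinity>" and supp: "AE y in lborel. g y \<noteq> 0 \<longrightarrow> norm y < 1"
    and \<beta>: "\<beta> > 0"
  obtains M \<rho> \<Lambda> where
    "\<And>\<mu> r. \<Lambda> \<le> \<mu> \<Longrightarrow> \<rho> < r \<Longrightarrow> r < 1 \<Longrightarrow>
      emeasure lborel {x \<in> shell. M + \<mu> < norm (f (r *\<^sub>R sgn x))} \<le> ennreal (exp (- (\<beta> * \<mu> powr q)))"
    "0 \<le> M" "0 \<le> \<rho>" "\<rho> < 1" "0 < \<Lambda>"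
proof -
  let ?n = "DIM('a)"
  let ?V = "measure lborel (ball (0::'a) (1/2))"
  define B where "B = 10 * (1 + slab_const TYPE('a))"
  define k where "k = real ?n - 1"
  have k: "k \<ge> 1" using dim by (simp add: k_def)
  have qk: "q = (k + 1) / k" by (simp add: q_def k_def)
  have q: "(q - 1) * k = 1" "1 \<le> q" using k by (auto simp: qk field_simps)
  have B: "B > 0" using slab_const_nonneg[where 'a = 'a] by (simp add: B_def)
  have V: "?V > 0"
    by (simp add: content_ball unit_ball_vol_pos)
  define C where "C = 8 * (16 * k * \<beta>) ^ (?n - 1) * B / ?V"
  have C: "C > 0" using k \<beta> B V by (simp add: C_def)
  \<comment> \<open>The energy for which the final inequality has right-hand side \<open>1 / e\<close>.\<close>
  define \<epsilon> where "\<epsilon> = exp (- 1) / C"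
  have \<epsilon>: "\<epsilon> > 0" using C by (simp add: \<epsilon>_def)
  have [measurable]: "g \<in> borel_measurable borel" using g by (simp add: mollified_upper_gradient_def)
  have "AE y in lborel. g y ^ ?n \<noteq> 0 \<longrightarrow> norm y < 1"
    using supp by eventually_elim auto
  then obtain \<rho>' where \<rho>': "9/10 < \<rho>'" "\<rho>' < 1"
     "(\<integral>\<^sup>+y. g y ^ ?n * indicator {y. \<rho>' < norm y} y \<partial>lborel) < ennreal \<epsilon>"
    using tail_integral_small[of "\<lambda>y. g y ^ ?n" "ennreal \<epsilon>" "9/10"] fin \<epsilon> by auto
  define \<rho> where "\<rho> = (\<rho>' + 1) / 2"
  have \<rho>: "9/10 \<le> \<rho>" "\<rho>' < \<rho>" "\<rho> < 1" using \<rho>' by (auto simp: \<rho>_def)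
  have "compact (f ` cball 0 \<rho>)"
    using \<rho> by (intro compact_continuous_image continuous_on_subset[OF f]) auto
  then obtain M where "0 < M" and M: "\<And>x. x \<in> cball 0 \<rho> \<Longrightarrow> norm (f x) \<le> M"
    by (force simp: bounded_pos dest!: compact_imp_bounded)
  \<comment> \<open>Ensures \<open>b \<ge> 1\<close>, that is \<open>(n - 1) \<tau> \<le> 1/2\<close>.\<close>
  define \<Lambda> where "\<Lambda> = max 1 (1 / \<beta>)"
  show thesis
  proof (rule that[of \<Lambda> \<rho> M])
    show "0 \<le> M" "0 \<le> \<rho>" "\<rho> < 1" "0 < \<Lambda>" using \<open>0 < M\<close> \<rho> by (auto simp: \<Lambda>_def)
    fix \<mu> r assume \<mu>: "\<Lambda> \<le> \<mu>" and r: "\<rho> < r" "r < 1"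
    have \<mu>1: "1 \<le> \<mu>" "1 / \<beta> \<le> \<mu>" using \<mu> by (auto simp: \<Lambda>_def)
    define X where "X = {x \<in> shell. M + \<mu> < norm (f (r *\<^sub>R sgn x))}"
    have "emeasure lborel X \<le> emeasure lborel (ball (0::'a) 1)"
      by (intro emeasure_mono) (auto simp: X_def shell_def)
    also have "\<dots> < \<infinity>" by (rule emeasure_lborel_ball_finite)
    finally obtain m where m: "emeasure lborel X = ennreal m" "0 \<le> m"
      by (cases "emeasure lborel X") auto
    show "emeasure lborel {x \<in> shell. M + \<mu> < norm (f (r *\<^sub>R sgn x))} \<le> ennreal (exp (- (\<beta> * \<mu> powr q)))"
    proof (cases "m = 0")
      case True
      then show ?thesis using m by (simp add: X_def)
    next
      case False
      then have m0: "0 < m" using m by simp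
      define b where "b = \<beta> * \<mu> powr q"
      have "1 \<le> \<beta> * \<mu>" using \<mu>1(2) \<beta> by (simp add: field_simps)
      also have "\<dots> \<le> b" unfolding b_def using \<mu>1(1) q(2) \<beta> powr_mono[of 1 q \<mu>] by (intro mult_left_mono) auto
      finally have b: "1 \<le> b" .
      define \<tau> where "\<tau> = 1 / (2 * k * b)"
      have \<tau>: "0 < \<tau>" "k * \<tau> = 1 / (2 * b)" using k b by (auto simp: \<tau>_def)
      have t2: "k * \<tau> \<le> 1/2" unfolding \<tau>(2) using b by (simp add: field_simps)
      have est: "\<mu> / 8 * ?V * m \<le> inverse ((\<mu> * \<tau> / 8) ^ (?n - 1)) * (B * m powr (1 - 2 * (k * \<tau>)) * \<epsilon>)"
        unfolding B_def k_def
        using M r \<rho> \<mu>1 \<rho>'(3) \<epsilon> \<tau> t2 m m0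
        by (intro level_set_measure_le[OF f g dim _ \<rho>(1,2) r _ _ _ _ _ X_def]) (auto simp: k_def)
      have "2 * (k * \<tau>) = 1 / b" by (simp add: \<tau>(2))
      then have est2: "\<mu> / 8 * ?V * m \<le> inverse ((\<mu> * \<tau> / 8) ^ (?n - 1)) * (B * m powr (1 - 1 / b) * \<epsilon>)"
        using est by simp
      have inv: "inverse ((\<mu> * \<tau> / 8) ^ (?n - 1)) = (16 * k * \<beta>) ^ (?n - 1) * \<mu>"
      proof -
        have l: "\<mu> powr q = \<mu> powr (q - 1) * \<mu>" using \<mu>1 powr_add[of \<mu> "q - 1" 1] by simp
        have "inverse (\<mu> * \<tau> / 8) = 16 * k * \<beta> * \<mu> powr (q - 1)"
          unfolding \<tau>_def b_def l using \<mu>1 k \<beta> by (simp add: field_simps)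
        then have "inverse ((\<mu> * \<tau> / 8) ^ (?n - 1)) = (16 * k * \<beta>) ^ (?n - 1) * (\<mu> powr (q - 1)) ^ (?n - 1)"
          by (simp only: power_inverse[symmetric] power_mult_distrib)
        also have "(\<mu> powr (q - 1)) ^ (?n - 1) = \<mu> powr ((q - 1) * k)"
          using \<mu>1 dim by (simp add: k_def of_nat_diff powr_powr flip: powr_realpow)
        also have "\<dots> = \<mu>" using \<mu>1 q by simp
        finally show ?thesis .
      qed
      have mm: "m powr (1 - 1 / b) * m powr (1 / b) = m"
        using m0 powr_add[of m "1 - 1 / b" "1 / b"] by simp
      have "\<mu> / 8 * ?V * m powr (1 / b) * m powr (1 - 1 / b) = \<mu> / 8 * ?V * (m powr (1 - 1 / b) * m powr (1 / b))"
        by (simp only: mult_ac)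
      then have "\<mu> / 8 * ?V * m powr (1 / b) * m powr (1 - 1 / b) = \<mu> / 8 * ?V * m"
        by (simp only: mm)
      moreover have "inverse ((\<mu> * \<tau> / 8) ^ (?n - 1)) * (B * m powr (1 - 1 / b) * \<epsilon>) =
          ((16 * k * \<beta>) ^ (?n - 1) * \<mu> * B * \<epsilon>) * m powr (1 - 1 / b)"
        unfolding inv by (simp only: mult_ac)
      ultimately have "\<mu> / 8 * ?V * m powr (1 / b) * m powr (1 - 1 / b) \<le>
          ((16 * k * \<beta>) ^ (?n - 1) * \<mu> * B * \<epsilon>) * m powr (1 - 1 / b)"
        using est2 by linarith
      then have *: "\<mu> / 8 * ?V * m powr (1 / b) \<le> (16 * k * \<beta>) ^ (?n - 1) * \<mu> * B * \<epsilon>"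
        by (rule mult_right_le_imp_le) (use m0 in simp)
      have "\<mu> * (m powr (1 / b)) \<le> \<mu> * (C * \<epsilon>)"
      proof -
        have e1: "\<mu> * (m powr (1 / b)) = 8 / ?V * (\<mu> / 8 * ?V * m powr (1 / b))"
          using V by (simp del: content_ball)
        have e2: "8 / ?V * ((16 * k * \<beta>) ^ (?n - 1) * \<mu> * B * \<epsilon>) = \<mu> * (C * \<epsilon>)"
          by (simp add: C_def)
        show ?thesis
          unfolding e1 e2[symmetric] using * by (intro mult_left_mono) auto
      qed
      moreover have "0 < \<mu>" using \<mu>1 by linarith
      ultimately have "m powr (1 / b) \<le> C * \<epsilon>" by (rule mult_left_le_imp_le)
      also have "C * \<epsilon> = exp (- 1)"
      proof -
        have "C \<noteq> 0" using C by linarith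
        then show ?thesis unfolding \<epsilon>_def by simp
      qed
      finally have "m powr (1 / b) \<le> exp (- 1)" .
      then have "m \<le> exp (- b)"
        by (rule exponential_bound_from_power[OF m0, rotated]) (use b in linarith)
      then show ?thesis using m(1) by (simp add: X_def b_def ennreal_leI)
    qed
  qed
qed

section \<open>Exponential integrability of radial limits\<close>

lemma ray_in_shell:
  "norm \<zeta> = 1 \<Longrightarrow> t \<in> {5/8..7/8} \<Longrightarrow> t *\<^sub>R \<zeta> \<in> shell \<and> sgn (t *\<^sub>R \<zeta>) = \<zeta>"
  by (auto simp: shell_def sgn_div_norm)

lemma radial_limit_eq: "has_radial_limit f l \<zeta> \<Longrightarrow> radial_limit f \<zeta> = l"
  unfolding has_radial_limit_def radial_limit_def by (rule tendsto_Lim) auto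

lemma hausdorff_radial_limit_exceptional_null:
  fixes f :: "'a::euclidean_space \<Rightarrow> 'b::banach"
  assumes f: "continuous_on (ball 0 1) f" and g: "mollified_upper_gradient f g"
    and fin: "(\<integral>\<^sup>+y. g y \<partial>lborel) < \<infinity>" and supp: "AE y in lborel. g y \<noteq> 0 \<longrightarrow> norm y < 1"
  shows "{\<zeta> \<in> sphere 0 1. \<not> (\<exists>l. has_radial_limit f l \<zeta>)} \<in> null_sets (hausdorff_measure (DIM('a) - 1))"
proof (rule null_sets_hausdorff_measure)
  let ?Z = "{\<zeta> \<in> sphere 0 1. \<not> (\<exists>l. has_radial_limit f l \<zeta>)}"
  obtain N where N: "{x \<in> space lborel. \<not> (x \<in> shell \<longrightarrow> (\<exists>l. has_radial_limit f l (sgn x)))} \<subseteq> N"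
      "N \<in> null_sets lborel"
    using AE_radial_limit[OF assms] unfolding eventually_ae_filter by auto
  have N': "N \<in> null_sets lebesgue" using N(2) by (rule null_sets_completionI)
  have "hausdorff_outer_measure (DIM('a) - 1) ?Z \<le> ennreal (cone_const TYPE('a)) * emeasure lebesgue N"
  proof (rule hausdorff_outer_measure_le_cone)
    show "N \<in> sets lebesgue" using N' by auto
    fix \<zeta> :: 'a and t :: real assume "\<zeta> \<in> ?Z" "t \<in> {5/8..7/8}"
    then show "t *\<^sub>R \<zeta> \<in> N" using ray_in_shell[of \<zeta> t] N(1) by auto
  qed auto
  then show "hausdorff_outer_measure (DIM('a) - 1) ?Z = 0" using N' by auto
qed

text \<open>
  If the radial limit at \<open>\<zeta>\<close> exceeds a level in norm, so does \<open>f\<close> at all points of the radius close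
  to the sphere; the corresponding sets of directions at a sequence of radii therefore contain \<open>\<zeta>\<close>
  eventually, and their lower limit inherits the uniform bound. The directions without radial
  limit, where \<^const>\<open>radial_limit\<close> is arbitrary, are covered by a null set. Losing a factor
  two in the level absorbs the bound \<open>M\<close>.
\<close>

lemma hausdorff_radial_limit_level_decay:
  fixes f :: "'a::euclidean_space \<Rightarrow> 'b::banach"
  defines "q \<equiv> real DIM('a) / (real DIM('a) - 1)"
  assumes f: "continuous_on (ball 0 1) f" and g: "mollified_upper_gradient f g"
    and dim: "DIM('a) \<ge> 2" and fin1: "(\<integral>\<^sup>+y. g y \<partial>lborel) < \<infinity>"
    and fin: "(\<integral>\<^sup>+y. g y ^ DIM('a) \<partial>lborel) < \<infinity>" and supp: "AE y in lborel. g y \<noteq> 0 \<longrightarrow> norm y < 1"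
    and \<beta>: "\<beta> > 0"
  obtains C t0 where
    "\<And>t. t0 \<le> t \<Longrightarrow> hausdorff_outer_measure (DIM('a) - 1) {\<zeta> \<in> sphere 0 1. t < norm (radial_limit f \<zeta>)}
        \<le> ennreal (C * exp (- (\<beta> * t powr q)))"
    "hausdorff_outer_measure (DIM('a) - 1) (sphere (0::'a) 1) \<le> ennreal C" "0 \<le> C" "0 < t0"
proof -
  \<comment> \<open>The factor compensates for halving the level below.\<close>
  define \<beta>' where "\<beta>' = \<beta> * 2 powr q"
  have \<beta>': "\<beta>' > 0" using \<beta> by (simp add: \<beta>'_def)
  obtain M \<rho> \<Lambda> where
    decay: "\<And>\<mu> r. \<Lambda> \<le> \<mu> \<Longrightarrow> \<rho> < r \<Longrightarrow> r < 1 \<Longrightarrow>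
      emeasure lborel {x \<in> shell. M + \<mu> < norm (f (r *\<^sub>R sgn x))} \<le> ennreal (exp (- (\<beta>' * \<mu> powr q)))"
    and M: "0 \<le> M" "0 \<le> \<rho>" "\<rho> < 1" "0 < \<Lambda>"
    by (rule level_set_decay[OF f g dim fin supp \<beta>', folded q_def]) (rule that)
  obtain N where N: "{x \<in> space lborel. \<not> (x \<in> shell \<longrightarrow> (\<exists>l. has_radial_limit f l (sgn x)))} \<subseteq> N"
      "N \<in> null_sets lborel"
    using AE_radial_limit[OF f g fin1 supp] unfolding eventually_ae_filter by auto
  define C0 where "C0 = cone_const TYPE('a)"
  have C0: "0 \<le> C0" using cone_const_pos[where 'a = 'a] by (simp add: C0_def)
  define b where "b = measure lborel (ball (0::'a) 1)"
  have b: "emeasure lborel (ball (0::'a) 1) = ennreal b"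
    unfolding b_def by (rule emeasure_lborel_ball_eq)
  define C where "C = C0 * (b + 1)"
  have b0: "0 \<le> b" by (simp add: b_def)
  have C: "0 \<le> C" "C0 * b \<le> C" "C0 \<le> C" using C0 b0 by (auto simp: C_def algebra_simps)
  show thesis
  proof (rule that[of "2 * (M + \<Lambda>)" C])
    show "0 \<le> C" "0 < 2 * (M + \<Lambda>)" using C M by auto
    have "hausdorff_outer_measure (DIM('a) - 1) (sphere (0::'a) 1) \<le> ennreal C0 * emeasure lebesgue (ball (0::'a) 1)"
      unfolding C0_def by (rule hausdorff_outer_measure_le_cone) auto
    also have "\<dots> = ennreal (C0 * b)" using C0 b by (simp add: ennreal_mult b0)
    also have "\<dots> \<le> ennreal C" using C by (intro ennreal_leI)
    finally show "hausdorff_outer_measure (DIM('a) - 1) (sphere (0::'a) 1) \<le> ennreal C" .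
    fix t assume t: "2 * (M + \<Lambda>) \<le> t"
    define \<mu> where "\<mu> = t / 2"
    have \<mu>: "\<Lambda> \<le> \<mu>" "M + \<mu> \<le> t" using t M by (auto simp: \<mu>_def)
    obtain j0 :: nat where j0: "inverse (real (Suc j0)) < 1 - \<rho>"
      using reals_Archimedean[of "1 - \<rho>"] M by auto
    define r where "r j = 1 - inverse (real (Suc (j0 + j)))" for j :: nat
    have r: "\<rho> < r j" "r j < 1" for j
    proof -
      have "inverse (real (Suc (j0 + j))) \<le> inverse (real (Suc j0))" by (simp add: field_simps)
      then show "\<rho> < r j" using j0 unfolding r_def by linarith
    qed (simp add: r_def)
    define X where "X j = {x \<in> shell. M + \<mu> < norm (f (r j *\<^sub>R sgn x))}" for j
    have Xb: "X j \<in> sets borel" for j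
      unfolding X_def using r[of j] M by (intro borel_open open_radial_level_set f) auto
    have Xle: "emeasure lborel (X j) \<le> ennreal (exp (- (\<beta>' * \<mu> powr q)))" for j
      unfolding X_def by (rule decay[OF \<mu>(1) r])
    define Y where "Y i = (\<Inter>j\<in>{i..}. X j)" for i
    have Yb: "Y i \<in> sets borel" for i unfolding Y_def using Xb by (intro sets.countable_INT') auto
    have "emeasure lborel (\<Union>i. Y i) = (SUP i. emeasure lborel (Y i))"
      using Yb by (intro SUP_emeasure_incseq[symmetric]) (auto simp: incseq_def Y_def)
    also have "\<dots> \<le> ennreal (exp (- (\<beta>' * \<mu> powr q)))"
    proof (rule SUP_least)
      fix i
      have "emeasure lborel (Y i) \<le> emeasure lborel (X i)"
        using Xb by (intro emeasure_mono) (auto simp: Y_def)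
      also note Xle
      finally show "emeasure lborel (Y i) \<le> ennreal (exp (- (\<beta>' * \<mu> powr q)))" .
    qed
    finally have Yle: "emeasure lborel (\<Union>i. Y i) \<le> ennreal (exp (- (\<beta>' * \<mu> powr q)))" .
    have Nb: "N \<in> sets borel" using N(2) by auto
    let ?W = "(\<Union>i. Y i) \<union> N"
    have Wb: "?W \<in> sets borel" using Yb Nb by auto
    have "hausdorff_outer_measure (DIM('a) - 1) {\<zeta> \<in> sphere 0 1. t < norm (radial_limit f \<zeta>)}
        \<le> ennreal C0 * emeasure lebesgue ?W"
      unfolding C0_def
    proof (rule hausdorff_outer_measure_le_cone)
      show "?W \<in> sets lebesgue" using Wb by (simp add: sets_completionI_sets)
      fix \<zeta> :: 'a and u :: real
      assume \<zeta>: "\<zeta> \<in> {\<zeta> \<in> sphere 0 1. t < norm (radial_limit f \<zeta>)}" and u: "u \<in> {5/8..7/8}"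
      then have sh: "u *\<^sub>R \<zeta> \<in> shell" "sgn (u *\<^sub>R \<zeta>) = \<zeta>" using ray_in_shell[of \<zeta> u] by auto
      show "u *\<^sub>R \<zeta> \<in> ?W"
      proof (cases "\<exists>l. has_radial_limit f l \<zeta>")
        case False
        then show ?thesis using sh N(1) by auto
      next
        case True
        then obtain l where l: "has_radial_limit f l \<zeta>" by blast
        then have "M + \<mu> < norm l" using \<zeta> \<mu>(2) radial_limit_eq[OF l] by auto
        moreover have "((\<lambda>s. norm (f (s *\<^sub>R \<zeta>))) \<longlongrightarrow> norm l) (at_left 1)"
          using l unfolding has_radial_limit_def by (rule tendsto_norm)
        ultimately have "\<forall>\<^sub>F s in at_left 1. M + \<mu> < norm (f (s *\<^sub>R \<zeta>))"
          by (intro order_tendstoD(1))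
        then obtain c where c: "c < 1" "\<And>s. c < s \<Longrightarrow> s < 1 \<Longrightarrow> M + \<mu> < norm (f (s *\<^sub>R \<zeta>))"
          unfolding eventually_at_left_field by blast
        obtain i where i: "inverse (real (Suc i)) < 1 - c" using reals_Archimedean[of "1 - c"] c by auto
        have "u *\<^sub>R \<zeta> \<in> X j" if "i \<le> j" for j
        proof -
          have "inverse (real (Suc (j0 + j))) \<le> inverse (real (Suc i))" using that by (simp add: field_simps)
          then have "c < r j" using i unfolding r_def by linarith
          then show ?thesis using c(2)[of "r j"] r(2)[of j] sh by (simp add: X_def)
        qed
        then show ?thesis by (auto simp: Y_def)
      qed
    qed auto
    also have "emeasure lebesgue ?W = emeasure lborel ?W"
      using Wb by simp
    also have "\<dots> = emeasure lborel (\<Union>i. Y i)"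
      using N(2) Yb by (intro emeasure_Un_null_set) auto
    also have "ennreal C0 * \<dots> \<le> ennreal C * ennreal (exp (- (\<beta>' * \<mu> powr q)))"
      using C Yle by (intro mult_mono ennreal_leI) auto
    also have "\<dots> = ennreal (C * exp (- (\<beta> * t powr q)))"
    proof -
      have "2 powr q * \<mu> powr q = t powr q"
        using M t by (subst powr_mult[symmetric]) (auto simp: \<mu>_def)
      then have "\<beta>' * \<mu> powr q = \<beta> * t powr q" by (simp add: \<beta>'_def mult.assoc)
      then show ?thesis using C(1) by (simp add: ennreal_mult)
    qed
    finally show "hausdorff_outer_measure (DIM('a) - 1) {\<zeta> \<in> sphere 0 1. t < norm (radial_limit f \<zeta>)}
        \<le> ennreal (C * exp (- (\<beta> * t powr q)))" .
  qed
qed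

text \<open>
  The decay with constant \<open>2 \<beta>\<close> bounds the measure of the set where the integrand exceeds \<open>2\<^sup>k\<close> by a
  multiple of \<open>4\<^sup>-\<^sup>k\<close>, which beats the factor \<open>2\<^sup>k\<close> of the dyadic layer.
\<close>

lemma nn_integral_exp_radial_limit_finite:
  fixes f :: "'a::euclidean_space \<Rightarrow> 'b::banach"
  defines "q \<equiv> real DIM('a) / (real DIM('a) - 1)"
  assumes f: "continuous_on (ball 0 1) f" and g: "mollified_upper_gradient f g"
    and dim: "DIM('a) \<ge> 2" and fin1: "(\<integral>\<^sup>+y. g y \<partial>lborel) < \<infinity>"
    and fin: "(\<integral>\<^sup>+y. g y ^ DIM('a) \<partial>lborel) < \<infinity>" and supp: "AE y in lborel. g y \<noteq> 0 \<longrightarrow> norm y < 1"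
    and \<beta>: "\<beta> > 0"
  shows "(\<integral>\<^sup>+\<zeta>\<in>sphere 0 1. ennreal (exp (\<beta> * norm (radial_limit f \<zeta>) powr q))
            \<partial>hausdorff_measure (DIM('a) - 1)) < \<infinity>"
proof -
  let ?H = "hausdorff_measure (DIM('a) - 1) :: 'a measure"
  let ?out = "hausdorff_outer_measure (DIM('a) - 1) :: 'a set \<Rightarrow> ennreal"
  let ?\<phi> = "\<lambda>\<zeta>. ennreal (exp (\<beta> * norm (radial_limit f \<zeta>) powr q)) * indicator (sphere 0 1) \<zeta>"
  have q: "q \<ge> 1" using dim by (simp add: q_def field_simps)
  have \<beta>2: "2 * \<beta> > 0" using \<beta> by simp
  obtain C t0 where
    decay: "\<And>t. t0 \<le> t \<Longrightarrow> ?out {\<zeta> \<in> sphere 0 1. t < norm (radial_limit f \<zeta>)}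
        \<le> ennreal (C * exp (- (2 * \<beta> * t powr q)))"
    and sph: "?out (sphere 0 1) \<le> ennreal C" and C: "0 \<le> C" "0 < t0"
    by (rule hausdorff_radial_limit_level_decay[OF f g dim fin1 fin supp \<beta>2, folded q_def]) (rule that)
  define t where "t k = (real k * ln 2 / \<beta>) powr (1 / q)" for k :: nat
  have tq: "t k powr q = real k * ln 2 / \<beta>" for k
    using q \<beta> by (simp add: t_def powr_powr)
  have level: "?out {\<zeta>. 2 ^ k < ?\<phi> \<zeta>} \<le> ?out {\<zeta> \<in> sphere 0 1. t k < norm (radial_limit f \<zeta>)}" for k
  proof (rule hausdorff_outer_measure_mono, rule subsetI)
    fix \<zeta> :: 'a assume "\<zeta> \<in> {\<zeta>. 2 ^ k < ?\<phi> \<zeta>}"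
    then have lt: "2 ^ k < ?\<phi> \<zeta>" by simp
    then have sp: "\<zeta> \<in> sphere 0 1" by (cases "\<zeta> \<in> sphere 0 1") auto
    let ?u = "norm (radial_limit f \<zeta>)"
    have "(2::ennreal) ^ k = ennreal (2 ^ k)" by (simp add: ennreal_power[symmetric])
    then have "2 ^ k < exp (\<beta> * ?u powr q)" using lt sp by (simp add: ennreal_less_iff)
    moreover have "(2::real) ^ k = exp (real k * ln 2)" by (simp add: exp_of_nat_mult)
    ultimately have "real k * ln 2 < \<beta> * ?u powr q" by simp
    then have "t k powr q < ?u powr q" unfolding tq using \<beta> by (simp add: field_simps)
    then have "t k < ?u" using q by (meson norm_ge_zero not_less powr_mono2 order_trans zero_le_one)
    then show "\<zeta> \<in> {\<zeta> \<in> sphere 0 1. t k < norm (radial_limit f \<zeta>)}" using sp by simp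
  qed
  have "0 < ln 2 / \<beta>" using \<beta> by simp
  then obtain k0 :: nat where k0: "t0 powr q < real k0 * (ln 2 / \<beta>)"
    using ex_less_of_nat_mult by blast
  \<comment> \<open>Large enough to cover the finitely many levels below the range of the decay estimate.\<close>
  define B where "B = C * 4 ^ k0"
  have B: "0 \<le> B" "C \<le> B" using C mult_left_mono[of 1 "4 ^ k0" C] by (auto simp: B_def)
  have bound: "?out {\<zeta>. 2 ^ k < ?\<phi> \<zeta>} \<le> ennreal (B * (1/4) ^ k)" for k
  proof (cases "k0 \<le> k")
    case True
    have "t0 powr q \<le> t k powr q"
    proof -
      have "real k0 * (ln 2 / \<beta>) \<le> real k * (ln 2 / \<beta>)" using True \<beta> by (intro mult_right_mono) auto
      then show ?thesis using k0 unfolding tq by simp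
    qed
    then have "t0 \<le> t k"
      using q C(2) powr_less_mono2[of q "t k" t0] by (auto simp: t_def not_less[symmetric])
    then have "?out {\<zeta> \<in> sphere 0 1. t k < norm (radial_limit f \<zeta>)} \<le> ennreal (C * exp (- (2 * \<beta> * t k powr q)))"
      by (rule decay)
    also have "exp (- (2 * \<beta> * t k powr q)) = (1/4) ^ k"
    proof -
      have "- (2 * \<beta> * t k powr q) = real k * (- (2 * ln 2))" unfolding tq using \<beta> by simp
      moreover have "exp (- (2 * ln 2)) = (1/4::real)"
        by (simp add: exp_minus exp_double power2_eq_square)
      ultimately show ?thesis by (simp only: exp_of_nat_mult)
    qed
    also have "ennreal (C * (1/4) ^ k) \<le> ennreal (B * (1/4) ^ k)"
      using B by (intro ennreal_leI mult_right_mono) auto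
    finally show ?thesis using level order_trans by blast
  next
    case False
    have "?out {\<zeta>. 2 ^ k < ?\<phi> \<zeta>} \<le> ?out (sphere 0 1)"
      by (rule hausdorff_outer_measure_mono) (auto simp: indicator_def split: if_splits)
    also note sph
    also have "ennreal C \<le> ennreal (B * (1/4) ^ k)"
    proof (rule ennreal_leI)
      have "1 \<le> (4::real) ^ (k0 - k)" by simp
      also have "\<dots> = 4 ^ k0 * (1/4) ^ k" using False by (simp add: power_diff power_divide)
      finally show "C \<le> B * (1/4) ^ k" unfolding B_def using C(1) mult_left_mono[of 1 "4 ^ k0 * (1/4) ^ k" C] by (simp add: mult.assoc)
    qed
    finally show ?thesis .
  qed
  have "(\<integral>\<^sup>+\<zeta>. ?\<phi> \<zeta> \<partial>?H) \<le> ennreal C + (\<Sum>k. 2 ^ Suc k * ennreal (B * (1/4) ^ k))"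
  proof (rule nn_integral_le_dyadic_layers)
    show "?\<phi> \<zeta> < top" for \<zeta> by (simp add: indicator_def)
    fix A assume A: "A \<in> sets ?H" "A \<subseteq> {\<zeta>. 0 < ?\<phi> \<zeta>}"
    have "emeasure ?H A = ?out A" using A(1) by (rule emeasure_hausdorff_measure)
    also have "\<dots> \<le> ?out (sphere 0 1)"
    proof (intro hausdorff_outer_measure_mono subsetI)
      fix \<zeta> assume "\<zeta> \<in> A"
      then have "0 < ?\<phi> \<zeta>" using A(2) by blast
      then show "\<zeta> \<in> sphere 0 1" by (cases "\<zeta> \<in> sphere 0 1") auto
    qed
    also note sph
    finally show "emeasure ?H A \<le> ennreal C" .
  next
    fix A k assume A: "A \<in> sets ?H" "A \<subseteq> {\<zeta>. 2 ^ k < ?\<phi> \<zeta>}"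
    have "emeasure ?H A = ?out A" using A(1) by (rule emeasure_hausdorff_measure)
    also have "\<dots> \<le> ?out {\<zeta>. 2 ^ k < ?\<phi> \<zeta>}" using A(2) by (rule hausdorff_outer_measure_mono)
    also note bound
    finally show "emeasure ?H A \<le> ennreal (B * (1/4) ^ k)" .
  qed
  also have "(\<Sum>k. 2 ^ Suc k * ennreal (B * (1/4) ^ k)) = (\<Sum>k. ennreal (2 * B * (1/2) ^ k))"
  proof (rule suminf_cong)
    fix k :: nat
    have "2 ^ Suc k * ennreal (B * (1/4) ^ k) = ennreal (2 ^ Suc k) * ennreal (B * (1/4) ^ k)"
      by (simp only: ennreal_power[symmetric] ennreal_numeral zero_le_numeral)
    also have "\<dots> = ennreal (2 ^ Suc k * (B * (1/4) ^ k))" using B by (intro ennreal_mult''[symmetric]) auto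
    also have "2 ^ Suc k * (B * (1/4) ^ k) = 2 * B * (1/2) ^ k"
    proof -
      have "(2::real) ^ k * (1/4) ^ k = (1/2) ^ k" by (simp flip: power_mult_distrib)
      then show ?thesis by (simp add: mult_ac)
    qed
    finally show "2 ^ Suc k * ennreal (B * (1/4) ^ k) = ennreal (2 * B * (1/2) ^ k)" .
  qed
  also have "\<dots> = ennreal (2 * B * (1 / (1 - 1/2)))"
    using B by (intro suminf_ennreal_eq sums_mult geometric_sums) auto
  also have "ennreal C + \<dots> < \<infinity>" by simp
  finally show ?thesis .
qed

theorem mainTheorem5:
  fixes f :: "real^'n \<Rightarrow> real^'n" and K :: real
  assumes "CARD('n) \<ge> 2"
    and "K \<ge> 1"
    and "quasiregular K (ball 0 1) f"
    and "f 0 = 0"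
    and "(\<integral>\<^sup>+x\<in>ball 0 1. ennreal (weak_jacobian (ball 0 1) f x) \<partial>lebesgue)
           \<le> emeasure lebesgue (ball (0 :: real^'n) 1)"
  shows "(AE \<zeta> in hausdorff_measure (CARD('n) - 1). \<zeta> \<in> sphere 0 1 \<longrightarrow>
            (\<exists>l. has_radial_limit f l \<zeta>)) \<and>
         (\<forall>\<beta>>0. (\<integral>\<^sup>+\<zeta>\<in>sphere 0 1.
            ennreal (exp (\<beta> * norm (radial_limit f \<zeta>) powr (real CARD('n) / (real CARD('n) - 1))))
              \<partial>hausdorff_measure (CARD('n) - 1)) < \<infinity>)"
proof -
  let ?n = "CARD('n)"
  define D where "D = weak_derivative (ball 0 1) f"
  have cont: "continuous_on (ball 0 1) f"
    and qr: "AE x in lebesgue. x \<in> ball 0 1 \<longrightarrow> onorm ((*v) (D x)) ^ ?n \<le> K * det (D x)"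
    using assms(3) by (auto simp: quasiregular_def weak_jacobian_def D_def)
  have wd: "has_weak_derivative f D (ball 0 1)"
  proof -
    have "\<exists>D. has_weak_derivative f D (ball 0 1)"
      using assms(3) by (auto simp: quasiregular_def sobolev_W1p_loc_def)
    then show ?thesis unfolding D_def weak_derivative_def by (rule someI_ex)
  qed
  obtain g where g: "mollified_upper_gradient f g"
    and g_eq: "AE y in lebesgue. g y = ennreal (\<Sum>i\<in>UNIV. \<Sum>j\<in>UNIV. \<bar>(indicator (ball 0 1) y *\<^sub>R D y) $ i $ j\<bar>)"
    by (rule mollified_upper_gradient_weak_derivative[OF cont wd]) (rule that)
  have [measurable]: "g \<in> borel_measurable borel" using g by (simp add: mollified_upper_gradient_def)
  define c where "c = (real ?n * real ?n) ^ ?n * K"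
  have c: "0 \<le> c" using assms(2) by (simp add: c_def)
  let ?S = "\<lambda>y. (\<Sum>i\<in>UNIV. \<Sum>j\<in>UNIV. \<bar>(indicator (ball 0 1) y *\<^sub>R D y) $ i $ j\<bar>)"
  have energy_pt: "AE y in lebesgue. g y ^ ?n \<le> ennreal c * (ennreal (det (D y)) * indicator (ball 0 1) y)
      \<and> (g y \<noteq> 0 \<longrightarrow> norm y < 1)"
    using g_eq qr
  proof eventually_elim
    case (elim y)
    show ?case
    proof (cases "y \<in> ball 0 1")
      case True
      have o0: "0 \<le> onorm ((*v) (D y))" by (simp add: onorm_pos_le matrix_vector_mul_bounded_linear)
      have "?S y \<le> (\<Sum>i\<in>(UNIV::'n set). \<Sum>j\<in>(UNIV::'n set). onorm ((*v) (D y)))"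
        using True by (intro sum_mono) (simp add: matrix_component_le_onorm)
      also have "\<dots> = real ?n * real ?n * onorm ((*v) (D y))" by simp
      finally have "?S y ^ ?n \<le> (real ?n * real ?n * onorm ((*v) (D y))) ^ ?n"
        by (rule power_mono) (simp add: sum_nonneg)
      also have "\<dots> = (real ?n * real ?n) ^ ?n * onorm ((*v) (D y)) ^ ?n" by (rule power_mult_distrib)
      also have "\<dots> \<le> (real ?n * real ?n) ^ ?n * (K * det (D y))"
        using elim(2) True by (intro mult_left_mono) auto
      finally have le: "?S y ^ ?n \<le> c * det (D y)"
        by (simp add: c_def mult.assoc)
      have "g y ^ ?n = ennreal (?S y ^ ?n)"
        unfolding elim(1) by (intro ennreal_power) (simp add: sum_nonneg)
      also have "\<dots> \<le> ennreal (c * det (D y))" by (rule ennreal_leI[OF le])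
      also have "\<dots> = ennreal c * ennreal (det (D y))" by (rule ennreal_mult'[OF c])
      finally show ?thesis using True by simp
    next
      case False
      then have "g y = 0" unfolding elim(1) by simp
      then show ?thesis by (simp add: zero_power)
    qed
  qed
  have n0: "0 < ?n" by simp
  \<comment> \<open>Multiplying by the indicator inside the determinant is harmless and makes the entries measurable.\<close>
  have mdet: "(\<lambda>y. ennreal (det (D y)) * indicator (ball 0 1) y) \<in> borel_measurable lebesgue"
  proof -
    note borel_measurable_weak_derivative_entry[OF wd, measurable]
    have "(\<lambda>y. ennreal (det (indicator (ball 0 1) y *\<^sub>R D y))) \<in> borel_measurable lebesgue"
      unfolding det_def by measurable
    moreover have "ennreal (det (indicator (ball 0 1) y *\<^sub>R D y)) = ennreal (det (D y)) * indicator (ball 0 1) y" for y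
      by (cases "y \<in> ball 0 1") (auto simp: det_0[unfolded mat_0])
    ultimately show ?thesis by simp
  qed
  have "(\<integral>\<^sup>+y. g y ^ ?n \<partial>lborel) = (\<integral>\<^sup>+y. g y ^ ?n \<partial>lebesgue)"
    by (rule nn_integral_completion[symmetric])
  also have "\<dots> \<le> (\<integral>\<^sup>+y. ennreal c * (ennreal (det (D y)) * indicator (ball 0 1) y) \<partial>lebesgue)"
    using energy_pt by (intro nn_integral_mono_AE) auto
  also have "\<dots> = ennreal c * (\<integral>\<^sup>+y. ennreal (det (D y)) * indicator (ball 0 1) y \<partial>lebesgue)"
    by (rule nn_integral_cmult[OF mdet])
  also have "\<dots> \<le> ennreal c * emeasure lebesgue (ball (0 :: real^'n) 1)"
    using assms(5) by (intro mult_left_mono) (auto simp: weak_jacobian_def D_def)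
  also have "\<dots> < \<infinity>"
    using emeasure_lborel_ball_finite[of "0 :: real^'n" 1] by (simp add: ennreal_mult_less_top)
  finally have fin: "(\<integral>\<^sup>+y. g y ^ ?n \<partial>lborel) < \<infinity>" .
  have supp: "AE y in lborel. g y \<noteq> 0 \<longrightarrow> norm y < 1"
  proof -
    have "AE y in lebesgue. g y \<noteq> 0 \<longrightarrow> norm y < 1" using energy_pt by eventually_elim simp
    then show ?thesis by (simp add: AE_completion_iff)
  qed
  have "(\<integral>\<^sup>+y. g y \<partial>lborel) \<le> (\<integral>\<^sup>+y. indicator (ball 0 1) y + g y ^ ?n \<partial>lborel)"
  proof (rule nn_integral_mono_AE, use supp in eventually_elim)
    case (elim y)
    show ?case
    proof (cases "g y = 0")
      case False
      have "g y \<le> ennreal 1 + ennreal (inverse (1 ^ (?n - 1))) * g y ^ ?n"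
        using n0 by (intro ennreal_le_truncation) auto
      then show ?thesis using elim False by simp
    qed simp
  qed
  also have "\<dots> = emeasure lborel (ball (0 :: real^'n) 1) + (\<integral>\<^sup>+y. g y ^ ?n \<partial>lborel)"
    by (subst nn_integral_add) (auto intro!: borel_measurable_indicator)
  also have "\<dots> < \<infinity>"
    using fin emeasure_lborel_ball_finite[of "0 :: real^'n" 1] by simp
  finally have fin1: "(\<integral>\<^sup>+y. g y \<partial>lborel) < \<infinity>" .
  have dim: "DIM(real^'n) = ?n" by simp
  have "{\<zeta> \<in> sphere 0 1. \<not> (\<exists>l. has_radial_limit f l \<zeta>)} \<in> null_sets (hausdorff_measure (?n - 1))"
    using hausdorff_radial_limit_exceptional_null[OF cont g fin1 supp] unfolding dim .
  then have "AE \<zeta> in hausdorff_measure (?n - 1). \<zeta> \<in> sphere 0 1 \<longrightarrow> (\<exists>l. has_radial_limit f l \<zeta>)"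
    by (rule AE_I') auto
  moreover have "(\<integral>\<^sup>+\<zeta>\<in>sphere 0 1. ennreal (exp (\<beta> * norm (radial_limit f \<zeta>) powr (real ?n / (real ?n - 1))))
              \<partial>hausdorff_measure (?n - 1)) < \<infinity>" if "\<beta> > 0" for \<beta>
    using nn_integral_exp_radial_limit_finite[OF cont g _ fin1 _ supp that] fin assms(1) unfolding dim by simp
  ultimately show ?thesis by blast
qed

end
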